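(* Let $p$ be a prime number, $G$ a transitive group of degree $n\in p\mathbb{Z}\setminus p^{2}\mathbb{Z}$, and $H$ a corresponding subgroup of $G$. Assume that a $p$-Sylow subgroup $S_{p}$ of $G$ is normal in $G$. (i) One has $\operatorname{Sha}_{\omega}^{2}(G,J_{G/H})[p^{\infty}]\neq 0$ if and only if (a) $S_{p}\cong (C_{p})^{2}$; (b) $[S_{p},G]=S_{p}$; and (c) $N_{G}(S_{p}\cap H)=Z_{G}(S_{p}\cap H)$. Conversely, if (a), (b) and (c) hold, then for every admissible set $\mathcal{D}$ of subgroups of $G$, $\operatorname{Sha}_{\mathcal{D}}^{2}(G,J_{G/H})[p^{\infty}]$ is $0$ if some $D\in\mathcal{D}$ contains $S_{p}$, and is isomorphic to $\mathbb{Z}/p$ otherwise. (ii) For every admissible set $\mathcal{D}$ of subgroups of $G$, $\operatorname{Sha}_{\mathcal{D}}^{2}(G,J_{G/H})^{(p)}\cong \operatorname{Sha}_{\mathcal{D}_{/S_{p}}}^{2}(G/S_{p},J_{G/HS_{p}})$, where $\mathcal{D}_{/S_{p}}:=\{DS_{p}/S_{p}\mid D\in\mathcal{D}\}$.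
   Context: A transitive group of degree $n$ is a subgroup $G$ of the symmetric group $\mathfrak{S}_n$ acting transitively on $\{1,\dots,n\}$; a corresponding subgroup is a stabilizer $\mathrm{Stab}_G(i)$. For a finite group $G$ and subgroup $H$, $\operatorname{Ind}_H^G\mathbb{Z}:=\mathrm{Hom}_{\mathbb{Z}[H]}(\mathbb{Z}[G],\mathbb{Z})$ with $G$-action $(g\varphi)(g')=\varphi(g'g)$, and $J_{G/H}$ is the cokernel of the $G$-map $\mathbb{Z}\to\operatorname{Ind}_H^G\mathbb{Z}$ sending $1$ to the constant function $1$. For a set $\mathcal{D}$ of subgroups and a $G$-module $M$, $\operatorname{Sha}^2_{\mathcal{D}}(G,M):=\ker\big(H^2(G,M)\to\bigoplus_{D\in\mathcal{D}}H^2(D,M)\big)$ (restriction maps); $\operatorname{Sha}^2_\omega$ is the case where $\mathcal{D}$ is the set of all cyclic subgroups. A finite set $\mathcal{D}$ of subgroups of $G$ is admissible if it contains all cyclic subgroups of $G$ and is stable under conjugation. $J_{G/HS_p}$ is regarded as a $G/S_p$-lattice. $A[p^\infty]$, $A^{(p)}$ denote $p$-primary and prime-to-$p$ torsion parts; $[A,B]$ is the commutator subgroup generated by $aba^{-1}b^{-1}$; $N_G$, $Z_G$ are normalizer and centralizer. *)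

theory Defs
  imports "HOL-Algebra.Sym_Groups" "HOL-Algebra.Group_Action" "HOL-Algebra.Elementary_Groups"
    "HOL-Algebra.Product_Groups" "HOL-Computational_Algebra.Primes"
begin

section \<open>Transitive groups and subgroups\<close>

definition transitive_group :: "nat \<Rightarrow> (nat \<Rightarrow> nat) monoid \<Rightarrow> bool" where
  "transitive_group n G \<longleftrightarrow>
     G = (sym_group n)\<lparr>carrier := carrier G\<rparr> \<and> subgroup (carrier G) (sym_group n) \<and>
     (\<forall>i\<in>{1..n}. \<forall>j\<in>{1..n}. \<exists>g\<in>carrier G. g i = j)"

definition corresponding_subgroup :: "nat \<Rightarrow> (nat \<Rightarrow> nat) monoid \<Rightarrow> (nat \<Rightarrow> nat) set \<Rightarrow> bool" where
  "corresponding_subgroup n G H \<longleftrightarrow> (\<exists>i\<in>{1..n}. H = stabilizer G (\<lambda>g. g) i)"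

definition sylow_subgroup :: "nat \<Rightarrow> ('a, 'x) monoid_scheme \<Rightarrow> 'a set \<Rightarrow> bool" where
  "sylow_subgroup p G S \<longleftrightarrow> subgroup S G \<and> card S = p ^ multiplicity p (order G)"

definition commutator_subgroup :: "('a, 'x) monoid_scheme \<Rightarrow> 'a set \<Rightarrow> 'a set \<Rightarrow> 'a set" where
  "commutator_subgroup G A B =
     generate G {a \<otimes>\<^bsub>G\<^esub> b \<otimes>\<^bsub>G\<^esub> inv\<^bsub>G\<^esub> a \<otimes>\<^bsub>G\<^esub> inv\<^bsub>G\<^esub> b | a b. a \<in> A \<and> b \<in> B}"

definition centralizer :: "('a, 'x) monoid_scheme \<Rightarrow> 'a set \<Rightarrow> 'a set" where
  "centralizer G K = {g \<in> carrier G. \<forall>k\<in>K. g \<otimes>\<^bsub>G\<^esub> k = k \<otimes>\<^bsub>G\<^esub> g}"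

definition cyclic_subgroups :: "('a, 'x) monoid_scheme \<Rightarrow> 'a set set" where
  "cyclic_subgroups G = {generate G {g} | g. g \<in> carrier G}"

definition admissible :: "('a, 'x) monoid_scheme \<Rightarrow> 'a set set \<Rightarrow> bool" where
  "admissible G \<D> \<longleftrightarrow>
     finite \<D> \<and> (\<forall>D\<in>\<D>. subgroup D G) \<and> cyclic_subgroups G \<subseteq> \<D> \<and>
     (\<forall>D\<in>\<D>. \<forall>g\<in>carrier G. g <#\<^bsub>G\<^esub> D #>\<^bsub>G\<^esub> inv\<^bsub>G\<^esub> g \<in> \<D>)"

definition quotient_subgroups :: "('a, 'x) monoid_scheme \<Rightarrow> 'a set \<Rightarrow> 'a set set \<Rightarrow> 'a set set set" where
  "quotient_subgroups G S \<D> =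
     (\<lambda>D. carrier ((G\<lparr>carrier := D <#>\<^bsub>G\<^esub> S\<rparr>) Mod S)) ` \<D>"

definition primary_part :: "nat \<Rightarrow> ('a, 'x) monoid_scheme \<Rightarrow> ('a, 'x) monoid_scheme" where
  "primary_part p A =
     A\<lparr>carrier := {x \<in> carrier A. \<exists>k::nat. x [^]\<^bsub>A\<^esub> (p ^ k) = \<one>\<^bsub>A\<^esub>}\<rparr>"

definition prime_to_part :: "nat \<Rightarrow> ('a, 'x) monoid_scheme \<Rightarrow> ('a, 'x) monoid_scheme" where
  "prime_to_part p A =
     A\<lparr>carrier := {x \<in> carrier A. \<exists>m::nat. m > 0 \<and> coprime m p \<and> x [^]\<^bsub>A\<^esub> m = \<one>\<^bsub>A\<^esub>}\<rparr>"


section \<open>Second cohomology\<close>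

text \<open>
  A \<open>G\<close>-module consists of an abelian group \<open>M\<close>, written multiplicatively,
  and an action \<open>act\<close>. Cohomology is that of the complex of inhomogeneous cochains.
\<close>

definition cochains1 :: "('g, 'x) monoid_scheme \<Rightarrow> ('m, 'y) monoid_scheme \<Rightarrow> ('g \<Rightarrow> 'm) monoid" where
  "cochains1 G M = product_group (carrier G) (\<lambda>_. M)"

definition cochains2 ::
    "('g, 'x) monoid_scheme \<Rightarrow> ('m, 'y) monoid_scheme \<Rightarrow> ('g \<times> 'g \<Rightarrow> 'm) monoid" where
  "cochains2 G M = product_group (carrier G \<times> carrier G) (\<lambda>_. M)"

definition cochains3 ::
    "('g, 'x) monoid_scheme \<Rightarrow> ('m, 'y) monoid_scheme \<Rightarrow> ('g \<times> 'g \<times> 'g \<Rightarrow> 'm) monoid" where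
  "cochains3 G M = product_group (carrier G \<times> carrier G \<times> carrier G) (\<lambda>_. M)"

definition diff1 ::
    "('g, 'x) monoid_scheme \<Rightarrow> ('m, 'y) monoid_scheme \<Rightarrow> ('g \<Rightarrow> 'm \<Rightarrow> 'm) \<Rightarrow>
     ('g \<Rightarrow> 'm) \<Rightarrow> 'g \<times> 'g \<Rightarrow> 'm" where
  "diff1 G M act b =
     (\<lambda>(g, h) \<in> carrier G \<times> carrier G.
        act g (b h) \<otimes>\<^bsub>M\<^esub> inv\<^bsub>M\<^esub> b (g \<otimes>\<^bsub>G\<^esub> h) \<otimes>\<^bsub>M\<^esub> b g)"

definition diff2 ::
    "('g, 'x) monoid_scheme \<Rightarrow> ('m, 'y) monoid_scheme \<Rightarrow> ('g \<Rightarrow> 'm \<Rightarrow> 'm) \<Rightarrow>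
     ('g \<times> 'g \<Rightarrow> 'm) \<Rightarrow> 'g \<times> 'g \<times> 'g \<Rightarrow> 'm" where
  "diff2 G M act c =
     (\<lambda>(g, h, k) \<in> carrier G \<times> carrier G \<times> carrier G.
        act g (c (h, k)) \<otimes>\<^bsub>M\<^esub> inv\<^bsub>M\<^esub> c (g \<otimes>\<^bsub>G\<^esub> h, k)
          \<otimes>\<^bsub>M\<^esub> c (g, h \<otimes>\<^bsub>G\<^esub> k) \<otimes>\<^bsub>M\<^esub> inv\<^bsub>M\<^esub> c (g, h))"

definition cocycles2 ::
    "('g, 'x) monoid_scheme \<Rightarrow> ('m, 'y) monoid_scheme \<Rightarrow> ('g \<Rightarrow> 'm \<Rightarrow> 'm) \<Rightarrow>
     ('g \<times> 'g \<Rightarrow> 'm) monoid" where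
  "cocycles2 G M act =
     (cochains2 G M)\<lparr>carrier := kernel (cochains2 G M) (cochains3 G M) (diff2 G M act)\<rparr>"

definition coboundaries2 ::
    "('g, 'x) monoid_scheme \<Rightarrow> ('m, 'y) monoid_scheme \<Rightarrow> ('g \<Rightarrow> 'm \<Rightarrow> 'm) \<Rightarrow>
     ('g \<times> 'g \<Rightarrow> 'm) set" where
  "coboundaries2 G M act = diff1 G M act ` carrier (cochains1 G M)"

definition H2 ::
    "('g, 'x) monoid_scheme \<Rightarrow> ('m, 'y) monoid_scheme \<Rightarrow> ('g \<Rightarrow> 'm \<Rightarrow> 'm) \<Rightarrow>
     ('g \<times> 'g \<Rightarrow> 'm) set monoid" where
  "H2 G M act = cocycles2 G M act Mod coboundaries2 G M act"

text \<open>
  The class of a cocycle is sent to the class of its restriction to \<open>D\<close>; all members of a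
  class give the same value, which \<^const>\<open>the_elem\<close> extracts.
\<close>

definition res2 ::
    "('g, 'x) monoid_scheme \<Rightarrow> ('m, 'y) monoid_scheme \<Rightarrow> ('g \<Rightarrow> 'm \<Rightarrow> 'm) \<Rightarrow> 'g set \<Rightarrow>
     ('g \<times> 'g \<Rightarrow> 'm) set \<Rightarrow> ('g \<times> 'g \<Rightarrow> 'm) set" where
  "res2 G M act D x =
     the_elem ((\<lambda>c. r_coset (cocycles2 (G\<lparr>carrier := D\<rparr>) M act)
                         (coboundaries2 (G\<lparr>carrier := D\<rparr>) M act)
                         (restrict c (D \<times> D))) ` x)"

definition Sha2 ::
    "('g, 'x) monoid_scheme \<Rightarrow> 'g set set \<Rightarrow> ('m, 'y) monoid_scheme \<Rightarrow> ('g \<Rightarrow> 'm \<Rightarrow> 'm) \<Rightarrow>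
     ('g \<times> 'g \<Rightarrow> 'm) set monoid" where
  "Sha2 G \<D> M act =
     (H2 G M act)
       \<lparr>carrier := kernel (H2 G M act)
          (sum_group \<D> (\<lambda>D. H2 (G\<lparr>carrier := D\<rparr>) M act))
          (\<lambda>x. \<lambda>D\<in>\<D>. res2 G M act D x)\<rparr>"

abbreviation Sha2_omega ::
    "('g, 'x) monoid_scheme \<Rightarrow> ('m, 'y) monoid_scheme \<Rightarrow> ('g \<Rightarrow> 'm \<Rightarrow> 'm) \<Rightarrow>
     ('g \<times> 'g \<Rightarrow> 'm) set monoid" where
  "Sha2_omega G M act \<equiv> Sha2 G (cyclic_subgroups G) M act"


section \<open>The lattice of a subgroup\<close>

text \<open>
  Elements of \<open>Hom\<^bsub>\<int>[H]\<^esub>(\<int>[G], \<int>)\<close> are given by their values on the basis \<open>G\<close> of \<open>\<int>[G]\<close>;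
  since \<open>H\<close> acts trivially on \<open>\<int>\<close>, equivariance reads \<open>\<phi> (h g) = \<phi> g\<close>.
\<close>

definition Ind_int :: "('a, 'x) monoid_scheme \<Rightarrow> 'a set \<Rightarrow> ('a \<Rightarrow> int) monoid" where
  "Ind_int G H =
     (product_group (carrier G) (\<lambda>_. integer_group))
       \<lparr>carrier := {\<phi> \<in> carrier G \<rightarrow>\<^sub>E UNIV. \<forall>h\<in>H. \<forall>g\<in>carrier G. \<phi> (h \<otimes>\<^bsub>G\<^esub> g) = \<phi> g}\<rparr>"

definition Ind_act :: "('a, 'x) monoid_scheme \<Rightarrow> 'a \<Rightarrow> ('a \<Rightarrow> int) \<Rightarrow> ('a \<Rightarrow> int)" where
  "Ind_act G g \<phi> = (\<lambda>g'\<in>carrier G. \<phi> (g' \<otimes>\<^bsub>G\<^esub> g))"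

definition J :: "('a, 'x) monoid_scheme \<Rightarrow> 'a set \<Rightarrow> ('a \<Rightarrow> int) set monoid" where
  "J G H = Ind_int G H Mod range (\<lambda>n::int. \<lambda>g\<in>carrier G. n)"

definition J_act :: "('a, 'x) monoid_scheme \<Rightarrow> 'a \<Rightarrow> ('a \<Rightarrow> int) set \<Rightarrow> ('a \<Rightarrow> int) set" where
  "J_act G g x = Ind_act G g ` x"

text \<open>
  The action of \<open>G Mod S\<close> induced by an action of \<open>G\<close> for which \<open>S\<close> acts trivially: all
  representatives of a coset act in the same way.
\<close>

definition quotient_act :: "('g \<Rightarrow> 'm \<Rightarrow> 'm) \<Rightarrow> 'g set \<Rightarrow> 'm \<Rightarrow> 'm" where
  "quotient_act act C m = the_elem ((\<lambda>g. act g m) ` C)"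

end

theory Submission
  imports Defs "HOL-Algebra.Multiplicative_Group" "HOL-Algebra.Zassenhaus"
begin

text \<open>
  Tensoring \<open>J\<close> with the exact sequence of \<open>\<int>\<close>, \<open>\<real>\<close> and the circle \<open>\<real>/\<int>\<close> identifies \<open>H\<^sup>2(G, J)\<close> with
  the first cohomology of \<open>\<real>/\<int>\<close>-valued functions on the right cosets of \<open>H\<close>, modulo constants.
  A class is thus a function \<open>b g x\<close>, left \<open>H\<close>-invariant in \<open>x\<close>, for which
  \<open>b g x + b h (x g) - b (g h) x\<close> does not depend on \<open>x\<close>; it is trivial iff \<open>b g x = m (x g) - m x + e g\<close>.

  Prime-to-\<open>p\<close> classes vanish on \<open>S\<close> and hence come from \<open>G/S\<close>, which gives (ii).

  Classes of \<open>p\<close>-power order are detected on \<open>S\<close>. The point stabilisers \<open>K\<^sub>x\<close> in \<open>S\<close> have index \<open>p\<close> and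
  intersect trivially, so \<open>S\<close> is elementary abelian. Local triviality on cyclic subgroups makes
  \<open>b k x\<close> independent of \<open>x\<close> among the \<open>x\<close> with \<open>k \<in> K\<^sub>x\<close>. This splits the obstruction cocycle on \<open>S\<close> and
  leaves compatible characters of the \<open>K\<^sub>x\<close>, which glue to a character of \<open>S\<close> unless \<open>S\<close> has order
  \<open>p\<^sup>2\<close>. In that case the \<open>G\<close>-invariant families of characters modulo \<open>G\<close>-invariant characters of
  \<open>S\<close> form a group of order \<open>p\<close> or \<open>1\<close>: it is nonzero exactly when the normaliser of \<open>K = S \<inter> H\<close>
  acts trivially on \<open>K\<close> and \<open>S\<close> has no nonzero invariant character, that is \<open>[S, G] = S\<close>. The transfer
  \<open>H \<rightarrow> K\<close> realises a nonzero element.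
\<close>

section \<open>Natural multiples and the circle group\<close>

primrec ntimes :: "nat \<Rightarrow> 'a::ab_group_add \<Rightarrow> 'a" (infixr "\<cdot>" 75) where
  "0 \<cdot> a = 0"
| "Suc n \<cdot> a = a + n \<cdot> a"

lemma ntimes_add_right: "n \<cdot> (a + b) = n \<cdot> a + n \<cdot> b"
  by (induction n) (auto simp: algebra_simps)

lemma ntimes_zero_right [simp]: "n \<cdot> (0::'a::ab_group_add) = 0"
  by (induction n) auto

lemma ntimes_minus_right: "n \<cdot> (- a) = - (n \<cdot> a)"
  by (induction n) (auto simp: algebra_simps)

lemma ntimes_diff_right: "n \<cdot> (a - b) = n \<cdot> a - n \<cdot> b"
  by (induction n) (auto simp: algebra_simps)

lemma ntimes_add_left: "(m + n) \<cdot> a = m \<cdot> a + n \<cdot> a"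
  by (induction m) (auto simp: algebra_simps)

lemma ntimes_mult: "(m * n) \<cdot> a = m \<cdot> n \<cdot> a"
  by (induction m) (auto simp: ntimes_add_left)

lemma ntimes_one [simp]: "Suc 0 \<cdot> a = a" "1 \<cdot> a = a"
  by auto

lemma ntimes_commute: "m \<cdot> n \<cdot> a = n \<cdot> m \<cdot> a"
  by (metis ntimes_mult mult.commute)

lemma ntimes_sum: "n \<cdot> (\<Sum>i\<in>I. f i) = (\<Sum>i\<in>I. n \<cdot> f i)"
  by (induction I rule: infinite_finite_induct) (auto simp: ntimes_add_right)

lemma sum_constant_ntimes: "(\<Sum>i\<in>I. a) = card I \<cdot> a"
  by (induction I rule: infinite_finite_induct) auto

lemma ntimes_real: "n \<cdot> (x::real) = real n * x"
  by (induction n) (auto simp: algebra_simps)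

lemma coprime_bezout_nat:
  fixes m n :: nat
  assumes "coprime m n" "0 < m"
  obtains x y where "x * m = y * n + 1"
  using bezout_nat[of m n] assms that by (auto simp: mult.commute)

lemma ntimes_coprime_left_inverse:
  fixes m n :: nat
  assumes "coprime m n" "0 < m"
  obtains u where "\<And>a::'a::ab_group_add. n \<cdot> a = 0 \<Longrightarrow> u \<cdot> m \<cdot> a = a"
proof -
  obtain u v where uv: "u * m = v * n + 1" using coprime_bezout_nat[OF assms] .
  have "u \<cdot> m \<cdot> a = a" if "n \<cdot> a = 0" for a :: 'a
    using that by (simp add: uv ntimes_add_left ntimes_mult flip: ntimes_mult[of u m])
  then show ?thesis using that by blast
qed

lemma ntimes_coprime_zero:
  fixes m n :: nat
  assumes "coprime m n" "m \<cdot> a = 0" "n \<cdot> a = 0"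
  shows "a = 0"
proof (cases "m = 0")
  case False
  then obtain u where "u \<cdot> m \<cdot> a = a" using ntimes_coprime_left_inverse assms by blast
  then show ?thesis using assms(2) by simp
qed (use assms in simp)

quotient_type circle = real / "\<lambda>x y. x - y \<in> \<int>"
proof (rule equivpI)
  show "reflp (\<lambda>x y::real. x - y \<in> \<int>)" by (simp add: reflp_def)
  show "symp (\<lambda>x y::real. x - y \<in> \<int>)"
    by (metis (no_types, lifting) sympI Ints_minus minus_diff_eq)
  show "transp (\<lambda>x y::real. x - y \<in> \<int>)"
  proof (rule transpI)
    fix x y z :: real
    assume "x - y \<in> \<int>" "y - z \<in> \<int>"
    then have "(x - y) + (y - z) \<in> \<int>" by (rule Ints_add)
    then show "x - z \<in> \<int>" by simp
  qed
qed

instantiation circle :: ab_group_add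
begin

lift_definition zero_circle :: circle is 0 .

lift_definition plus_circle :: "circle \<Rightarrow> circle \<Rightarrow> circle" is "(+)"
proof -
  fix a b c d :: real
  assume "a - b \<in> \<int>" "c - d \<in> \<int>"
  then have "(a - b) + (c - d) \<in> \<int>" by (rule Ints_add)
  then show "a + c - (b + d) \<in> \<int>" by (simp add: algebra_simps)
qed

lift_definition minus_circle :: "circle \<Rightarrow> circle \<Rightarrow> circle" is "(-)"
proof -
  fix a b c d :: real
  assume "a - b \<in> \<int>" "c - d \<in> \<int>"
  then have "(a - b) - (c - d) \<in> \<int>" by (rule Ints_diff)
  then show "a - c - (b - d) \<in> \<int>" by (simp add: algebra_simps)
qed

lift_definition uminus_circle :: "circle \<Rightarrow> circle" is uminus
  by (metis Ints_minus minus_diff_minus minus_minus)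

instance
  by standard (transfer; simp add: algebra_simps)+

end

lift_definition circ :: "real \<Rightarrow> circle" is "\<lambda>x. x" .

lemma circ_add: "circ (x + y) = circ x + circ y" by transfer simp
lemma circ_diff: "circ (x - y) = circ x - circ y" by transfer simp
lemma circ_zero: "circ 0 = 0" by transfer simp
lemma circ_eq_iff: "circ x = circ y \<longleftrightarrow> x - y \<in> \<int>" by transfer simp
lemma circ_eq_0_iff: "circ x = 0 \<longleftrightarrow> x \<in> \<int>" by transfer simp

lemma circ_rep_circle [simp]: "circ (rep_circle a) = a"
  by (metis Quotient3_abs_rep Quotient3_circle circ.abs_eq)

lemma ntimes_circ: "n \<cdot> circ x = circ (real n * x)"
  by (induction n) (auto simp: circ_zero circ_add algebra_simps)

lemma circle_divisible:
  fixes a :: circle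
  assumes "0 < n"
  obtains b where "n \<cdot> b = a"
proof
  show "n \<cdot> circ (rep_circle a / real n) = a"
    using assms by (simp add: ntimes_circ)
qed

lemma circle_torsion:
  fixes a :: circle
  assumes "0 < n" "n \<cdot> a = 0"
  obtains k where "a = k \<cdot> circ (1 / real n)"
proof -
  have "real n * rep_circle a \<in> \<int>"
    using assms(2) by (metis circ_eq_0_iff circ_rep_circle ntimes_circ)
  then obtain z where z: "real n * rep_circle a = of_int z" by (auto elim: Ints_cases)
  define k where "k = nat (z mod int n)"
  have "int k = z mod int n" using assms(1) by (simp add: k_def)
  then have "real_of_int z = real_of_int (z div int n) * real n + real k"
    by (metis div_mult_mod_eq of_int_add of_int_mult of_int_of_nat_eq)
  then have "rep_circle a - real k / real n = of_int (z div int n)"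
    using z assms(1) by (simp add: field_simps)
  then have "circ (rep_circle a) = circ (real k / real n)" unfolding circ_eq_iff by simp
  then show ?thesis using that[of k] by (simp add: ntimes_circ)
qed

lemma ntimes_circ_inverse_eq_0_iff:
  assumes "0 < n"
  shows "k \<cdot> circ (1 / real n) = 0 \<longleftrightarrow> n dvd k"
proof
  assume "k \<cdot> circ (1 / real n) = 0"
  then obtain z where "real k / real n = of_int z"
    by (auto simp: ntimes_circ circ_eq_0_iff elim: Ints_cases)
  then have "real_of_int (int k) = of_int (z * int n)" using assms by (simp add: field_simps)
  then have "int k = z * int n" by linarith
  then show "n dvd k" by (metis dvd_triv_right int_dvd_int_iff)
next
  assume "n dvd k"
  then show "k \<cdot> circ (1 / real n) = 0"
    using assms by (auto simp: ntimes_circ circ_eq_0_iff dvd_def)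
qed

lemma circle_prime_torsion_multiple:
  fixes a a' :: circle
  assumes p: "prime p" and a: "p \<cdot> a = 0" "a \<noteq> 0" and a': "p \<cdot> a' = 0"
  obtains j where "a' = j \<cdot> a"
proof -
  have p0: "0 < p" using p prime_gt_0_nat by blast
  obtain i where i: "a = i \<cdot> circ (1 / real p)" using circle_torsion[OF p0 a(1)] .
  obtain i' where i': "a' = i' \<cdot> circ (1 / real p)" using circle_torsion[OF p0 a'] .
  have "\<not> p dvd i" using a(2) ntimes_circ_inverse_eq_0_iff[OF p0] i by blast
  then have "coprime i p" "0 < i"
    using p prime_imp_coprime coprime_commute by (blast, cases i) auto
  moreover have "p \<cdot> circ (1 / real p) = 0" using ntimes_circ_inverse_eq_0_iff[OF p0] by simp
  ultimately obtain u where "u \<cdot> i \<cdot> circ (1 / real p) = circ (1 / real p)"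
    using ntimes_coprime_left_inverse by blast
  then have "(i' * u) \<cdot> a = a'" by (simp add: i i' ntimes_mult)
  then show ?thesis using that by metis
qed

section \<open>Cosets, characters and averaging\<close>

lemma card_image_eq:
  assumes "\<And>x y. \<lbrakk>x \<in> A; y \<in> A\<rbrakk> \<Longrightarrow> f x = f y \<longleftrightarrow> g x = g y"
  shows "card (f ` A) = card (g ` A)"
proof (rule bij_betw_same_card)
  have "g (inv_into A f (f x)) = g x" if "x \<in> A" for x
    using assms that by (metis f_inv_into_f imageI inv_into_into)
  then show "bij_betw (\<lambda>z. g (inv_into A f z)) (f ` A) (g ` A)"
    unfolding bij_betw_def using assms by (auto simp: inj_on_def image_iff)
qed

context group
begin

lemma inv_cancel:
  "\<lbrakk>x \<in> carrier G; y \<in> carrier G\<rbrakk> \<Longrightarrow> inv x \<otimes> (x \<otimes> y) = y"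
  "\<lbrakk>x \<in> carrier G; y \<in> carrier G\<rbrakk> \<Longrightarrow> x \<otimes> (inv x \<otimes> y) = y"
  by (simp_all flip: m_assoc)

lemmas word_simps = m_assoc inv_mult_group inv_cancel

lemma conj_eq_iff:
  assumes "x \<in> carrier G" "a \<in> carrier G" "b \<in> carrier G"
  shows "x \<otimes> a \<otimes> inv x = b \<longleftrightarrow> x \<otimes> a = b \<otimes> x" "inv x \<otimes> a \<otimes> x = b \<longleftrightarrow> a \<otimes> x = x \<otimes> b"
  using assms by (metis inv_solve_right m_closed, metis inv_solve_left m_assoc m_closed inv_closed)

lemma conj_nat_pow:
  assumes "x \<in> carrier G" "a \<in> carrier G"
  shows "x \<otimes> a [^] (n::nat) \<otimes> inv x = (x \<otimes> a \<otimes> inv x) [^] n"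
proof (induction n)
  case (Suc n)
  have "x \<otimes> a [^] Suc n \<otimes> inv x = (x \<otimes> a [^] n \<otimes> inv x) \<otimes> (x \<otimes> a \<otimes> inv x)"
    using assms by (simp add: word_simps)
  then show ?case using Suc by simp
qed (use assms in simp)

lemma conj_set_eq_image: "g <# K #> inv g = (\<lambda>k. g \<otimes> k \<otimes> inv g) ` K"
  by (auto simp: l_coset_def r_coset_def)

lemma subgroup_nat_pow_closed: "\<lbrakk>subgroup K G; k \<in> K\<rbrakk> \<Longrightarrow> k [^] (n::nat) \<in> K"
  by (induction n) (auto simp: subgroup.one_closed subgroup.m_closed)

lemma finite_subgroup_card_pos: "\<lbrakk>subgroup K G; finite K\<rbrakk> \<Longrightarrow> 0 < card K"
  by (auto simp: card_gt_0_iff dest: subgroup.one_closed)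

lemma pow_card_subgroup:
  assumes "subgroup K G" "k \<in> K"
  shows "k [^] card K = \<one>"
proof -
  interpret K: group "G\<lparr>carrier := K\<rparr>" by (rule subgroup_imp_group[OF assms(1)])
  show ?thesis using K.pow_order_eq_1[of k] assms by (simp add: order_def flip: nat_pow_consistent)
qed

lemma root_in_subgroup:
  assumes S: "subgroup S G" and K: "subgroup K G" and t: "t \<in> S"
    and j: "t [^] (j::nat) \<in> K" "0 < j" "coprime j (card S)"
  shows "t \<in> K"
proof -
  have tG: "t \<in> carrier G" using subgroup.mem_carrier[OF S t] .
  obtain u v where uv: "u * j = v * card S + 1" using coprime_bezout_nat[OF j(3,2)] .
  have "t [^] (v * card S) = \<one>"
    using pow_card_subgroup[OF S t] tG by (simp add: mult.commute[of v] flip: nat_pow_pow)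
  then have "t [^] (u * j) = t" unfolding uv using tG by (simp flip: nat_pow_mult)
  moreover have "t [^] (u * j) \<in> K"
    using subgroup_nat_pow_closed[OF K j(1), of u] tG by (simp add: nat_pow_pow mult.commute)
  ultimately show ?thesis by simp
qed

lemma generate_singleton_subset: "\<lbrakk>subgroup K G; k \<in> K\<rbrakk> \<Longrightarrow> generate G {k} \<subseteq> K"
  by (rule generate_subgroup_incl) auto

lemma ord_subgroup_prime:
  assumes K: "subgroup K G" "prime (card K)" and t: "t \<in> K" "t \<noteq> \<one>"
  shows "ord t = card K"
proof -
  have tG: "t \<in> carrier G" using subgroup.mem_carrier[OF K(1) t(1)] .
  have "ord t dvd card K" using pow_eq_id[OF tG] pow_card_subgroup[OF K(1) t(1)] by blast
  then show ?thesis using K(2) ord_eq_1[OF tG] t(2) prime_nat_iff by blast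
qed

lemma prime_order_subgroup_eq_generate:
  assumes K: "subgroup K G" "prime (card K)" and t: "t \<in> K" "t \<noteq> \<one>"
  shows "K = generate G {t}"
proof -
  have "finite K" using K(2) by (metis card.infinite not_prime_0)
  moreover have "card (generate G {t}) = card K"
    using generate_pow_card subgroup.mem_carrier[OF K(1) t(1)] ord_subgroup_prime[OF assms] by simp
  ultimately show ?thesis
    using card_subset_eq[OF _ generate_singleton_subset[OF K(1) t(1)]] by simp
qed

lemma prime_order_subgroup_nat_pow:
  assumes K: "subgroup K G" "prime (card K)" and t: "t \<in> K" "t \<noteq> \<one>" and u: "u \<in> K"
  obtains i where "u = t [^] (i::nat)" "i < card K"
proof -
  have tG: "t \<in> carrier G" using subgroup.mem_carrier[OF K(1) t(1)] .
  have card: "0 < card K" using K(2) prime_gt_0_nat by blast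
  have "u \<in> range (\<lambda>z::int. t [^] z)"
    using generate_pow[OF tG] prime_order_subgroup_eq_generate[OF K t] u by auto
  then obtain z :: int where z: "u = t [^] z" by blast
  define i where "i = nat (z mod int (card K))"
  have i: "int i = z mod int (card K)" using card by (simp add: i_def)
  have "t [^] (z - int i) = \<one>"
    using int_pow_eq_id[OF tG] ord_subgroup_prime[OF K t] by (simp add: i)
  then have "t [^] z = t [^] int i" using tG by (simp add: int_pow_diff inv_solve_right')
  then show ?thesis using that[of i] z card i by (simp add: int_pow_int i_def nat_less_iff)
qed

lemma normalizer_iff:
  assumes K: "subgroup K G" "finite K"
  shows "g \<in> normalizer G K \<longleftrightarrow> g \<in> carrier G \<and> (\<forall>k\<in>K. g \<otimes> k \<otimes> inv g \<in> K)"
proof -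
  have KG: "K \<subseteq> carrier G" using subgroup.subset[OF K(1)] .
  have "g <# K #> inv g = K \<longleftrightarrow> (\<forall>k\<in>K. g \<otimes> k \<otimes> inv g \<in> K)" if g: "g \<in> carrier G" for g
  proof
    assume "\<forall>k\<in>K. g \<otimes> k \<otimes> inv g \<in> K"
    then have "(\<lambda>k. g \<otimes> k \<otimes> inv g) ` K \<subseteq> K" by blast
    moreover have "inj_on (\<lambda>k. g \<otimes> k \<otimes> inv g) K"
      using g KG by (auto simp: inj_on_def subset_iff)
    ultimately show "g <# K #> inv g = K" unfolding conj_set_eq_image using endo_inj_surj[OF K(2)] by blast
  qed (auto simp: conj_set_eq_image)
  then show ?thesis using KG by (auto simp: normalizer_def stabilizer_def)
qed

lemma centralizer_subset_normalizer:
  assumes K: "subgroup K G" "finite K"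
  shows "centralizer G K \<subseteq> normalizer G K"
proof
  fix g assume g: "g \<in> centralizer G K"
  then have "g \<otimes> k \<otimes> inv g = k" if "k \<in> K" for k
    using that subgroup.mem_carrier[OF K(1) that] by (auto simp: centralizer_def m_assoc)
  then show "g \<in> normalizer G K" using g by (simp add: normalizer_iff[OF K] centralizer_def)
qed

lemma rcoset_eq_iff:
  assumes K: "subgroup K G" and a: "a \<in> carrier G" and b: "b \<in> carrier G"
  shows "K #> a = K #> b \<longleftrightarrow> a \<otimes> inv b \<in> K"
  using subgroup.rcos_module[OF K is_group b a] repr_independence[OF _ b K] rcos_self[OF a K] by blast

lemma rcoset_absorb: "\<lbrakk>subgroup K G; k \<in> K; x \<in> carrier G\<rbrakk> \<Longrightarrow> K #> (k \<otimes> x) = K #> x"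
  by (simp add: rcoset_eq_iff subgroup.mem_carrier word_simps)

lemma subset_set_mult:
  assumes "subgroup K G" "D \<subseteq> carrier G"
  shows "D \<subseteq> K <#> D" "D \<subseteq> D <#> K"
proof -
  have "\<one> \<otimes> d \<in> K <#> D \<and> d \<otimes> \<one> \<in> D <#> K" if "d \<in> D" for d
    using that subgroup.one_closed[OF assms(1)] unfolding set_mult_def by blast
  then show "D \<subseteq> K <#> D" "D \<subseteq> D <#> K" using assms(2) by (metis l_one r_one subset_iff)+
qed

lemma rcoset_mult_right_cong:
  assumes "subgroup K G" "x \<in> carrier G" "y \<in> carrier G" "g \<in> carrier G" "K #> x = K #> y"
  shows "K #> (x \<otimes> g) = K #> (y \<otimes> g)"
  using assms coset_mult_assoc[OF subgroup.subset[OF assms(1)]] by metis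

lemma bij_betw_subgroup_translate:
  assumes D: "subgroup D G" and g: "g \<in> D"
  shows "bij_betw (\<lambda>d. g \<otimes> d) D D"
  by (rule bij_betw_byWitness[where f' = "\<lambda>d. inv g \<otimes> d"])
    (use g subgroup.m_closed[OF D] subgroup.m_inv_closed[OF D] subgroup.mem_carrier[OF D] in \<open>auto simp: inv_cancel\<close>)

end

definition coset_rep :: "'a set \<Rightarrow> 'a" where
  "coset_rep C = (SOME x. x \<in> C)"

definition cosets_in :: "('a, 'x) monoid_scheme \<Rightarrow> 'a set \<Rightarrow> 'a set \<Rightarrow> 'a set set" where
  "cosets_in G D K = (\<lambda>k. D #>\<^bsub>G\<^esub> k) ` K"

context group
begin

lemma coset_rep_in_coset:
  assumes "subgroup D G" "x \<in> carrier G"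
  shows "coset_rep (D #> x) \<in> D #> x"
  unfolding coset_rep_def using rcos_self[OF assms(2,1)] by (rule someI)

lemma coset_rep_eqE:
  assumes "subgroup D G" "x \<in> carrier G"
  obtains d where "d \<in> D" "coset_rep (D #> x) = d \<otimes> x"
  using coset_rep_in_coset[OF assms] by (auto simp: r_coset_def)

lemma coset_rep_carrier: "\<lbrakk>subgroup D G; x \<in> carrier G\<rbrakk> \<Longrightarrow> coset_rep (D #> x) \<in> carrier G"
  using coset_rep_eqE subgroup.mem_carrier by (metis m_closed)

lemma rcoset_coset_rep:
  assumes "subgroup D G" "x \<in> carrier G"
  shows "D #> coset_rep (D #> x) = D #> x"
  using repr_independence[OF coset_rep_in_coset[OF assms] assms(2,1)] by simp

context
  fixes D K
  assumes D: "subgroup D G" and K: "subgroup K G" and DK: "D \<subseteq> K"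
begin

lemma cosets_in_rep:
  assumes "C \<in> cosets_in G D K"
  shows "coset_rep C \<in> K" "D #> coset_rep C = C"
proof -
  obtain k where k: "k \<in> K" "C = D #> k" using assms by (auto simp: cosets_in_def)
  obtain d where "d \<in> D" "coset_rep C = d \<otimes> k"
    using coset_rep_eqE[OF D subgroup.mem_carrier[OF K k(1)]] k(2) by metis
  then show "coset_rep C \<in> K" using DK k(1) subgroup.m_closed[OF K] by auto
  show "D #> coset_rep C = C" using rcoset_coset_rep[OF D subgroup.mem_carrier[OF K k(1)]] k(2) by simp
qed

lemma card_cosets_in: "card (cosets_in G D K) * card D = card K"
proof -
  interpret K: group "G\<lparr>carrier := K\<rparr>" by (rule subgroup_imp_group[OF K])
  have "subgroup D (G\<lparr>carrier := K\<rparr>)" using subgroup_incl[OF D K DK] .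
  from K.lagrange[OF this] show ?thesis
    by (simp add: order_def RCOSETS_def UNION_singleton_eq_range cosets_in_def)
qed

lemma bij_betw_cosets_in_translate:
  assumes g: "g \<in> K"
  shows "bij_betw (\<lambda>C. C #> g) (cosets_in G D K) (cosets_in G D K)"
proof -
  have ig: "inv g \<in> K" using subgroup.m_inv_closed[OF K g] .
  have translate: "D #> k #> h = D #> (k \<otimes> h)" if "k \<in> K" "h \<in> K" for k h
    using coset_mult_assoc[OF subgroup.subset[OF D]] that subgroup.mem_carrier[OF K] by simp
  show ?thesis
    by (rule bij_betw_byWitness[where f' = "\<lambda>C. C #> inv g"])
      (use g ig subgroup.mem_carrier[OF K] subgroup.m_closed[OF K] in \<open>auto simp: cosets_in_def translate word_simps\<close>)
qed

lemma sum_cosets_in_translate: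
  assumes f: "\<And>d k. \<lbrakk>d \<in> D; k \<in> K\<rbrakk> \<Longrightarrow> f (d \<otimes> k) = f k" and g: "g \<in> K"
  shows "(\<Sum>C\<in>cosets_in G D K. f (coset_rep C \<otimes> g)) = (\<Sum>C\<in>cosets_in G D K. f (coset_rep C))"
proof -
  note carr = subgroup.mem_carrier[OF K]
  have f_rep: "f (coset_rep (D #> k)) = f k" if "k \<in> K" for k
    using coset_rep_eqE[OF D carr[OF that]] f that by metis
  have "f (coset_rep C \<otimes> g) = f (coset_rep (C #> g))" if C: "C \<in> cosets_in G D K" for C
  proof -
    note rep = cosets_in_rep[OF C]
    have "C #> g = D #> (coset_rep C \<otimes> g)"
      using coset_mult_assoc[OF subgroup.subset[OF D] carr[OF rep(1)] carr[OF g]] rep(2) by simp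
    then show ?thesis using f_rep[OF subgroup.m_closed[OF K rep(1) g]] by simp
  qed
  then have "(\<Sum>C\<in>cosets_in G D K. f (coset_rep C \<otimes> g)) = (\<Sum>C\<in>cosets_in G D K. f (coset_rep (C #> g)))"
    by (rule sum.cong[OF refl])
  also have "\<dots> = (\<Sum>C\<in>cosets_in G D K. f (coset_rep C))"
    by (rule sum.reindex_bij_betw[OF bij_betw_cosets_in_translate[OF g]])
  finally show ?thesis .
qed

text \<open>Normalised at \<open>base\<close>, a crossed homomorphism modulo constants satisfies the assumption \<open>f\<close>.\<close>

lemma crossed_hom_average:
  fixes f :: "'a \<Rightarrow> 'i \<Rightarrow> 'w::ab_group_add"
  assumes move: "\<And>g i. \<lbrakk>g \<in> K; i \<in> I\<rbrakk> \<Longrightarrow> move g i \<in> I" and base: "base \<in> I"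
    and f: "\<And>g h i. \<lbrakk>g \<in> K; h \<in> K; i \<in> I\<rbrakk> \<Longrightarrow> f (g \<otimes> h) i = f g i + f h (move g i) - f h (move g base)"
    and zero: "\<And>d i. \<lbrakk>d \<in> D; i \<in> I\<rbrakk> \<Longrightarrow> f d i = 0" and g: "g \<in> K" and i: "i \<in> I"
  defines "w \<equiv> \<lambda>i. \<Sum>C\<in>cosets_in G D K. f (inv (coset_rep C)) i"
  shows "card (cosets_in G D K) \<cdot> f g i = w i - w (move g i) + w (move g base)"
proof -
  note Kinv = subgroup.m_inv_closed[OF K] and carr = subgroup.mem_carrier[OF K]
  have "w i = (\<Sum>C\<in>cosets_in G D K. f (inv (coset_rep C \<otimes> inv g)) i)"
    unfolding w_def
  proof (rule sum_cosets_in_translate[where f = "\<lambda>k. f (inv k) i", symmetric])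
    fix d k assume dk: "d \<in> D" "k \<in> K"
    then have "f (inv (d \<otimes> k)) i = f (inv k) i + f (inv d) (move (inv k) i) - f (inv d) (move (inv k) base)"
      using f[OF Kinv Kinv i] DK carr by (simp add: inv_mult_group subset_iff)
    then show "f (inv (d \<otimes> k)) i = f (inv k) i"
      using dk zero[OF subgroup.m_inv_closed[OF D]] move[OF Kinv] i base by simp
  qed (rule Kinv[OF g])
  also have "\<dots> = (\<Sum>C\<in>cosets_in G D K. f g i + f (inv (coset_rep C)) (move g i)
      - f (inv (coset_rep C)) (move g base))"
    using f[OF g Kinv i] cosets_in_rep(1) carr g by (intro sum.cong) (auto simp: inv_mult_group)
  also have "\<dots> = card (cosets_in G D K) \<cdot> f g i + w (move g i) - w (move g base)"
    by (simp add: sum.distrib sum_subtractf sum_constant_ntimes w_def)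
  finally show ?thesis by (simp add: algebra_simps)
qed

end

definition character :: "'a set \<Rightarrow> ('a \<Rightarrow> 'w::ab_group_add) \<Rightarrow> bool" where
  "character K \<chi> \<longleftrightarrow> (\<forall>k\<in>K. \<forall>l\<in>K. \<chi> (k \<otimes> l) = \<chi> k + \<chi> l)"

lemma characterD: "\<lbrakk>character K \<chi>; k \<in> K; l \<in> K\<rbrakk> \<Longrightarrow> \<chi> (k \<otimes> l) = \<chi> k + \<chi> l"
  by (simp add: character_def)

lemma character_ntimes: "character K \<chi> \<Longrightarrow> character K (\<lambda>k. n \<cdot> \<chi> k)"
  by (simp add: character_def ntimes_add_right)

context
  fixes K \<chi>
  assumes K: "subgroup K G" and \<chi>: "character K \<chi>"
begin

lemma character_one: "\<chi> \<one> = 0"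
  using characterD[OF \<chi>, of \<one> \<one>] subgroup.one_closed[OF K] by simp

lemma character_inv:
  assumes "k \<in> K" shows "\<chi> (inv k) = - \<chi> k"
  using characterD[OF \<chi> subgroup.m_inv_closed[OF K assms] assms] subgroup.mem_carrier[OF K assms] character_one
  by (simp add: eq_neg_iff_add_eq_0)

lemma character_nat_pow: "k \<in> K \<Longrightarrow> \<chi> (k [^] (n::nat)) = n \<cdot> \<chi> k"
  by (induction n)
    (auto simp: character_one characterD[OF \<chi>] subgroup_nat_pow_closed[OF K] add.commute)

lemma character_commutator:
  assumes "a \<in> K" "b \<in> K"
  shows "\<chi> (a \<otimes> b \<otimes> inv a \<otimes> inv b) = 0"
  using assms by (simp add: characterD[OF \<chi>] character_inv subgroup.m_closed[OF K] subgroup.m_inv_closed[OF K])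

lemma subgroup_character_kernel: "subgroup {k \<in> K. \<chi> k = 0} G"
  by (rule subgroupI)
    (use K subgroup.mem_carrier[OF K] in \<open>auto simp: character_one character_inv characterD[OF \<chi>]
      subgroup.one_closed subgroup.m_closed subgroup.m_inv_closed intro: exI[of _ \<one>]\<close>)

end

lemma exists_faithful_character:
  assumes K: "subgroup K G" "prime (card K)"
  obtains a :: "'a \<Rightarrow> circle" where "character K a" "\<And>k. \<lbrakk>k \<in> K; k \<noteq> \<one>\<rbrakk> \<Longrightarrow> a k \<noteq> 0"
proof -
  let ?p = "card K"
  have p: "1 < ?p" using K(2) prime_gt_1_nat by blast
  then have "K \<noteq> {\<one>}" by auto
  then obtain t where t: "t \<in> K" "t \<noteq> \<one>" using subgroup.one_closed[OF K(1)] by blast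
  have tG: "t \<in> carrier G" using subgroup.mem_carrier[OF K(1) t(1)] .
  define a where "a k = (SOME i::nat. k = t [^] i) \<cdot> circ (1 / real ?p)" for k
  have a_pow: "a (t [^] i) = i \<cdot> circ (1 / real ?p)" for i :: nat
  proof -
    define j where "j = (SOME j::nat. t [^] i = t [^] j)"
    have "t [^] int i = t [^] int j" using someI[of "\<lambda>j::nat. t [^] i = t [^] j"] by (simp add: j_def int_pow_int)
    then have "int ?p dvd int j - int i"
      using int_pow_eq[OF tG] ord_subgroup_prime[OF K t] by simp
    then obtain z where "int j - int i = int ?p * z" by blast
    then have "real j / real ?p - real i / real ?p = of_int z"
      using p by (simp add: field_simps) (metis of_int_add of_int_mult of_int_of_nat_eq diff_add_cancel)
    then show ?thesis by (simp add: a_def j_def[symmetric] ntimes_circ circ_eq_iff)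
  qed
  have pow: "\<exists>i::nat. k = t [^] i" if "k \<in> K" for k
    using prime_order_subgroup_nat_pow[OF K t that] by blast
  have "a (k \<otimes> l) = a k + a l" if "k \<in> K" "l \<in> K" for k l
    using pow[OF that(1)] pow[OF that(2)] tG by (auto simp: nat_pow_mult a_pow ntimes_add_left)
  moreover have "k = \<one>" if k: "k \<in> K" "a k = 0" for k
  proof -
    obtain i where i: "k = t [^] (i::nat)" using pow[OF k(1)] by blast
    then have "?p dvd i" using k(2) p ntimes_circ_inverse_eq_0_iff[of ?p i] by (simp add: a_pow)
    then show ?thesis using i pow_eq_id[OF tG] ord_subgroup_prime[OF K t] by simp
  qed
  ultimately show ?thesis using that[of a] by (auto simp: character_def)
qed

lemma character_extend_over_complement:
  assumes K: "subgroup K G" and C: "subgroup C G" and disjoint: "K \<inter> C = {\<one>}"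
    and commute: "\<And>k c. \<lbrakk>k \<in> K; c \<in> C\<rbrakk> \<Longrightarrow> c \<otimes> k = k \<otimes> c" and a: "character K a"
  obtains \<theta> where "character (K <#> C) \<theta>" "\<And>k c. \<lbrakk>k \<in> K; c \<in> C\<rbrakk> \<Longrightarrow> \<theta> (k \<otimes> c) = a k"
proof -
  interpret group_disjoint_sum G K C
    using K C by (simp add: group_disjoint_sum_def)
  define \<theta> where "\<theta> s = a (SOME k. k \<in> K \<and> (\<exists>c\<in>C. s = k \<otimes> c))" for s
  have \<theta>: "\<theta> (k \<otimes> c) = a k" if kc: "k \<in> K" "c \<in> C" for k c
  proof -
    define k' where "k' = (SOME k'. k' \<in> K \<and> (\<exists>c'\<in>C. k \<otimes> c = k' \<otimes> c'))"
    have "k' \<in> K \<and> (\<exists>c'\<in>C. k \<otimes> c = k' \<otimes> c')"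
      unfolding k'_def by (rule someI[of _ k]) (use kc in blast)
    then have "k' = k" using cancel disjoint kc by (metis order_refl)
    then show ?thesis by (simp add: \<theta>_def k'_def)
  qed
  have "character (K <#> C) \<theta>"
    unfolding character_def
  proof (intro ballI)
    fix s t assume "s \<in> K <#> C" "t \<in> K <#> C"
    then obtain k c l d where s: "k \<in> K" "c \<in> C" "s = k \<otimes> c" and t: "l \<in> K" "d \<in> C" "t = l \<otimes> d"
      by (auto simp: set_mult_def)
    have "s \<otimes> t = (k \<otimes> l) \<otimes> (c \<otimes> d)"
      using s t commute[OF t(1) s(2)] subgroup.mem_carrier[OF K] subgroup.mem_carrier[OF C]
      by (metis m_assoc m_closed)
    then show "\<theta> (s \<otimes> t) = \<theta> s + \<theta> t"
      using s t by (simp add: \<theta> characterD[OF a])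
  qed
  then show ?thesis using that \<theta> by blast
qed

definition retract :: "'a set \<Rightarrow> 'a \<Rightarrow> 'a" where
  "retract K h = h \<otimes> inv coset_rep (K #> h)"

lemma retract_mem:
  assumes K: "subgroup K G" and h: "h \<in> carrier G"
  shows "retract K h \<in> K"
proof -
  obtain k where "k \<in> K" "coset_rep (K #> h) = k \<otimes> h" using coset_rep_eqE[OF K h] .
  then show ?thesis
    using h subgroup.mem_carrier[OF K] subgroup.m_inv_closed[OF K] by (simp add: retract_def word_simps)
qed

lemma retract_mult:
  assumes "subgroup K G" "h \<in> carrier G" "k \<in> K"
  shows "retract K (k \<otimes> h) = k \<otimes> retract K h"
  using assms coset_rep_carrier[OF assms(1,2)] subgroup.mem_carrier[OF assms(1,3)]
  by (simp add: retract_def rcoset_absorb m_assoc)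

definition transfer :: "'a set \<Rightarrow> 'a set \<Rightarrow> ('a \<Rightarrow> 'w) \<Rightarrow> 'a \<Rightarrow> 'w::ab_group_add" where
  "transfer K H a h =
     (\<Sum>C\<in>cosets_in G K H. a (retract K (coset_rep C \<otimes> h)) - a (retract K (coset_rep C)))"

context
  fixes K H and a :: "'a \<Rightarrow> 'w::ab_group_add"
  assumes K: "subgroup K G" and H: "subgroup H G" and KH: "K \<subseteq> H" and a: "character K a"
begin

lemma character_transfer: "character H (transfer K H a)"
  unfolding character_def
proof (intro ballI)
  fix h h' assume h: "h \<in> H" and h': "h' \<in> H"
  note carr = subgroup.mem_carrier[OF H] and Hm = subgroup.m_closed[OF H]
  let ?q = coset_rep
  have "(\<Sum>C\<in>cosets_in G K H. a (retract K (?q C \<otimes> h \<otimes> h')) - a (retract K (?q C \<otimes> h))) = transfer K H a h'"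
    unfolding transfer_def
  proof (rule sum_cosets_in_translate[OF K H KH _ h, where f = "\<lambda>q. a (retract K (q \<otimes> h')) - a (retract K q)"])
    fix d k assume d: "d \<in> K" and k: "k \<in> H"
    have "a (retract K (d \<otimes> x)) = a d + a (retract K x)" if "x \<in> H" for x
      using that d by (simp add: retract_mult[OF K carr] retract_mem[OF K carr] characterD[OF a])
    then show "a (retract K (d \<otimes> k \<otimes> h')) - a (retract K (d \<otimes> k)) = a (retract K (k \<otimes> h')) - a (retract K k)"
      using d k h' KH carr Hm by (simp add: m_assoc subset_iff)
  qed
  moreover have "transfer K H a (h \<otimes> h') = (\<Sum>C\<in>cosets_in G K H.
      (a (retract K (?q C \<otimes> h \<otimes> h')) - a (retract K (?q C \<otimes> h))) + (a (retract K (?q C \<otimes> h)) - a (retract K (?q C))))"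
    unfolding transfer_def
    by (rule sum.cong) (use cosets_in_rep(1)[OF K H KH] h h' carr in \<open>auto simp: m_assoc\<close>)
  ultimately show "transfer K H a (h \<otimes> h') = transfer K H a h + transfer K H a h'"
    by (simp only: sum.distrib) (simp add: transfer_def add.commute)
qed

lemma transfer_central:
  assumes central: "\<And>h. h \<in> H \<Longrightarrow> h \<otimes> k = k \<otimes> h" and k: "k \<in> K"
  shows "transfer K H a k = card (cosets_in G K H) \<cdot> a k"
proof -
  have "a (retract K (coset_rep C \<otimes> k)) - a (retract K (coset_rep C)) = a k" if "C \<in> cosets_in G K H" for C
  proof -
    have "coset_rep C \<in> H" "coset_rep C \<in> carrier G"
      using cosets_in_rep(1)[OF K H KH that] subgroup.mem_carrier[OF H] by blast+
    then show ?thesis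
      using k by (simp add: central retract_mult[OF K] retract_mem[OF K] characterD[OF a])
  qed
  then show ?thesis by (simp add: transfer_def sum_constant_ntimes)
qed

lemma ntimes_transfer_zero:
  assumes "\<And>k. k \<in> K \<Longrightarrow> n \<cdot> a k = 0" "h \<in> H"
  shows "n \<cdot> transfer K H a h = 0"
  unfolding transfer_def ntimes_sum
proof (rule sum.neutral, rule ballI)
  fix C assume "C \<in> cosets_in G K H"
  then have "coset_rep C \<in> carrier G" "coset_rep C \<otimes> h \<in> carrier G"
    using cosets_in_rep(1)[OF K H KH] assms(2) subgroup.mem_carrier[OF H] by auto
  then show "n \<cdot> (a (retract K (coset_rep C \<otimes> h)) - a (retract K (coset_rep C))) = 0"
    using assms(1) retract_mem[OF K] by (simp add: ntimes_diff_right)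
qed

end

end

context normal
begin

lemma commutators_subset: "{a \<otimes> b \<otimes> inv a \<otimes> inv b | a b. a \<in> H \<and> b \<in> carrier G} \<subseteq> H"
proof clarify
  fix a b assume a: "a \<in> H" and b: "b \<in> carrier G"
  have "a \<otimes> (b \<otimes> inv a \<otimes> inv b) \<in> H" using a b inv_op_closed2[OF b m_inv_closed[OF a]] by blast
  then show "a \<otimes> b \<otimes> inv a \<otimes> inv b \<in> H" using mem_carrier[OF a] b by (simp add: m_assoc)
qed

lemma commutator_subgroup_subset: "commutator_subgroup G H (carrier G) \<subseteq> H"
  unfolding commutator_subgroup_def using generate_subgroup_incl[OF commutators_subset subgroup_axioms] .

lemma subgroup_commutator_subgroup: "subgroup (commutator_subgroup G H (carrier G)) G"
  unfolding commutator_subgroup_def using generate_is_subgroup commutators_subset subset by blast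

lemma commutator_mem: "\<lbrakk>a \<in> H; b \<in> carrier G\<rbrakk> \<Longrightarrow> a \<otimes> b \<otimes> inv a \<otimes> inv b \<in> commutator_subgroup G H (carrier G)"
  unfolding commutator_subgroup_def by (rule generate.incl) blast

lemma inv_mult_conj_in_commutator_subgroup:
  assumes "a \<in> H" "g \<in> carrier G"
  shows "inv a \<otimes> (inv g \<otimes> a \<otimes> g) \<in> commutator_subgroup G H (carrier G)"
  using commutator_mem[of "inv a" "inv g"] assms mem_carrier[OF assms(1)] by (simp add: m_assoc)

end

lemma (in group) character_commutator_subgroup:
  assumes \<chi>: "character (carrier G) \<chi>" and K: "K \<subseteq> carrier G" and k: "k \<in> commutator_subgroup G K (carrier G)"
  shows "\<chi> k = 0"
proof -
  have "{a \<otimes> b \<otimes> inv a \<otimes> inv b | a b. a \<in> K \<and> b \<in> carrier G} \<subseteq> {k \<in> carrier G. \<chi> k = 0}"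
    using character_commutator[OF subgroup_self \<chi>] K by auto
  then show ?thesis
    using k generate_subgroup_incl[OF _ subgroup_character_kernel[OF subgroup_self \<chi>]]
    unfolding commutator_subgroup_def by blast
qed

section \<open>Subgroups of prime index and groups of small order\<close>

context group
begin

context
  fixes S K p e
  assumes S: "subgroup S G" "finite S" and p: "prime (p::nat)" and card_S: "card S = p ^ e"
    and K: "subgroup K G" "K \<subseteq> S" and index: "card S = p * card K"
begin

lemma index_p_root:
  assumes "t \<in> S" "t [^] (j::nat) \<in> K" "\<not> p dvd j"
  shows "t \<in> K"
proof (rule root_in_subgroup[OF S(1) K(1) assms(1,2)])
  show "coprime j (card S)"
    using prime_imp_coprime[OF p assms(3)] by (simp add: card_S coprime_commute)
  show "0 < j" using assms(3) by (cases j) auto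
qed

lemma index_p_translate_meets:
  assumes t: "t \<in> S" "t \<notin> K" and u: "u \<in> S"
  obtains i where "i < p" "u \<otimes> t [^] (i::nat) \<in> K"
proof -
  let ?C = "\<lambda>i::nat. K #> inv (t [^] i)"
  have tG: "t \<in> carrier G" and uG: "u \<in> carrier G" using subgroup.mem_carrier[OF S(1)] t u by auto
  have "inj_on ?C {..<p}"
  proof (rule linorder_inj_onI)
    fix i j :: nat assume ij: "i < j" "i \<in> {..<p}" "j \<in> {..<p}"
    then have "inv (t [^] i) \<otimes> inv (inv (t [^] j)) = t [^] (j - i)"
      using tG nat_pow_mult[OF tG, of i "j - i"] by (simp add: inv_solve_left')
    moreover have "\<not> p dvd j - i" using ij by (auto dest: dvd_imp_le)
    ultimately show "?C i \<noteq> ?C j"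
      using index_p_root t tG by (auto simp: rcoset_eq_iff[OF K(1)])
  qed auto
  then have "card (?C ` {..<p}) = p" by (simp add: card_image)
  also have "p = card (cosets_in G K S)"
    using card_cosets_in[OF K(1) S(1) K(2)] index finite_subgroup_card_pos[OF K(1) finite_subset[OF K(2) S(2)]]
    by (metis mult_cancel2 less_nat_zero_code)
  finally have card_eq: "card (?C ` {..<p}) = card (cosets_in G K S)" .
  have "inv (t [^] i) \<in> S" for i :: nat
    using subgroup.m_inv_closed[OF S(1) subgroup_nat_pow_closed[OF S(1) t(1)]] .
  then have "?C ` {..<p} \<subseteq> cosets_in G K S" by (auto simp: cosets_in_def)
  then have "?C ` {..<p} = cosets_in G K S"
    using card_eq S(2) by (simp add: card_subset_eq cosets_in_def)
  then have "K #> u \<in> ?C ` {..<p}" using u by (simp add: cosets_in_def)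
  then obtain i where "i < p" "K #> u = ?C i" by auto
  then show ?thesis using that tG uG by (simp add: rcoset_eq_iff[OF K(1)])
qed

lemma index_p_nat_pow_mem:
  assumes s: "s \<in> S"
  shows "s [^] p \<in> K"
proof (cases "s \<in> K")
  case False
  have sG: "s \<in> carrier G" using subgroup.mem_carrier[OF S(1) s] .
  obtain i where i: "i < p" "s [^] p \<otimes> s [^] i \<in> K"
    using index_p_translate_meets[OF s False subgroup_nat_pow_closed[OF S(1) s]] by blast
  then have "p dvd p + i" using index_p_root[OF s, of "p + i"] False sG by (auto simp: nat_pow_mult)
  then have "i = 0" using i(1) by (auto simp: dvd_add_right_iff dest: dvd_imp_le)
  then show ?thesis using i(2) sG by simp
qed (rule subgroup_nat_pow_closed[OF K(1)])

end

context
  fixes S K p e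
  assumes S: "subgroup S G" "finite S" and p: "prime (p::nat)" and card_S: "card S = p ^ e"
    and K: "subgroup K G" "K \<subseteq> S" and index: "card S = p * card K"
begin

lemma index_p_conj_mem:
  assumes k: "k \<in> K" and s: "s \<in> S"
  shows "s \<otimes> k \<otimes> inv s \<in> K"
proof -
  have sG: "s \<in> carrier G" and kG: "k \<in> carrier G"
    using subgroup.mem_carrier[OF S(1) s] subgroup.mem_carrier[OF K(1) k] .
  define L where "L = (\<lambda>k. inv s \<otimes> k \<otimes> s) ` K"
  have "inv s <# K #> s = L" by (auto simp: L_def l_coset_def r_coset_def)
  then have L: "subgroup L G" using subgroup_conjugation_is_surj1[OF sG K(1)] by simp
  have mem_L: "s \<otimes> x \<otimes> inv s \<in> K" if "x \<in> L" for x
    using that sG subgroup.mem_carrier[OF K(1)] by (auto simp: L_def word_simps)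
  have LS: "L \<subseteq> S"
    using s K(2) subgroup.m_closed[OF S(1)] subgroup.m_inv_closed[OF S(1)] by (auto simp: L_def)
  have "card L = card K"
    unfolding L_def using sG subgroup.mem_carrier[OF K(1)] by (intro card_image) (auto simp: inj_on_def)
  then have index_L: "card S = p * card L" using index by simp
  show ?thesis
  proof (cases "k \<in> L")
    case False
    obtain i where "inv s \<otimes> k [^] (i::nat) \<in> L"
      using index_p_translate_meets[OF S p card_S L LS index_L _ False subgroup.m_inv_closed[OF S(1) s]] k K(2)
      by blast
    from mem_L[OF this] have "k [^] i \<otimes> inv s \<in> K" using sG kG by (simp add: word_simps)
    then have "inv (k [^] i) \<otimes> (k [^] i \<otimes> inv s) \<in> K"
      using subgroup_nat_pow_closed[OF K(1) k] subgroup.m_closed[OF K(1)] subgroup.m_inv_closed[OF K(1)] by blast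
    then have "inv (inv s) \<in> K" using sG kG subgroup.m_inv_closed[OF K(1), of "inv s"] by (simp add: inv_cancel)
    then show ?thesis
      using sG k subgroup.m_closed[OF K(1)] subgroup.m_inv_closed[OF K(1)] by simp
  qed (rule mem_L)
qed

lemma index_p_commutator_mem:
  assumes a: "a \<in> S" and b: "b \<in> S"
  shows "a \<otimes> b \<otimes> inv a \<otimes> inv b \<in> K"
proof -
  have G: "a \<in> carrier G" "b \<in> carrier G" using subgroup.mem_carrier[OF S(1)] a b by auto
  have commutator_mem: "a \<otimes> k \<otimes> inv a \<otimes> inv k \<in> K" if "k \<in> K" for k
    using index_p_conj_mem[OF that a] that subgroup.m_closed[OF K(1)] subgroup.m_inv_closed[OF K(1)] by blast
  show ?thesis
  proof (cases "a \<in> K")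
    case True
    have "a \<otimes> (b \<otimes> inv a \<otimes> inv b) \<in> K"
      using index_p_conj_mem[OF subgroup.m_inv_closed[OF K(1) True] b] subgroup.m_closed[OF K(1) True] by blast
    then show ?thesis using G by (simp add: m_assoc)
  next
    case False
    obtain i where i: "b \<otimes> a [^] (i::nat) \<in> K"
      using index_p_translate_meets[OF S p card_S K index a False b] by blast
    have "inv a \<otimes> inv (a [^] i) = inv (a [^] i) \<otimes> inv a"
      using G(1) by (metis inv_mult_group nat_pow_Suc nat_pow_Suc2 nat_pow_closed)
    then have "a [^] i \<otimes> (inv a \<otimes> inv (a [^] i)) = inv a" using G(1) by (simp add: inv_cancel)
    then have "a \<otimes> (b \<otimes> a [^] i) \<otimes> inv a \<otimes> inv (b \<otimes> a [^] i) = a \<otimes> b \<otimes> inv a \<otimes> inv b"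
      using G by (simp add: word_simps) (metis inv_closed m_assoc m_closed nat_pow_closed)
    then show ?thesis using commutator_mem[OF i] by simp
  qed
qed

end

lemma subgroup_generated_eq: "subgroup K G \<Longrightarrow> subgroup_generated G K = G\<lparr>carrier := K\<rparr>"
  using subgroup.carrier_subgroup_generated_subgroup[of K G] by (auto simp: subgroup_generated_def)

lemma card_le_exponent_if_subset_cyclic:
  assumes g: "finite (carrier G)" "g \<in> carrier G" and S: "S \<subseteq> generate G {g}"
    and p: "0 < p" "\<And>s. s \<in> S \<Longrightarrow> s [^] (p::nat) = \<one>"
  shows "card S \<le> p"
proof -
  define q where "q = gcd (ord g) p"
  obtain d p' where d: "ord g = d * q" and p': "p = p' * q" and cop: "coprime d p'"
    using gcd_coprime_exists[of "ord g" p] p(1) unfolding q_def by auto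
  have q0: "q \<noteq> 0" using p(1) by (simp add: q_def)
  have x: "g [^] d \<in> carrier G" using g(2) by simp
  have "S \<subseteq> generate G {g [^] d}"
  proof
    fix s assume s: "s \<in> S"
    then obtain i where i: "s = g [^] (i::nat)"
      using S generate_pow_on_finite_carrier[OF g] by auto
    then have "ord g dvd i * p" using p(2)[OF s] pow_eq_id[OF g(2)] g(2) by (simp add: nat_pow_pow)
    then have "d dvd i * p'" using q0 by (simp add: d p' mult.assoc[symmetric])
    then have "d dvd i" using cop by (simp add: coprime_dvd_mult_left_iff)
    then obtain j where "i = d * j" ..
    then have "s = (g [^] d) [^] j" using g(2) by (simp add: i nat_pow_pow)
    then show "s \<in> generate G {g [^] d}" using generate_pow_on_finite_carrier[OF g(1) x] by blast
  qed
  moreover have "(g [^] d) [^] p = \<one>"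
    using pow_eq_id[OF g(2)] g(2) by (simp add: nat_pow_pow d p' mult.left_commute)
  then have "card (generate G {g [^] d}) dvd p" using generate_pow_card[OF x] pow_eq_id[OF x] by simp
  moreover have "finite (generate G {g [^] d})"
    using finite_subset[OF generate_incl g(1)] x by simp
  ultimately show ?thesis using p(1) by (meson card_mono dvd_imp_le order_trans)
qed

end

lemma iso_of_equal_kernels:
  assumes P: "group P" and A: "group A" and B: "group B"
    and f: "f \<in> hom P A" "f ` carrier P = carrier A"
    and g: "g \<in> hom P B" "g ` carrier P = carrier B"
    and eq: "\<And>x. x \<in> carrier P \<Longrightarrow> f x = \<one>\<^bsub>A\<^esub> \<longleftrightarrow> g x = \<one>\<^bsub>B\<^esub>"
  shows "A \<cong> B"
proof -
  interpret f: group_hom P A f using P A f by (simp add: group_hom_def group_hom_axioms_def)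
  interpret g: group_hom P B g using P B g by (simp add: group_hom_def group_hom_axioms_def)
  have "kernel P A f = kernel P B g" using eq by (auto simp: kernel_def)
  then have "P Mod kernel P A f \<cong> B" using g.FactGroup_iso[OF g(2)] by simp
  moreover have "A \<cong> P Mod kernel P A f"
    using f.FactGroup_iso[OF f(2)] group.iso_sym[OF normal.factorgroup_is_group[OF f.normal_kernel]] by blast
  ultimately show ?thesis using iso_trans by blast
qed

lemma (in group) cyclic_iso_integer_mod_group:
  assumes p: "prime p" and x: "x \<in> carrier G" "x \<noteq> \<one>" "x [^] p = \<one>"
    and gen: "\<And>y. y \<in> carrier G \<Longrightarrow> \<exists>j::nat. y = x [^] j"
  shows "G \<cong> integer_mod_group p"
proof (rule iso_of_equal_kernels)
  have "ord x dvd p" using x pow_eq_id by blast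
  then have ord: "ord x = p" using p ord_eq_1 x prime_nat_iff by blast
  have p0: "0 < int p" using p prime_gt_0_nat by simp
  show "(\<lambda>i::int. x [^] i) \<in> hom integer_group G" by (rule hom_integer_group_pow[OF x(1)])
  have "y \<in> range (\<lambda>i::int. x [^] i)" if "y \<in> carrier G" for y
    using gen[OF that] by (metis int_pow_int rangeI)
  then show "(\<lambda>i::int. x [^] i) ` carrier integer_group = carrier G" using x by auto
  show "(x [^] i = \<one>) = (i mod int p = \<one>\<^bsub>integer_mod_group p\<^esub>)" for i :: int
    using int_pow_eq_id[OF x(1), of i] ord by (simp add: dvd_eq_mod_eq_0)
  show "(\<lambda>i. i mod int p) \<in> hom integer_group (integer_mod_group p)"
    using p0 by (auto simp: hom_def carrier_integer_mod_group mod_add_eq)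
  have "i \<in> range (\<lambda>i. i mod int p)" if "i \<in> {0..<int p}" for i
    using that by (intro image_eqI[of _ _ i]) auto
  then show "(\<lambda>i. i mod int p) ` carrier integer_group = carrier (integer_mod_group p)"
    using p0 by (auto simp: carrier_integer_mod_group)
qed auto

lemma (in group) prime_order_subgroup_iso:
  assumes K: "subgroup K G" and p: "prime (card K)"
  shows "G\<lparr>carrier := K\<rparr> \<cong> integer_mod_group (card K)"
proof -
  interpret K: group "G\<lparr>carrier := K\<rparr>" by (rule subgroup_imp_group[OF K])
  have "K \<noteq> {\<one>}" using p by auto
  then obtain t where t: "t \<in> K" "t \<noteq> \<one>" using subgroup.one_closed[OF K] by blast
  show ?thesis
    by (rule K.cyclic_iso_integer_mod_group[of _ t])
      (use p t pow_card_subgroup[OF K t(1)] prime_order_subgroup_nat_pow[OF K p t] in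
        \<open>auto simp flip: nat_pow_consistent\<close>)
qed

lemma (in comm_group) iso_DirProd_if_complements:
  assumes K: "subgroup K G" and L: "subgroup L G" and disjoint: "K \<inter> L = {\<one>}" and span: "K <#> L = carrier G"
    and iso: "G\<lparr>carrier := K\<rparr> \<cong> A" "G\<lparr>carrier := L\<rparr> \<cong> B"
  shows "G \<cong> A \<times>\<times> B"
proof -
  interpret group_disjoint_sum G K L using K L by (simp add: group_disjoint_sum_def)
  have "G\<lparr>carrier := K\<rparr> \<times>\<times> G\<lparr>carrier := L\<rparr> \<cong> G"
    using iso_group_mul[OF comm_group_axioms] disjoint span
    by (auto simp: subgroup_generated_eq K L is_iso_def)
  then have "G \<cong> G\<lparr>carrier := K\<rparr> \<times>\<times> G\<lparr>carrier := L\<rparr>"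
    using group.iso_sym DirProd_group subgroup_imp_group K L by metis
  moreover have "G\<lparr>carrier := K\<rparr> \<times>\<times> G\<lparr>carrier := L\<rparr> \<cong> A \<times>\<times> B"
    using iso group.DirProd_iso_trans[OF subgroup_imp_group[OF K]] by blast
  ultimately show ?thesis by (rule iso_trans)
qed

lemma (in comm_group) comm_group_subgroup: "subgroup K G \<Longrightarrow> comm_group (G\<lparr>carrier := K\<rparr>)"
  using abelian_subgroup_generated[OF comm_group_axioms, of K] by (simp add: subgroup_generated_eq)

lemma (in comm_group) subgroup_torsion:
  assumes one: "1 \<in> M" and mult: "\<And>m n. \<lbrakk>m \<in> M; n \<in> M\<rbrakk> \<Longrightarrow> m * n \<in> M"
  shows "subgroup {x \<in> carrier G. \<exists>n\<in>M. x [^] (n::nat) = \<one>} G"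
proof (rule subgroupI)
  show "{x \<in> carrier G. \<exists>n\<in>M. x [^] n = \<one>} \<noteq> {}" using one nat_pow_one by blast
  fix x assume x: "x \<in> {x \<in> carrier G. \<exists>n\<in>M. x [^] n = \<one>}"
  then show "inv x \<in> {x \<in> carrier G. \<exists>n\<in>M. x [^] n = \<one>}" by (auto simp: nat_pow_inv)
  fix y assume y: "y \<in> {x \<in> carrier G. \<exists>n\<in>M. x [^] n = \<one>}"
  obtain m n where mn: "m \<in> M" "x [^] m = \<one>" "n \<in> M" "y [^] n = \<one>" using x y by blast
  have "(x \<otimes> y) [^] (m * n) = (x [^] m) [^] n \<otimes> (y [^] n) [^] m"
    using x y by (simp add: nat_pow_distrib nat_pow_pow mult.commute)
  then have "(x \<otimes> y) [^] (m * n) = \<one>" using mn by simp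
  then show "x \<otimes> y \<in> {x \<in> carrier G. \<exists>n\<in>M. x [^] n = \<one>}" using x y mult[OF mn(1,3)] by blast
qed auto

lemma comm_group_primary_part:
  assumes "comm_group A"
  shows "comm_group (primary_part p A)"
proof -
  interpret A: comm_group A by fact
  have "subgroup {x \<in> carrier A. \<exists>n\<in>range ((^) p). x [^]\<^bsub>A\<^esub> n = \<one>\<^bsub>A\<^esub>} A"
    by (rule A.subgroup_torsion) (auto simp: image_iff intro: exI[of _ 0] power_add[symmetric])
  from A.comm_group_subgroup[OF this] show ?thesis by (simp add: primary_part_def)
qed

lemma comm_group_prime_to_part:
  assumes "comm_group A"
  shows "comm_group (prime_to_part p A)"
proof -
  interpret A: comm_group A by fact
  have "subgroup {x \<in> carrier A. \<exists>n\<in>{n. 0 < n \<and> coprime n p}. x [^]\<^bsub>A\<^esub> n = \<one>\<^bsub>A\<^esub>} A"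
    by (rule A.subgroup_torsion) auto
  from A.comm_group_subgroup[OF this] show ?thesis by (simp add: prime_to_part_def conj_assoc)
qed

section \<open>Second cohomology of a module\<close>

lemma (in comm_group) comm_group_product_group: "comm_group (product_group I (\<lambda>_. G))"
  by (rule group.group_comm_groupI) (auto simp: m_comm PiE_iff intro!: restrict_ext)

locale module_action = Q?: group Q + M?: comm_group M
  for Q :: "('g, 'x) monoid_scheme" (structure) and M :: "('m, 'y) monoid_scheme" (structure) +
  fixes act :: "'g \<Rightarrow> 'm \<Rightarrow> 'm"
  assumes act_hom: "g \<in> carrier Q \<Longrightarrow> act g \<in> hom M M"
    and act_mult: "\<lbrakk>g \<in> carrier Q; h \<in> carrier Q; m \<in> carrier M\<rbrakk> \<Longrightarrow> act (g \<otimes>\<^bsub>Q\<^esub> h) m = act g (act h m)"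
begin

lemma act_closed [simp, intro]: "\<lbrakk>g \<in> carrier Q; m \<in> carrier M\<rbrakk> \<Longrightarrow> act g m \<in> carrier M"
  using act_hom by (auto simp: hom_def)

lemma act_hom_mult: "\<lbrakk>g \<in> carrier Q; m \<in> carrier M; m' \<in> carrier M\<rbrakk>
    \<Longrightarrow> act g (m \<otimes>\<^bsub>M\<^esub> m') = act g m \<otimes>\<^bsub>M\<^esub> act g m'"
  using act_hom by (auto simp: hom_def)

lemma act_inv: "\<lbrakk>g \<in> carrier Q; m \<in> carrier M\<rbrakk> \<Longrightarrow> act g (inv\<^bsub>M\<^esub> m) = inv\<^bsub>M\<^esub> (act g m)"
  using group_hom.hom_inv[of M M "act g"] act_hom M.is_group
  by (simp add: group_hom_def group_hom_axioms_def)

lemma comm_group_cochains2: "comm_group (cochains2 Q M)"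
  unfolding cochains2_def by (rule M.comm_group_product_group)

lemma comm_group_cochains1: "comm_group (cochains1 Q M)"
  unfolding cochains1_def by (rule M.comm_group_product_group)

lemma group_cochains3: "group (cochains3 Q M)"
  unfolding cochains3_def by simp

lemma diff2_hom: "diff2 Q M act \<in> hom (cochains2 Q M) (cochains3 Q M)"
proof (rule homI)
  fix c assume "c \<in> carrier (cochains2 Q M)"
  then have c: "\<And>g h. g \<in> carrier Q \<Longrightarrow> h \<in> carrier Q \<Longrightarrow> c (g, h) \<in> carrier M"
    by (auto simp: cochains2_def)
  then show "diff2 Q M act c \<in> carrier (cochains3 Q M)"
    by (auto simp: diff2_def cochains3_def)
next
  fix c d assume "c \<in> carrier (cochains2 Q M)" "d \<in> carrier (cochains2 Q M)"
  then have c: "\<And>g h. g \<in> carrier Q \<Longrightarrow> h \<in> carrier Q \<Longrightarrow> c (g, h) \<in> carrier M"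
    and d: "\<And>g h. g \<in> carrier Q \<Longrightarrow> h \<in> carrier Q \<Longrightarrow> d (g, h) \<in> carrier M"
    by (auto simp: cochains2_def)
  show "diff2 Q M act (c \<otimes>\<^bsub>cochains2 Q M\<^esub> d) =
      diff2 Q M act c \<otimes>\<^bsub>cochains3 Q M\<^esub> diff2 Q M act d"
    by (auto simp: diff2_def cochains3_def cochains2_def c d act_hom_mult act_inv M.inv_mult M.m_ac
        intro!: ext)
qed

lemma diff1_hom: "diff1 Q M act \<in> hom (cochains1 Q M) (cochains2 Q M)"
proof (rule homI)
  fix c assume "c \<in> carrier (cochains1 Q M)"
  then have c: "\<And>g. g \<in> carrier Q \<Longrightarrow> c g \<in> carrier M"
    by (auto simp: cochains1_def)
  then show "diff1 Q M act c \<in> carrier (cochains2 Q M)"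
    by (auto simp: diff1_def cochains2_def)
next
  fix c d assume "c \<in> carrier (cochains1 Q M)" "d \<in> carrier (cochains1 Q M)"
  then have c: "\<And>g. g \<in> carrier Q \<Longrightarrow> c g \<in> carrier M"
    and d: "\<And>g. g \<in> carrier Q \<Longrightarrow> d g \<in> carrier M"
    by (auto simp: cochains1_def)
  show "diff1 Q M act (c \<otimes>\<^bsub>cochains1 Q M\<^esub> d) =
      diff1 Q M act c \<otimes>\<^bsub>cochains2 Q M\<^esub> diff1 Q M act d"
    by (auto simp: diff1_def cochains1_def cochains2_def c d act_hom_mult act_inv M.inv_mult M.m_ac
        intro!: ext)
qed

lemma cocycles2_iff: "c \<in> carrier (cocycles2 Q M act) \<longleftrightarrow>
   c \<in> carrier Q \<times> carrier Q \<rightarrow>\<^sub>E carrier M \<and>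
   (\<forall>g\<in>carrier Q. \<forall>h\<in>carrier Q. \<forall>k\<in>carrier Q.
      act g (c (h, k)) \<otimes>\<^bsub>M\<^esub> inv\<^bsub>M\<^esub> c (g \<otimes>\<^bsub>Q\<^esub> h, k)
          \<otimes>\<^bsub>M\<^esub> c (g, h \<otimes>\<^bsub>Q\<^esub> k) \<otimes>\<^bsub>M\<^esub> inv\<^bsub>M\<^esub> c (g, h) = \<one>\<^bsub>M\<^esub>)"
  unfolding cocycles2_def kernel_def cochains2_def cochains3_def diff2_def
  by (auto simp: fun_eq_iff restrict_def split: if_splits)

lemma subgroup_cocycles2: "subgroup (carrier (cocycles2 Q M act)) (cochains2 Q M)"
proof -
  interpret group_hom "cochains2 Q M" "cochains3 Q M" "diff2 Q M act"
    using diff2_hom comm_group_cochains2 group_cochains3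
    by (simp add: group_hom_def group_hom_axioms_def comm_group_def)
  show ?thesis using subgroup_kernel by (simp add: cocycles2_def)
qed

lemma comm_group_cocycles2: "comm_group (cocycles2 Q M act)"
proof -
  have "comm_group ((cochains2 Q M)\<lparr>carrier := carrier (cocycles2 Q M act)\<rparr>)"
    by (rule comm_group.comm_group_subgroup[OF comm_group_cochains2 subgroup_cocycles2])
  then show ?thesis by (simp add: cocycles2_def)
qed

lemma coboundaries2_subset: "coboundaries2 Q M act \<subseteq> carrier (cocycles2 Q M act)"
proof
  fix c assume "c \<in> coboundaries2 Q M act"
  then obtain b where b: "b \<in> carrier (cochains1 Q M)" and c: "c = diff1 Q M act b"
    by (auto simp: coboundaries2_def)
  have bM: "\<And>g. g \<in> carrier Q \<Longrightarrow> b g \<in> carrier M" using b by (auto simp: cochains1_def)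
  show "c \<in> carrier (cocycles2 Q M act)"
    unfolding cocycles2_iff
  proof (intro conjI ballI)
    show "c \<in> carrier Q \<times> carrier Q \<rightarrow>\<^sub>E carrier M"
      using diff1_hom b by (auto simp: c hom_def cochains2_def)
    fix g h k assume ghk: "g \<in> carrier Q" "h \<in> carrier Q" "k \<in> carrier Q"
    show "act g (c (h, k)) \<otimes>\<^bsub>M\<^esub> inv\<^bsub>M\<^esub> c (g \<otimes>\<^bsub>Q\<^esub> h, k)
          \<otimes>\<^bsub>M\<^esub> c (g, h \<otimes>\<^bsub>Q\<^esub> k) \<otimes>\<^bsub>M\<^esub> inv\<^bsub>M\<^esub> c (g, h) = \<one>\<^bsub>M\<^esub>"
      using ghk bM
      by (simp add: c diff1_def act_hom_mult act_inv act_mult M.inv_mult M.m_ac Q.m_assoc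
          M.inv_cancel)
  qed
qed

lemma subgroup_coboundaries2: "subgroup (coboundaries2 Q M act) (cocycles2 Q M act)"
proof -
  interpret group_hom "cochains1 Q M" "cochains2 Q M" "diff1 Q M act"
    using diff1_hom comm_group_cochains2 comm_group_cochains1
    by (simp add: group_hom_def group_hom_axioms_def comm_group_def)
  have "subgroup (coboundaries2 Q M act) (cochains2 Q M)"
    unfolding coboundaries2_def by (rule img_is_subgroup)
  then have "subgroup (coboundaries2 Q M act) ((cochains2 Q M)\<lparr>carrier := carrier (cocycles2 Q M act)\<rparr>)"
    using group.subgroup_incl[OF H.is_group] subgroup_cocycles2 coboundaries2_subset by blast
  then show ?thesis by (simp add: cocycles2_def)
qed

lemma comm_group_H2: "comm_group (H2 Q M act)"
  unfolding H2_def using comm_group.abelian_FactGroup[OF comm_group_cocycles2] subgroup_coboundaries2 by blast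

lemma normal_coboundaries2: "coboundaries2 Q M act \<lhd> cocycles2 Q M act"
  using comm_group.subgroup_imp_normal[OF comm_group_cocycles2] subgroup_coboundaries2 by blast

definition cohom_class :: "('g \<times> 'g \<Rightarrow> 'm) \<Rightarrow> ('g \<times> 'g \<Rightarrow> 'm) set" where
  "cohom_class c = coboundaries2 Q M act #>\<^bsub>cocycles2 Q M act\<^esub> c"

lemma carrier_H2: "carrier (H2 Q M act) = cohom_class ` carrier (cocycles2 Q M act)"
  by (auto simp: H2_def FactGroup_def RCOSETS_def cohom_class_def)

lemma cohom_class_mult: "\<lbrakk>c \<in> carrier (cocycles2 Q M act); d \<in> carrier (cocycles2 Q M act)\<rbrakk> \<Longrightarrow>
   cohom_class (c \<otimes>\<^bsub>cocycles2 Q M act\<^esub> d) = cohom_class c \<otimes>\<^bsub>H2 Q M act\<^esub> cohom_class d"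
  using normal.rcos_sum[OF normal_coboundaries2] by (simp add: cohom_class_def H2_def FactGroup_def)

lemma cohom_class_eq_iff:
  assumes c: "c \<in> carrier (cocycles2 Q M act)" and d: "d \<in> carrier (cocycles2 Q M act)"
  shows "cohom_class c = cohom_class d \<longleftrightarrow> (\<exists>b\<in>coboundaries2 Q M act. c = b \<otimes>\<^bsub>cocycles2 Q M act\<^esub> d)"
proof -
  interpret Z: comm_group "cocycles2 Q M act" by (rule comm_group_cocycles2)
  have "cohom_class c = cohom_class d \<longleftrightarrow> c \<in> cohom_class d"
    using Z.repr_independence[OF _ d subgroup_coboundaries2, of c]
      Z.rcos_self[OF c subgroup_coboundaries2] by (auto simp: cohom_class_def)
  then show ?thesis by (auto simp: cohom_class_def r_coset_def)
qed

lemma cohom_class_eq_one_iff: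
  assumes c: "c \<in> carrier (cocycles2 Q M act)"
  shows "cohom_class c = \<one>\<^bsub>H2 Q M act\<^esub> \<longleftrightarrow> c \<in> coboundaries2 Q M act"
proof -
  interpret Z: comm_group "cocycles2 Q M act" by (rule comm_group_cocycles2)
  show ?thesis
    using Z.coset_join1 Z.coset_join2 c subgroup_coboundaries2 coboundaries2_subset
    by (auto simp: cohom_class_def H2_def FactGroup_def)
qed

lemma module_action_subgroup:
  assumes "subgroup D Q"
  shows "module_action (Q\<lparr>carrier := D\<rparr>) M act"
proof -
  interpret D: group "Q\<lparr>carrier := D\<rparr>"
    using Q.subgroup_imp_group[OF assms] .
  show ?thesis
    using subgroup.subset[OF assms]
    by unfold_locales (auto simp: act_hom act_mult subset_iff)
qed

lemma restrict_cocycle: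
  assumes D: "subgroup D Q" and c: "c \<in> carrier (cocycles2 Q M act)"
  shows "restrict c (D \<times> D) \<in> carrier (cocycles2 (Q\<lparr>carrier := D\<rparr>) M act)"
proof -
  interpret D: module_action "Q\<lparr>carrier := D\<rparr>" M act by (rule module_action_subgroup[OF D])
  show ?thesis
    using c subgroup.subset[OF D] subgroup.m_closed[OF D]
    unfolding cocycles2_iff D.cocycles2_iff by (auto simp: subset_iff PiE_iff)
qed

lemma restrict_coboundary:
  assumes D: "subgroup D Q" and c: "c \<in> coboundaries2 Q M act"
  shows "restrict c (D \<times> D) \<in> coboundaries2 (Q\<lparr>carrier := D\<rparr>) M act"
proof -
  obtain b where b: "b \<in> carrier Q \<rightarrow>\<^sub>E carrier M" and cb: "c = diff1 Q M act b"
    using c by (auto simp: coboundaries2_def cochains1_def)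
  have "restrict c (D \<times> D) = diff1 (Q\<lparr>carrier := D\<rparr>) M act (restrict b D)"
    using subgroup.subset[OF D] subgroup.m_closed[OF D]
    by (auto simp: cb diff1_def fun_eq_iff restrict_def subset_iff)
  moreover have "restrict b D \<in> carrier (cochains1 (Q\<lparr>carrier := D\<rparr>) M)"
    using b subgroup.subset[OF D] by (auto simp: cochains1_def)
  ultimately show ?thesis unfolding coboundaries2_def by blast
qed

lemma res2_cohom_class:
  assumes D: "subgroup D Q" and c: "c \<in> carrier (cocycles2 Q M act)"
  shows "res2 Q M act D (cohom_class c) = module_action.cohom_class (Q\<lparr>carrier := D\<rparr>) M act (restrict c (D \<times> D))"
proof -
  interpret D: module_action "Q\<lparr>carrier := D\<rparr>" M act by (rule module_action_subgroup[OF D])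
  have "D.cohom_class (restrict d (D \<times> D)) = D.cohom_class (restrict c (D \<times> D))" if d: "d \<in> cohom_class c" for d
  proof -
    obtain b where b: "b \<in> coboundaries2 Q M act" and dd: "d = b \<otimes>\<^bsub>cocycles2 Q M act\<^esub> c"
      using d by (auto simp: cohom_class_def r_coset_def)
    have dc: "d \<in> carrier (cocycles2 Q M act)"
      using dd b c coboundaries2_subset comm_group.axioms(2)[OF comm_group_cocycles2]
      by (metis group.is_monoid monoid.m_closed subset_eq)
    have eq: "restrict d (D \<times> D) =
        restrict b (D \<times> D) \<otimes>\<^bsub>cocycles2 (Q\<lparr>carrier := D\<rparr>) M act\<^esub> restrict c (D \<times> D)"
      using subgroup.subset[OF D] by (auto simp: dd cocycles2_def cochains2_def fun_eq_iff restrict_def subset_iff)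
    show ?thesis
      unfolding D.cohom_class_eq_iff[OF restrict_cocycle[OF D dc] restrict_cocycle[OF D c]]
      using eq restrict_coboundary[OF D b] by blast
  qed
  moreover have "c \<in> cohom_class c"
    unfolding cohom_class_def
    using group.rcos_self[OF comm_group.axioms(2)[OF comm_group_cocycles2] c subgroup_coboundaries2] .
  ultimately have "(\<lambda>d. D.cohom_class (restrict d (D \<times> D))) ` cohom_class c = {D.cohom_class (restrict c (D \<times> D))}"
    by blast
  then show ?thesis by (simp add: res2_def D.cohom_class_def)
qed

lemma cohom_class_in_Sha2_iff:
  assumes D: "\<And>D. D \<in> \<D> \<Longrightarrow> subgroup D Q"
    and c: "c \<in> carrier (cocycles2 Q M act)"
  shows "cohom_class c \<in> carrier (Sha2 Q \<D> M act) \<longleftrightarrow>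
    (\<forall>D\<in>\<D>. restrict c (D \<times> D) \<in> coboundaries2 (Q\<lparr>carrier := D\<rparr>) M act)"
proof -
  have "cohom_class c \<in> carrier (Sha2 Q \<D> M act) \<longleftrightarrow>
     (\<lambda>D\<in>\<D>. res2 Q M act D (cohom_class c)) = (\<lambda>D\<in>\<D>. \<one>\<^bsub>H2 (Q\<lparr>carrier := D\<rparr>) M act\<^esub>)"
    using c by (simp add: Sha2_def kernel_def carrier_H2)
  also have "\<dots> \<longleftrightarrow> (\<forall>D\<in>\<D>. res2 Q M act D (cohom_class c) = \<one>\<^bsub>H2 (Q\<lparr>carrier := D\<rparr>) M act\<^esub>)"
    by (auto simp: fun_eq_iff restrict_def)
  also have "\<dots> \<longleftrightarrow> (\<forall>D\<in>\<D>. restrict c (D \<times> D) \<in> coboundaries2 (Q\<lparr>carrier := D\<rparr>) M act)"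
    using module_action.cohom_class_eq_one_iff[OF module_action_subgroup[OF D] restrict_cocycle[OF D c]]
    by (simp add: res2_cohom_class[OF D c])
  finally show ?thesis .
qed

end

section \<open>The lattice of a subgroup\<close>

locale coset_module = G?: group G for G :: "('a, 'x) monoid_scheme" (structure) +
  fixes H :: "'a set"
  assumes subgroup_H: "subgroup H G"
begin

lemma H_carrier: "h \<in> H \<Longrightarrow> h \<in> carrier G"
  using subgroup.mem_carrier[OF subgroup_H] .

definition left_invariant :: "('a \<Rightarrow> 'b) \<Rightarrow> bool" where
  "left_invariant f \<longleftrightarrow> (\<forall>x\<in>carrier G. \<forall>h\<in>H. f (h \<otimes> x) = f x)"

lemma left_invariantD: "\<lbrakk>left_invariant f; x \<in> carrier G; h \<in> H\<rbrakk> \<Longrightarrow> f (h \<otimes> x) = f x"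
  by (simp add: left_invariant_def)

lemma left_invariant_const: "left_invariant (\<lambda>_. c)"
  by (simp add: left_invariant_def)

lemma left_invariant_comp: "left_invariant f \<Longrightarrow> left_invariant (\<lambda>x. F (f x))"
  by (simp add: left_invariant_def)

lemma left_invariant_comp2: "\<lbrakk>left_invariant f; left_invariant g\<rbrakk> \<Longrightarrow> left_invariant (\<lambda>x. F (f x) (g x))"
  by (simp add: left_invariant_def)

lemma left_invariant_translate: "\<lbrakk>left_invariant f; g \<in> carrier G\<rbrakk> \<Longrightarrow> left_invariant (\<lambda>x. f (x \<otimes> g))"
  using H_carrier by (auto simp: left_invariant_def G.m_assoc)

lemma left_invariant_rcoset:
  assumes "left_invariant f" "x \<in> carrier G" "y \<in> carrier G" "H #> x = H #> y"
  shows "f x = f y"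
proof -
  have "x \<otimes> inv y \<in> H" using assms G.rcoset_eq_iff[OF subgroup_H] by blast
  from left_invariantD[OF assms(1,3) this] show ?thesis using assms by (simp add: G.m_assoc)
qed

abbreviation constfuns :: "('a \<Rightarrow> int) set" where "constfuns \<equiv> range (\<lambda>n::int. \<lambda>g\<in>carrier G. n)"

lemma Ind_int_iff: "\<phi> \<in> carrier (Ind_int G H) \<longleftrightarrow> \<phi> \<in> extensional (carrier G) \<and> left_invariant \<phi>"
  by (auto simp: Ind_int_def left_invariant_def PiE_def)

lemma Ind_int_mult: "\<phi> \<otimes>\<^bsub>Ind_int G H\<^esub> \<psi> = (\<lambda>x\<in>carrier G. \<phi> x + \<psi> x)"
  by (simp add: Ind_int_def)

lemma Ind_int_one: "\<one>\<^bsub>Ind_int G H\<^esub> = (\<lambda>x\<in>carrier G. 0)"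
  by (simp add: Ind_int_def)

lemma restrict_in_Ind_int: "left_invariant \<phi> \<Longrightarrow> restrict \<phi> (carrier G) \<in> carrier (Ind_int G H)"
  using H_carrier by (auto simp: Ind_int_iff left_invariant_def)

lemma comm_group_Ind_int: "comm_group (Ind_int G H)"
proof (rule comm_groupI)
  fix \<phi> assume \<phi>: "\<phi> \<in> carrier (Ind_int G H)"
  then have "restrict \<phi> (carrier G) = \<phi>" by (simp add: Ind_int_iff extensional_restrict)
  then show "\<one>\<^bsub>Ind_int G H\<^esub> \<otimes>\<^bsub>Ind_int G H\<^esub> \<phi> = \<phi>"
    by (simp add: Ind_int_mult Ind_int_one cong: restrict_cong)
  show "\<exists>\<psi>\<in>carrier (Ind_int G H). \<psi> \<otimes>\<^bsub>Ind_int G H\<^esub> \<phi> = \<one>\<^bsub>Ind_int G H\<^esub>"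
  proof
    show "(\<lambda>x\<in>carrier G. - \<phi> x) \<in> carrier (Ind_int G H)"
      using \<phi> restrict_in_Ind_int[of "\<lambda>x. - \<phi> x"] by (simp add: Ind_int_iff left_invariant_def)
  qed (auto simp: Ind_int_mult Ind_int_one)
  fix \<psi> assume "\<psi> \<in> carrier (Ind_int G H)"
  then show "\<phi> \<otimes>\<^bsub>Ind_int G H\<^esub> \<psi> \<in> carrier (Ind_int G H)"
    unfolding Ind_int_mult using \<phi> by (intro restrict_in_Ind_int) (auto simp: Ind_int_iff left_invariant_def)
qed (auto simp: Ind_int_mult Ind_int_one restrict_in_Ind_int left_invariant_const intro!: restrict_ext)

lemma subgroup_constfuns: "subgroup constfuns (Ind_int G H)"
proof -
  interpret I: comm_group "Ind_int G H" by (rule comm_group_Ind_int)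
  have const: "(\<lambda>g\<in>carrier G. n) \<in> carrier (Ind_int G H)" for n
    by (rule restrict_in_Ind_int[OF left_invariant_const])
  have inv: "inv\<^bsub>Ind_int G H\<^esub> (\<lambda>g\<in>carrier G. n) = (\<lambda>g\<in>carrier G. - n)" for n
    by (rule I.inv_equality) (auto simp: const Ind_int_mult Ind_int_one)
  have mult: "(\<lambda>g\<in>carrier G. m) \<otimes>\<^bsub>Ind_int G H\<^esub> (\<lambda>g\<in>carrier G. n) = (\<lambda>g\<in>carrier G. m + n)" for m n
    by (auto simp: Ind_int_mult)
  show ?thesis by (rule I.subgroupI) (auto simp: const inv mult)
qed

lemma comm_group_J: "comm_group (J G H)"
  unfolding J_def using comm_group.abelian_FactGroup[OF comm_group_Ind_int subgroup_constfuns] .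

text \<open>Real representatives of a class in \<open>J\<close> make cochain identities exact, with no constants to carry.\<close>

definition integral_mod_const :: "('a \<Rightarrow> real) \<Rightarrow> bool" where
  "integral_mod_const f \<longleftrightarrow> left_invariant f \<and> (\<forall>x\<in>carrier G. f x - f \<one> \<in> \<int>)"

definition J_class :: "('a \<Rightarrow> real) \<Rightarrow> ('a \<Rightarrow> int) set" where
  "J_class f = {\<psi> \<in> extensional (carrier G). \<exists>c. \<forall>x\<in>carrier G. real_of_int (\<psi> x) = f x + c}"

lemma integral_mod_const_of_int: "left_invariant \<phi> \<Longrightarrow> integral_mod_const (\<lambda>x. real_of_int (\<phi> x))"
  by (simp add: integral_mod_const_def left_invariant_def)

lemma integral_mod_const_add:
  assumes "integral_mod_const f" "integral_mod_const g"
  shows "integral_mod_const (\<lambda>x. f x + g x)"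
  unfolding integral_mod_const_def
proof (intro conjI ballI)
  fix x assume "x \<in> carrier G"
  then have "(f x - f \<one>) + (g x - g \<one>) \<in> \<int>"
    using assms by (intro Ints_add) (simp_all add: integral_mod_const_def)
  then show "f x + g x - (f \<one> + g \<one>) \<in> \<int>" by (simp add: algebra_simps)
qed (use assms in \<open>simp add: integral_mod_const_def left_invariant_comp2\<close>)

lemma integral_mod_const_uminus:
  assumes "integral_mod_const f"
  shows "integral_mod_const (\<lambda>x. - f x)"
  unfolding integral_mod_const_def
proof (intro conjI ballI)
  fix x assume "x \<in> carrier G"
  then have "- (f x - f \<one>) \<in> \<int>"
    using assms by (intro Ints_minus) (simp add: integral_mod_const_def)
  then show "- f x - - f \<one> \<in> \<int>" by simp
qed (use assms in \<open>simp add: integral_mod_const_def left_invariant_comp\<close>)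

lemma integral_mod_const_diff:
  "\<lbrakk>integral_mod_const f; integral_mod_const g\<rbrakk> \<Longrightarrow> integral_mod_const (\<lambda>x. f x - g x)"
  using integral_mod_const_add[OF _ integral_mod_const_uminus] by simp

lemma integral_mod_const_translate:
  assumes f: "integral_mod_const f" and g: "g \<in> carrier G"
  shows "integral_mod_const (\<lambda>x. f (x \<otimes> g))"
proof -
  have "f (x \<otimes> g) - f (\<one> \<otimes> g) \<in> \<int>" if "x \<in> carrier G" for x
    using Ints_diff[of "f (x \<otimes> g) - f \<one>" "f (\<one> \<otimes> g) - f \<one>"] f g that
    by (simp add: integral_mod_const_def)
  moreover have "left_invariant (\<lambda>x. f (x \<otimes> g))"
    using f g by (intro left_invariant_translate) (simp_all add: integral_mod_const_def)
  ultimately show ?thesis by (simp add: integral_mod_const_def)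
qed

lemma J_class_cong:
  assumes "\<And>x. x \<in> carrier G \<Longrightarrow> f x = g x + c"
  shows "J_class f = J_class g"
proof
  have "J_class f \<subseteq> J_class g" if "\<And>x. x \<in> carrier G \<Longrightarrow> f x = g x + c" for f g c
    using that by (auto simp: J_class_def add.assoc)
  from this[of f g c] this[of g f "- c"] show "J_class f \<subseteq> J_class g" "J_class g \<subseteq> J_class f"
    using assms by simp_all
qed

lemma J_class_of_int:
  "J_class (\<lambda>x. real_of_int (\<phi> x)) = constfuns #>\<^bsub>Ind_int G H\<^esub> restrict \<phi> (carrier G)"
proof -
  have const_mult: "(\<lambda>x\<in>carrier G. n) \<otimes>\<^bsub>Ind_int G H\<^esub> restrict \<phi> (carrier G) = (\<lambda>x\<in>carrier G. n + \<phi> x)" for n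
    by (auto simp: Ind_int_mult intro!: restrict_ext)
  have "\<psi> \<in> J_class (\<lambda>x. real_of_int (\<phi> x)) \<longleftrightarrow> (\<exists>n. \<psi> = (\<lambda>x\<in>carrier G. n + \<phi> x))" for \<psi>
  proof
    assume "\<psi> \<in> J_class (\<lambda>x. real_of_int (\<phi> x))"
    then obtain c where ext: "\<psi> \<in> extensional (carrier G)"
      and c: "\<And>x. x \<in> carrier G \<Longrightarrow> real_of_int (\<psi> x) = real_of_int (\<phi> x) + c" by (auto simp: J_class_def)
    show "\<exists>n. \<psi> = (\<lambda>x\<in>carrier G. n + \<phi> x)"
    proof (intro exI extensionalityI[OF ext restrict_extensional])
      fix x assume x: "x \<in> carrier G"
      have "\<psi> x = (\<psi> \<one> - \<phi> \<one>) + \<phi> x" using c[OF x] c[OF G.one_closed] by linarith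
      then show "\<psi> x = (\<lambda>x\<in>carrier G. (\<psi> \<one> - \<phi> \<one>) + \<phi> x) x" using x by simp
    qed
  qed (auto simp: J_class_def)
  then show ?thesis by (auto simp: r_coset_def const_mult)
qed

lemma integral_mod_constE:
  assumes "integral_mod_const f"
  obtains \<phi> where "left_invariant \<phi>" "\<forall>x\<in>carrier G. real_of_int (\<phi> x) = f x - f \<one>"
    "J_class f = constfuns #>\<^bsub>Ind_int G H\<^esub> restrict \<phi> (carrier G)"
proof
  show "left_invariant (\<lambda>x. \<lfloor>f x - f \<one>\<rfloor>)"
    using assms by (auto simp: integral_mod_const_def left_invariant_def)
  show floor: "\<forall>x\<in>carrier G. real_of_int \<lfloor>f x - f \<one>\<rfloor> = f x - f \<one>"
  proof
    fix x assume "x \<in> carrier G"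
    then have "f x - f \<one> \<in> \<int>" using assms by (simp add: integral_mod_const_def)
    then obtain z where "f x - f \<one> = of_int z" by (rule Ints_cases)
    then show "real_of_int \<lfloor>f x - f \<one>\<rfloor> = f x - f \<one>" by simp
  qed
  have "J_class f = J_class (\<lambda>x. real_of_int \<lfloor>f x - f \<one>\<rfloor>)"
    by (rule J_class_cong[where c = "f \<one>"]) (simp add: floor)
  then show "J_class f = constfuns #>\<^bsub>Ind_int G H\<^esub> (\<lambda>x\<in>carrier G. \<lfloor>f x - f \<one>\<rfloor>)"
    by (simp only: J_class_of_int)
qed

lemma J_class_eq_iff:
  assumes "integral_mod_const f"
  shows "J_class f = J_class g \<longleftrightarrow> (\<exists>c. \<forall>x\<in>carrier G. f x = g x + c)"
proof
  obtain \<phi> where \<phi>: "\<forall>x\<in>carrier G. real_of_int (\<phi> x) = f x - f \<one>"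
    using integral_mod_constE[OF assms] by blast
  have "restrict \<phi> (carrier G) \<in> J_class f"
    unfolding J_class_def by (auto intro!: exI[of _ "- f \<one>"] simp: \<phi>)
  moreover assume "J_class f = J_class g"
  ultimately have "restrict \<phi> (carrier G) \<in> J_class g" by simp
  then obtain d where d: "\<And>x. x \<in> carrier G \<Longrightarrow> real_of_int (\<phi> x) = g x + d"
    by (auto simp: J_class_def)
  have "f x = g x + (d + f \<one>)" if "x \<in> carrier G" for x using bspec[OF \<phi> that] d[OF that] by simp
  then show "\<exists>c. \<forall>x\<in>carrier G. f x = g x + c" by blast
next
  assume "\<exists>c. \<forall>x\<in>carrier G. f x = g x + c"
  then obtain c where c: "\<forall>x\<in>carrier G. f x = g x + c" ..
  show "J_class f = J_class g" by (rule J_class_cong[OF bspec[OF c]])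
qed

lemma carrier_J: "carrier (J G H) = J_class ` {f. integral_mod_const f}"
proof (intro equalityI subsetI)
  fix m assume "m \<in> carrier (J G H)"
  then obtain \<phi> where \<phi>: "\<phi> \<in> carrier (Ind_int G H)" "m = constfuns #>\<^bsub>Ind_int G H\<^esub> \<phi>"
    by (auto simp: J_def FactGroup_def RCOSETS_def)
  then have "m = J_class (\<lambda>x. real_of_int (\<phi> x))"
    by (simp add: J_class_of_int Ind_int_iff extensional_restrict)
  then show "m \<in> J_class ` {f. integral_mod_const f}"
    using \<phi>(1) integral_mod_const_of_int by (auto simp: Ind_int_iff)
next
  fix m assume "m \<in> J_class ` {f. integral_mod_const f}"
  then obtain f where f: "integral_mod_const f" "m = J_class f" by blast
  obtain \<phi> where "left_invariant \<phi>" "\<forall>x\<in>carrier G. real_of_int (\<phi> x) = f x - f \<one>"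
    "J_class f = constfuns #>\<^bsub>Ind_int G H\<^esub> restrict \<phi> (carrier G)"
    using integral_mod_constE[OF f(1)] .
  then show "m \<in> carrier (J G H)"
    using restrict_in_Ind_int f(2) by (auto simp: J_def FactGroup_def RCOSETS_def)
qed

lemma J_class_closed [simp, intro]: "integral_mod_const f \<Longrightarrow> J_class f \<in> carrier (J G H)"
  by (auto simp: carrier_J)

lemma J_cases:
  assumes "m \<in> carrier (J G H)"
  obtains f where "integral_mod_const f" "m = J_class f"
  using assms by (auto simp: carrier_J)

lemma J_class_mult:
  assumes "integral_mod_const f" "integral_mod_const g"
  shows "J_class f \<otimes>\<^bsub>J G H\<^esub> J_class g = J_class (\<lambda>x. f x + g x)"
proof -
  obtain \<phi> where \<phi>: "left_invariant \<phi>" "\<forall>x\<in>carrier G. real_of_int (\<phi> x) = f x - f \<one>"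
    "J_class f = constfuns #>\<^bsub>Ind_int G H\<^esub> restrict \<phi> (carrier G)"
    using integral_mod_constE[OF assms(1)] .
  obtain \<psi> where \<psi>: "left_invariant \<psi>" "\<forall>x\<in>carrier G. real_of_int (\<psi> x) = g x - g \<one>"
    "J_class g = constfuns #>\<^bsub>Ind_int G H\<^esub> restrict \<psi> (carrier G)"
    using integral_mod_constE[OF assms(2)] .
  have "constfuns \<lhd> Ind_int G H"
    by (rule comm_group.subgroup_imp_normal[OF comm_group_Ind_int subgroup_constfuns])
  from normal.rcos_sum[OF this restrict_in_Ind_int[OF \<phi>(1)] restrict_in_Ind_int[OF \<psi>(1)]]
  have "J_class f \<otimes>\<^bsub>J G H\<^esub> J_class g
      = constfuns #>\<^bsub>Ind_int G H\<^esub> (restrict \<phi> (carrier G) \<otimes>\<^bsub>Ind_int G H\<^esub> restrict \<psi> (carrier G))"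
    by (simp add: \<phi>(3) \<psi>(3) J_def FactGroup_def)
  also have "restrict \<phi> (carrier G) \<otimes>\<^bsub>Ind_int G H\<^esub> restrict \<psi> (carrier G) = (\<lambda>x\<in>carrier G. \<phi> x + \<psi> x)"
    by (auto simp: Ind_int_mult)
  also have "constfuns #>\<^bsub>Ind_int G H\<^esub> \<dots> = J_class (\<lambda>x. real_of_int (\<phi> x + \<psi> x))"
    by (rule J_class_of_int[symmetric])
  also have "\<dots> = J_class (\<lambda>x. f x + g x)"
    by (rule J_class_cong[where c = "- f \<one> - g \<one>"]) (simp add: \<phi>(2) \<psi>(2))
  finally show ?thesis .
qed

lemma J_class_zero: "J_class (\<lambda>_. 0) = \<one>\<^bsub>J G H\<^esub>"
proof -
  interpret J: comm_group "J G H" by (rule comm_group_J)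
  have "integral_mod_const (\<lambda>_. 0)" using integral_mod_const_of_int[OF left_invariant_const[of 0]] by simp
  then show ?thesis using J_class_mult[of "\<lambda>_. 0" "\<lambda>_. 0"] J.l_cancel_one by (metis J_class_closed add_0)
qed

lemma J_class_eq_one_iff:
  "integral_mod_const f \<Longrightarrow> J_class f = \<one>\<^bsub>J G H\<^esub> \<longleftrightarrow> (\<exists>c. \<forall>x\<in>carrier G. f x = c)"
  using J_class_eq_iff[of f "\<lambda>_. 0"] by (simp add: J_class_zero)

lemma J_class_inv:
  assumes "integral_mod_const f"
  shows "inv\<^bsub>J G H\<^esub> J_class f = J_class (\<lambda>x. - f x)"
proof -
  interpret J: comm_group "J G H" by (rule comm_group_J)
  show ?thesis
    by (rule J.inv_equality)
      (simp_all add: assms integral_mod_const_uminus J_class_mult J_class_zero)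
qed

lemma J_act_J_class:
  assumes g: "g \<in> carrier G"
  shows "J_act G g (J_class f) = J_class (\<lambda>x. f (x \<otimes> g))"
proof (intro equalityI subsetI)
  fix \<psi> assume "\<psi> \<in> J_act G g (J_class f)"
  then obtain \<phi> c where "\<psi> = (\<lambda>x\<in>carrier G. \<phi> (x \<otimes> g))"
    and "\<And>x. x \<in> carrier G \<Longrightarrow> real_of_int (\<phi> x) = f x + c"
    unfolding J_act_def Ind_act_def J_class_def by blast
  then have "\<psi> \<in> extensional (carrier G)"
    "\<forall>x\<in>carrier G. real_of_int (\<psi> x) = f (x \<otimes> g) + c"
    using g by simp_all
  then show "\<psi> \<in> J_class (\<lambda>x. f (x \<otimes> g))" unfolding J_class_def by blast
next
  fix \<psi> assume "\<psi> \<in> J_class (\<lambda>x. f (x \<otimes> g))"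
  then obtain c where ext: "\<psi> \<in> extensional (carrier G)"
    and c: "\<And>x. x \<in> carrier G \<Longrightarrow> real_of_int (\<psi> x) = f (x \<otimes> g) + c" by (auto simp: J_class_def)
  have "Ind_act G g (\<lambda>x\<in>carrier G. \<psi> (x \<otimes> inv g)) = \<psi>"
    using ext g by (intro extensionalityI[of _ "carrier G"]) (auto simp: Ind_act_def G.m_assoc)
  moreover have "real_of_int (\<psi> (x \<otimes> inv g)) = f x + c" if "x \<in> carrier G" for x
    using c[of "x \<otimes> inv g"] g that by (simp add: G.m_assoc)
  then have "(\<lambda>x\<in>carrier G. \<psi> (x \<otimes> inv g)) \<in> J_class f"
    unfolding J_class_def by auto
  ultimately show "\<psi> \<in> J_act G g (J_class f)" unfolding J_act_def by (metis imageI)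
qed

end

section \<open>Cocycles modulo constants\<close>

text \<open>
  \<open>\<tau>\<close> describes a right action of \<open>Q\<close> on the right cosets of \<open>H\<close>; it is the identity of \<open>G\<close>, or a
  system of representatives for a quotient of \<open>G\<close>.
\<close>

locale coset_cocycles = coset_module G H + Q?: group Q
  for G :: "('a, 'x) monoid_scheme" (structure) and H
    and Q :: "('c, 'y) monoid_scheme" (structure) +
  fixes \<tau> :: "'c \<Rightarrow> 'a"
  assumes finite_Q: "finite (carrier Q)"
    and tau_closed [simp, intro]: "\<gamma> \<in> carrier Q \<Longrightarrow> \<tau> \<gamma> \<in> carrier G"
    and tau_mult: "\<lbrakk>\<gamma> \<in> carrier Q; \<delta> \<in> carrier Q; x \<in> carrier G\<rbrakk> \<Longrightarrow>
        H #>\<^bsub>G\<^esub> (x \<otimes>\<^bsub>G\<^esub> \<tau> (\<gamma> \<otimes>\<^bsub>Q\<^esub> \<delta>)) = H #>\<^bsub>G\<^esub> (x \<otimes>\<^bsub>G\<^esub> \<tau> \<gamma> \<otimes>\<^bsub>G\<^esub> \<tau> \<delta>)"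
begin

lemma left_invariant_tau_mult:
  assumes "left_invariant m" "\<gamma> \<in> carrier Q" "\<delta> \<in> carrier Q" "x \<in> carrier G"
  shows "m (x \<otimes>\<^bsub>G\<^esub> \<tau> (\<gamma> \<otimes>\<^bsub>Q\<^esub> \<delta>)) = m (x \<otimes>\<^bsub>G\<^esub> \<tau> \<gamma> \<otimes>\<^bsub>G\<^esub> \<tau> \<delta>)"
  by (rule left_invariant_rcoset[OF assms(1)]) (use assms tau_mult in auto)

lemma left_invariant_tau_mult_one:
  assumes "left_invariant m" "\<gamma> \<in> carrier Q" "\<delta> \<in> carrier Q"
  shows "m (\<tau> (\<gamma> \<otimes>\<^bsub>Q\<^esub> \<delta>)) = m (\<tau> \<gamma> \<otimes>\<^bsub>G\<^esub> \<tau> \<delta>)"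
  using left_invariant_tau_mult[OF assms, of "\<one>\<^bsub>G\<^esub>"] assms by simp

lemma left_invariant_tau_one:
  assumes "left_invariant m" "x \<in> carrier G"
  shows "m (x \<otimes>\<^bsub>G\<^esub> \<tau> \<one>\<^bsub>Q\<^esub>) = m x"
proof -
  let ?y = "x \<otimes>\<^bsub>G\<^esub> inv\<^bsub>G\<^esub> \<tau> \<one>\<^bsub>Q\<^esub>"
  have "?y \<in> carrier G" "?y \<otimes>\<^bsub>G\<^esub> \<tau> \<one>\<^bsub>Q\<^esub> = x" using assms by (auto simp: G.m_assoc)
  then show ?thesis
    using left_invariant_tau_mult[OF assms(1) Q.one_closed Q.one_closed, of ?y] by simp
qed

definition mult_defect :: "('c \<Rightarrow> 'a \<Rightarrow> 'b::ab_group_add) \<Rightarrow> 'c \<Rightarrow> 'c \<Rightarrow> 'a \<Rightarrow> 'b" where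
  "mult_defect b \<gamma> \<delta> x = b \<gamma> x + b \<delta> (x \<otimes>\<^bsub>G\<^esub> \<tau> \<gamma>) - b (\<gamma> \<otimes>\<^bsub>Q\<^esub> \<delta>) x"

definition cocycle_mod_const :: "'c set \<Rightarrow> ('c \<Rightarrow> 'a \<Rightarrow> 'b::ab_group_add) \<Rightarrow> bool" where
  "cocycle_mod_const K b \<longleftrightarrow> (\<forall>\<gamma>\<in>K. left_invariant (b \<gamma>)) \<and>
    (\<forall>\<gamma>\<in>K. \<forall>\<delta>\<in>K. \<forall>x\<in>carrier G. mult_defect b \<gamma> \<delta> x = mult_defect b \<gamma> \<delta> \<one>\<^bsub>G\<^esub>)"

definition coboundary_mod_const :: "'c set \<Rightarrow> ('c \<Rightarrow> 'a \<Rightarrow> 'b::ab_group_add) \<Rightarrow> bool" where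
  "coboundary_mod_const K b \<longleftrightarrow> (\<exists>m e. left_invariant m \<and>
     (\<forall>\<gamma>\<in>K. \<forall>x\<in>carrier G. b \<gamma> x = m (x \<otimes>\<^bsub>G\<^esub> \<tau> \<gamma>) - m x + e \<gamma>))"

definition crossed_hom :: "'c set \<Rightarrow> ('c \<Rightarrow> 'a \<Rightarrow> 'b::ab_group_add) \<Rightarrow> bool" where
  "crossed_hom K b \<longleftrightarrow> (\<forall>\<gamma>\<in>K. left_invariant (b \<gamma>)) \<and>
    (\<forall>\<gamma>\<in>K. \<forall>\<delta>\<in>K. \<forall>x\<in>carrier G. b (\<gamma> \<otimes>\<^bsub>Q\<^esub> \<delta>) x = b \<gamma> x + b \<delta> (x \<otimes>\<^bsub>G\<^esub> \<tau> \<gamma>))"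

lemma mult_defect_add: "mult_defect (\<lambda>\<gamma> x. b \<gamma> x + c \<gamma> x) \<gamma> \<delta> x = mult_defect b \<gamma> \<delta> x + mult_defect c \<gamma> \<delta> x"
  by (simp add: mult_defect_def algebra_simps)

lemma mult_defect_uminus: "mult_defect (\<lambda>\<gamma> x. - b \<gamma> x) \<gamma> \<delta> x = - mult_defect b \<gamma> \<delta> x"
  by (simp add: mult_defect_def algebra_simps)

lemma mult_defect_diff: "mult_defect (\<lambda>\<gamma> x. b \<gamma> x - c \<gamma> x) \<gamma> \<delta> x = mult_defect b \<gamma> \<delta> x - mult_defect c \<gamma> \<delta> x"
  by (simp add: mult_defect_def algebra_simps)

lemma mult_defect_cocycle:
  assumes "left_invariant (b k)" "g \<in> carrier Q" "h \<in> carrier Q" "k \<in> carrier Q" "x \<in> carrier G"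
  shows "mult_defect b h k (x \<otimes>\<^bsub>G\<^esub> \<tau> g) - mult_defect b (g \<otimes>\<^bsub>Q\<^esub> h) k x
    + mult_defect b g (h \<otimes>\<^bsub>Q\<^esub> k) x - mult_defect b g h x = 0"
  using assms by (simp add: mult_defect_def Q.m_assoc left_invariant_tau_mult)

lemma cocycle_mod_constI:
  "\<lbrakk>\<And>\<gamma>. \<gamma> \<in> K \<Longrightarrow> left_invariant (b \<gamma>);
    \<And>\<gamma> \<delta> x. \<lbrakk>\<gamma> \<in> K; \<delta> \<in> K; x \<in> carrier G\<rbrakk> \<Longrightarrow> mult_defect b \<gamma> \<delta> x = mult_defect b \<gamma> \<delta> \<one>\<^bsub>G\<^esub>\<rbrakk>
   \<Longrightarrow> cocycle_mod_const K b"
  unfolding cocycle_mod_const_def by blast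

lemma cocycle_mod_const_left_invariant: "\<lbrakk>cocycle_mod_const K b; \<gamma> \<in> K\<rbrakk> \<Longrightarrow> left_invariant (b \<gamma>)"
  unfolding cocycle_mod_const_def by blast

lemma mult_defect_const:
  "\<lbrakk>cocycle_mod_const K b; \<gamma> \<in> K; \<delta> \<in> K; x \<in> carrier G\<rbrakk> \<Longrightarrow> mult_defect b \<gamma> \<delta> x = mult_defect b \<gamma> \<delta> \<one>\<^bsub>G\<^esub>"
  unfolding cocycle_mod_const_def by blast

lemma cocycle_mod_const_mult:
  assumes "cocycle_mod_const K b" "\<gamma> \<in> K" "\<delta> \<in> K" "x \<in> carrier G"
  shows "b (\<gamma> \<otimes>\<^bsub>Q\<^esub> \<delta>) x = b \<gamma> x + b \<delta> (x \<otimes>\<^bsub>G\<^esub> \<tau> \<gamma>) - mult_defect b \<gamma> \<delta> \<one>\<^bsub>G\<^esub>"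
  using mult_defect_const[OF assms] unfolding mult_defect_def[of b \<gamma> \<delta> x] by (simp add: algebra_simps)

lemma cocycle_mod_const_subset: "\<lbrakk>cocycle_mod_const K b; L \<subseteq> K\<rbrakk> \<Longrightarrow> cocycle_mod_const L b"
  unfolding cocycle_mod_const_def by blast

lemma cocycle_mod_const_zero: "cocycle_mod_const K (\<lambda>_ _. 0)"
  by (simp add: cocycle_mod_const_def mult_defect_def left_invariant_const)

lemma cocycle_mod_const_add:
  assumes "cocycle_mod_const K b" "cocycle_mod_const K c"
  shows "cocycle_mod_const K (\<lambda>\<gamma> x. b \<gamma> x + c \<gamma> x)"
proof (rule cocycle_mod_constI)
  show "left_invariant (\<lambda>x. b \<gamma> x + c \<gamma> x)" if "\<gamma> \<in> K" for \<gamma>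
    using assms[THEN cocycle_mod_const_left_invariant, OF that] by (simp add: left_invariant_def)
  show "mult_defect (\<lambda>\<gamma> x. b \<gamma> x + c \<gamma> x) \<gamma> \<delta> x = mult_defect (\<lambda>\<gamma> x. b \<gamma> x + c \<gamma> x) \<gamma> \<delta> \<one>\<^bsub>G\<^esub>"
    if "\<gamma> \<in> K" "\<delta> \<in> K" "x \<in> carrier G" for \<gamma> \<delta> x
    using mult_defect_const[OF assms(1) that] mult_defect_const[OF assms(2) that] by (simp only: mult_defect_add)
qed

lemma cocycle_mod_const_uminus:
  assumes "cocycle_mod_const K b"
  shows "cocycle_mod_const K (\<lambda>\<gamma> x. - b \<gamma> x)"
proof (rule cocycle_mod_constI)
  show "left_invariant (\<lambda>x. - b \<gamma> x)" if "\<gamma> \<in> K" for \<gamma>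
    using cocycle_mod_const_left_invariant[OF assms that] by (simp add: left_invariant_def)
  show "mult_defect (\<lambda>\<gamma> x. - b \<gamma> x) \<gamma> \<delta> x = mult_defect (\<lambda>\<gamma> x. - b \<gamma> x) \<gamma> \<delta> \<one>\<^bsub>G\<^esub>"
    if "\<gamma> \<in> K" "\<delta> \<in> K" "x \<in> carrier G" for \<gamma> \<delta> x
    using mult_defect_const[OF assms that] by (simp only: mult_defect_uminus)
qed

lemma cocycle_mod_const_diff:
  "\<lbrakk>cocycle_mod_const K b; cocycle_mod_const K c\<rbrakk> \<Longrightarrow> cocycle_mod_const K (\<lambda>\<gamma> x. b \<gamma> x - c \<gamma> x)"
  using cocycle_mod_const_add[OF _ cocycle_mod_const_uminus, of K b c] by simp

lemma cocycle_mod_const_ntimes: "cocycle_mod_const K b \<Longrightarrow> cocycle_mod_const K (\<lambda>\<gamma> x. n \<cdot> b \<gamma> x)"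
  by (induction n) (auto intro: cocycle_mod_const_add cocycle_mod_const_zero)

lemma cocycle_mod_const_coboundary:
  assumes m: "left_invariant m" and K: "K \<subseteq> carrier Q"
  shows "cocycle_mod_const K (\<lambda>\<gamma> x. m (x \<otimes>\<^bsub>G\<^esub> \<tau> \<gamma>) - m x + e \<gamma>)"
proof (rule cocycle_mod_constI)
  show "left_invariant (\<lambda>x. m (x \<otimes>\<^bsub>G\<^esub> \<tau> \<gamma>) - m x + e \<gamma>)" if "\<gamma> \<in> K" for \<gamma>
    using left_invariant_translate[OF m, of "\<tau> \<gamma>"] m that K by (auto simp: left_invariant_def)
qed (use m K in \<open>auto simp: mult_defect_def left_invariant_tau_mult left_invariant_tau_mult_one
    subset_iff algebra_simps\<close>)

lemma cocycle_mod_const_const: "cocycle_mod_const K (\<lambda>\<gamma> x. e \<gamma>)"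
  by (simp add: cocycle_mod_const_def mult_defect_def left_invariant_const)

lemma cocycle_mod_const_one:
  assumes "cocycle_mod_const K b" "\<one>\<^bsub>Q\<^esub> \<in> K" "x \<in> carrier G"
  shows "b \<one>\<^bsub>Q\<^esub> x = b \<one>\<^bsub>Q\<^esub> \<one>\<^bsub>G\<^esub>"
proof -
  have inv: "left_invariant (b \<one>\<^bsub>Q\<^esub>)" using cocycle_mod_const_left_invariant assms(1,2) by blast
  show ?thesis
    using mult_defect_const[OF assms(1,2,2,3)] left_invariant_tau_one[OF inv assms(3)]
      left_invariant_tau_one[OF inv, of "\<one>\<^bsub>G\<^esub>"]
    by (simp add: mult_defect_def)
qed

lemma coboundary_mod_constI:
  "\<lbrakk>left_invariant m; \<And>\<gamma> x. \<lbrakk>\<gamma> \<in> K; x \<in> carrier G\<rbrakk> \<Longrightarrow> b \<gamma> x = m (x \<otimes>\<^bsub>G\<^esub> \<tau> \<gamma>) - m x + e \<gamma>\<rbrakk>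
   \<Longrightarrow> coboundary_mod_const K b"
  unfolding coboundary_mod_const_def by blast

lemma coboundary_mod_constE:
  assumes "coboundary_mod_const K b"
  obtains m e where "left_invariant m"
    "\<And>\<gamma> x. \<lbrakk>\<gamma> \<in> K; x \<in> carrier G\<rbrakk> \<Longrightarrow> b \<gamma> x = m (x \<otimes>\<^bsub>G\<^esub> \<tau> \<gamma>) - m x + e \<gamma>"
  using assms unfolding coboundary_mod_const_def by blast

lemma coboundary_mod_const_subset: "\<lbrakk>coboundary_mod_const K b; L \<subseteq> K\<rbrakk> \<Longrightarrow> coboundary_mod_const L b"
  unfolding coboundary_mod_const_def by blast

lemma coboundary_mod_const_cong:
  "(\<And>\<gamma> x. \<lbrakk>\<gamma> \<in> K; x \<in> carrier G\<rbrakk> \<Longrightarrow> b \<gamma> x = c \<gamma> x) \<Longrightarrow> coboundary_mod_const K b \<longleftrightarrow> coboundary_mod_const K c"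
  unfolding coboundary_mod_const_def by simp

lemma coboundary_mod_const_if_const:
  assumes "\<And>\<gamma> x. \<lbrakk>\<gamma> \<in> K; x \<in> carrier G\<rbrakk> \<Longrightarrow> b \<gamma> x = e \<gamma>"
  shows "coboundary_mod_const K b"
  by (rule coboundary_mod_constI[OF left_invariant_const[of 0]]) (simp add: assms)

lemma coboundary_mod_const_const: "coboundary_mod_const K (\<lambda>\<gamma> x. e \<gamma>)"
  by (rule coboundary_mod_const_if_const) (rule refl)

lemma coboundary_mod_const_add:
  assumes "coboundary_mod_const K b" "coboundary_mod_const K c"
  shows "coboundary_mod_const K (\<lambda>\<gamma> x. b \<gamma> x + c \<gamma> x)"
proof -
  obtain m e where m: "left_invariant m"
    "\<And>\<gamma> x. \<lbrakk>\<gamma> \<in> K; x \<in> carrier G\<rbrakk> \<Longrightarrow> b \<gamma> x = m (x \<otimes>\<^bsub>G\<^esub> \<tau> \<gamma>) - m x + e \<gamma>"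
    using coboundary_mod_constE[OF assms(1)] by blast
  obtain m' e' where m': "left_invariant m'"
    "\<And>\<gamma> x. \<lbrakk>\<gamma> \<in> K; x \<in> carrier G\<rbrakk> \<Longrightarrow> c \<gamma> x = m' (x \<otimes>\<^bsub>G\<^esub> \<tau> \<gamma>) - m' x + e' \<gamma>"
    using coboundary_mod_constE[OF assms(2)] by blast
  show ?thesis
    by (rule coboundary_mod_constI[OF left_invariant_comp2[OF m(1) m'(1)], of _ _ "(+)" "\<lambda>\<gamma>. e \<gamma> + e' \<gamma>"])
      (simp add: m(2) m'(2) algebra_simps)
qed

lemma coboundary_mod_const_uminus:
  assumes "coboundary_mod_const K b"
  shows "coboundary_mod_const K (\<lambda>\<gamma> x. - b \<gamma> x)"
proof -
  obtain m e where m: "left_invariant m"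
    "\<And>\<gamma> x. \<lbrakk>\<gamma> \<in> K; x \<in> carrier G\<rbrakk> \<Longrightarrow> b \<gamma> x = m (x \<otimes>\<^bsub>G\<^esub> \<tau> \<gamma>) - m x + e \<gamma>"
    using coboundary_mod_constE[OF assms] by blast
  show ?thesis
    by (rule coboundary_mod_constI[OF left_invariant_comp[OF m(1)], of _ _ uminus "\<lambda>\<gamma>. - e \<gamma>"])
      (simp add: m(2))
qed

lemma coboundary_mod_const_diff:
  "\<lbrakk>coboundary_mod_const K b; coboundary_mod_const K c\<rbrakk> \<Longrightarrow> coboundary_mod_const K (\<lambda>\<gamma> x. b \<gamma> x - c \<gamma> x)"
  using coboundary_mod_const_add[OF _ coboundary_mod_const_uminus, of K b c] by simp

lemma coboundary_mod_const_ntimes: "coboundary_mod_const K b \<Longrightarrow> coboundary_mod_const K (\<lambda>\<gamma> x. n \<cdot> b \<gamma> x)"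
  by (induction n) (auto intro: coboundary_mod_const_add coboundary_mod_const_const[of _ "\<lambda>_. 0"])

lemma coboundary_mod_const_diff_const_iff:
  "coboundary_mod_const K (\<lambda>\<gamma> x. b \<gamma> x - e \<gamma>) \<longleftrightarrow> coboundary_mod_const K b"
proof
  assume "coboundary_mod_const K (\<lambda>\<gamma> x. b \<gamma> x - e \<gamma>)"
  from coboundary_mod_const_add[OF this coboundary_mod_const_const[of K e]]
  show "coboundary_mod_const K b" by simp
qed (rule coboundary_mod_const_diff[OF _ coboundary_mod_const_const])

lemma coboundary_mod_const_coprime:
  fixes m n :: nat
  assumes "coprime m n" "0 < m"
    and "coboundary_mod_const K (\<lambda>\<gamma> x. m \<cdot> b \<gamma> x)" "coboundary_mod_const K (\<lambda>\<gamma> x. n \<cdot> b \<gamma> x)"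
  shows "coboundary_mod_const K b"
proof -
  obtain u v where uv: "u * m = v * n + 1" using coprime_bezout_nat assms(1,2) by blast
  have "coboundary_mod_const K (\<lambda>\<gamma> x. u \<cdot> m \<cdot> b \<gamma> x - v \<cdot> n \<cdot> b \<gamma> x)"
    by (rule coboundary_mod_const_diff[OF assms(3,4)[THEN coboundary_mod_const_ntimes]])
  moreover have "u \<cdot> m \<cdot> b \<gamma> x - v \<cdot> n \<cdot> b \<gamma> x = b \<gamma> x" for \<gamma> x
    by (simp add: uv ntimes_add_left flip: ntimes_mult)
  ultimately show ?thesis by simp
qed

lemma cocycle_mod_const_average:
  fixes b :: "'c \<Rightarrow> 'a \<Rightarrow> 'b::ab_group_add"
  assumes D: "subgroup D Q" and K: "subgroup K Q" and DK: "D \<subseteq> K"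
    and b: "cocycle_mod_const K b"
    and const: "\<And>\<gamma> x. \<lbrakk>\<gamma> \<in> D; x \<in> carrier G\<rbrakk> \<Longrightarrow> b \<gamma> x = b \<gamma> \<one>\<^bsub>G\<^esub>"
  obtains \<mu> where "left_invariant \<mu>" "\<mu> \<one>\<^bsub>G\<^esub> = 0"
    "\<forall>n. (\<forall>\<gamma>\<in>K. \<forall>x\<in>carrier G. n \<cdot> b \<gamma> x = 0) \<longrightarrow> (\<forall>x\<in>carrier G. n \<cdot> \<mu> x = 0)"
    "\<forall>\<gamma>\<in>K. \<forall>x\<in>carrier G.
      card (cosets_in Q D K) \<cdot> (b \<gamma> x - b \<gamma> \<one>\<^bsub>G\<^esub>) = \<mu> x - \<mu> (x \<otimes>\<^bsub>G\<^esub> \<tau> \<gamma>) + \<mu> (\<tau> \<gamma>)"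
proof -
  note KQ = subgroup.mem_carrier[OF K]
  define f where "f \<gamma> x = b \<gamma> x - b \<gamma> \<one>\<^bsub>G\<^esub>" for \<gamma> x
  define \<mu> where "\<mu> x = (\<Sum>C\<in>cosets_in Q D K. f (inv\<^bsub>Q\<^esub> coset_rep C) x)" for x
  have rep: "inv\<^bsub>Q\<^esub> coset_rep C \<in> K" if "C \<in> cosets_in Q D K" for C
    using Q.cosets_in_rep(1)[OF D K DK that] subgroup.m_inv_closed[OF K] by blast
  have f_mult: "f (\<gamma> \<otimes>\<^bsub>Q\<^esub> \<delta>) x = f \<gamma> x + f \<delta> (x \<otimes>\<^bsub>G\<^esub> \<tau> \<gamma>) - f \<delta> (\<one>\<^bsub>G\<^esub> \<otimes>\<^bsub>G\<^esub> \<tau> \<gamma>)"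
    if "\<gamma> \<in> K" "\<delta> \<in> K" "x \<in> carrier G" for \<gamma> \<delta> x
    using cocycle_mod_const_mult[OF b that] cocycle_mod_const_mult[OF b that(1,2) G.one_closed]
    by (simp add: f_def)
  have f_zero: "f \<gamma> x = 0" if "\<gamma> \<in> D" "x \<in> carrier G" for \<gamma> x
    using const[OF that] by (simp add: f_def)
  show ?thesis
  proof (rule that[of \<mu>])
    show "left_invariant \<mu>"
      unfolding left_invariant_def \<mu>_def f_def
      using cocycle_mod_const_left_invariant[OF b rep] by (intro ballI sum.cong) (auto simp: left_invariant_def)
    show "\<mu> \<one>\<^bsub>G\<^esub> = 0" by (simp add: \<mu>_def f_def)
    show "\<forall>n. (\<forall>\<gamma>\<in>K. \<forall>x\<in>carrier G. n \<cdot> b \<gamma> x = 0) \<longrightarrow> (\<forall>x\<in>carrier G. n \<cdot> \<mu> x = 0)"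
      unfolding \<mu>_def ntimes_sum f_def using rep by (simp add: ntimes_diff_right)
    have "card (cosets_in Q D K) \<cdot> (b \<gamma> x - b \<gamma> \<one>\<^bsub>G\<^esub>) = \<mu> x - \<mu> (x \<otimes>\<^bsub>G\<^esub> \<tau> \<gamma>) + \<mu> (\<tau> \<gamma>)"
      if "\<gamma> \<in> K" "x \<in> carrier G" for \<gamma> x
    proof -
      have "card (cosets_in Q D K) \<cdot> f \<gamma> x = \<mu> x - \<mu> (x \<otimes>\<^bsub>G\<^esub> \<tau> \<gamma>) + \<mu> (\<one>\<^bsub>G\<^esub> \<otimes>\<^bsub>G\<^esub> \<tau> \<gamma>)"
        unfolding \<mu>_def
        by (rule Q.crossed_hom_average[OF D K DK, where I = "carrier G" and base = "\<one>\<^bsub>G\<^esub>"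
              and move = "\<lambda>\<gamma> x. x \<otimes>\<^bsub>G\<^esub> \<tau> \<gamma>"])
          (use f_mult f_zero KQ that in auto)
      then show ?thesis using KQ that by (simp add: f_def)
    qed
    then show "\<forall>\<gamma>\<in>K. \<forall>x\<in>carrier G.
      card (cosets_in Q D K) \<cdot> (b \<gamma> x - b \<gamma> \<one>\<^bsub>G\<^esub>) = \<mu> x - \<mu> (x \<otimes>\<^bsub>G\<^esub> \<tau> \<gamma>) + \<mu> (\<tau> \<gamma>)" by blast
  qed
qed

lemma coboundary_mod_const_average:
  fixes b :: "'c \<Rightarrow> 'a \<Rightarrow> 'b::ab_group_add"
  assumes D: "subgroup D Q" and K: "subgroup K Q" and DK: "D \<subseteq> K"
    and b: "cocycle_mod_const K b" and triv: "coboundary_mod_const D b"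
  shows "coboundary_mod_const K (\<lambda>\<gamma> x. card (cosets_in Q D K) \<cdot> b \<gamma> x)"
proof -
  let ?n = "card (cosets_in Q D K)"
  obtain m e where m: "left_invariant m"
    and me: "\<And>\<gamma> x. \<lbrakk>\<gamma> \<in> D; x \<in> carrier G\<rbrakk> \<Longrightarrow> b \<gamma> x = m (x \<otimes>\<^bsub>G\<^esub> \<tau> \<gamma>) - m x + e \<gamma>"
    using coboundary_mod_constE[OF triv] by blast
  define d where "d \<gamma> x = m (x \<otimes>\<^bsub>G\<^esub> \<tau> \<gamma>) - m x + 0" for \<gamma> x
  have cocycle: "cocycle_mod_const K (\<lambda>\<gamma> x. b \<gamma> x - d \<gamma> x)"
    unfolding d_def
    using cocycle_mod_const_diff[OF b cocycle_mod_const_coboundary[OF m subgroup.subset[OF K], of "\<lambda>_. 0"]] .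
  have const: "b \<gamma> x - d \<gamma> x = b \<gamma> \<one>\<^bsub>G\<^esub> - d \<gamma> \<one>\<^bsub>G\<^esub>" if "\<gamma> \<in> D" "x \<in> carrier G" for \<gamma> x
    using that by (simp add: d_def me)
  obtain \<mu> where \<mu>: "left_invariant \<mu>"
    "\<forall>\<gamma>\<in>K. \<forall>x\<in>carrier G.
      ?n \<cdot> (b \<gamma> x - d \<gamma> x - (b \<gamma> \<one>\<^bsub>G\<^esub> - d \<gamma> \<one>\<^bsub>G\<^esub>)) = \<mu> x - \<mu> (x \<otimes>\<^bsub>G\<^esub> \<tau> \<gamma>) + \<mu> (\<tau> \<gamma>)"
    using cocycle_mod_const_average[OF D K DK cocycle const] by metis
  have "?n \<cdot> (b \<gamma> x - d \<gamma> x) = - \<mu> (x \<otimes>\<^bsub>G\<^esub> \<tau> \<gamma>) - - \<mu> x + (\<mu> (\<tau> \<gamma>) + ?n \<cdot> (b \<gamma> \<one>\<^bsub>G\<^esub> - d \<gamma> \<one>\<^bsub>G\<^esub>))"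
    if "\<gamma> \<in> K" "x \<in> carrier G" for \<gamma> x
    using bspec[OF bspec[OF \<mu>(2) that(1)] that(2)] by (simp add: ntimes_diff_right ntimes_add_right algebra_simps)
  then have "coboundary_mod_const K (\<lambda>\<gamma> x. ?n \<cdot> (b \<gamma> x - d \<gamma> x))"
    by (rule coboundary_mod_constI[OF left_invariant_comp[OF \<mu>(1), of uminus]])
  moreover have "coboundary_mod_const K (\<lambda>\<gamma> x. ?n \<cdot> d \<gamma> x)"
    unfolding d_def by (rule coboundary_mod_const_ntimes[OF coboundary_mod_constI[OF m refl]])
  ultimately have "coboundary_mod_const K (\<lambda>\<gamma> x. ?n \<cdot> (b \<gamma> x - d \<gamma> x) + ?n \<cdot> d \<gamma> x)"
    by (rule coboundary_mod_const_add)
  then show ?thesis by (simp flip: ntimes_add_right)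
qed

lemma card_cosets_in_trivial:
  assumes "subgroup K Q" shows "card (cosets_in Q {\<one>\<^bsub>Q\<^esub>} K) = card K"
  using Q.card_cosets_in[OF Q.triv_subgroup assms] subgroup.one_closed[OF assms] by simp

lemma coboundary_mod_const_card:
  assumes K: "subgroup K Q" and b: "cocycle_mod_const K b"
  shows "coboundary_mod_const K (\<lambda>\<gamma> x. card K \<cdot> b \<gamma> x)"
proof -
  have one: "\<one>\<^bsub>Q\<^esub> \<in> K" using subgroup.one_closed[OF K] .
  have "b \<gamma> x = b \<gamma> \<one>\<^bsub>G\<^esub>" if "\<gamma> \<in> {\<one>\<^bsub>Q\<^esub>}" "x \<in> carrier G" for \<gamma> x
    using cocycle_mod_const_one[OF b one that(2)] that(1) by simp
  then have "coboundary_mod_const {\<one>\<^bsub>Q\<^esub>} b" by (rule coboundary_mod_const_if_const)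
  then show ?thesis
    using coboundary_mod_const_average[OF Q.triv_subgroup K _ b] one card_cosets_in_trivial[OF K] by simp
qed

lemma torsion_cocycle_trivialE:
  fixes b :: "'c \<Rightarrow> 'a \<Rightarrow> 'b::ab_group_add"
  assumes K: "subgroup K Q" and b: "cocycle_mod_const K b" and n: "coprime n (card K)"
    and torsion: "\<And>\<gamma> x. \<lbrakk>\<gamma> \<in> K; x \<in> carrier G\<rbrakk> \<Longrightarrow> n \<cdot> b \<gamma> x = 0"
  obtains \<nu> where "left_invariant \<nu>" "\<nu> \<one>\<^bsub>G\<^esub> = 0" "\<forall>x\<in>carrier G. n \<cdot> \<nu> x = 0"
    "\<forall>\<gamma>\<in>K. \<forall>x\<in>carrier G. b \<gamma> x - b \<gamma> \<one>\<^bsub>G\<^esub> = \<nu> x - \<nu> (x \<otimes>\<^bsub>G\<^esub> \<tau> \<gamma>) + \<nu> (\<tau> \<gamma>)"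
proof -
  have one: "\<one>\<^bsub>Q\<^esub> \<in> K" using subgroup.one_closed[OF K] .
  then have one_in_K: "{\<one>\<^bsub>Q\<^esub>} \<subseteq> K" by blast
  have const: "b \<gamma> x = b \<gamma> \<one>\<^bsub>G\<^esub>" if "\<gamma> \<in> {\<one>\<^bsub>Q\<^esub>}" "x \<in> carrier G" for \<gamma> x
    using cocycle_mod_const_one[OF b one that(2)] that(1) by simp
  obtain \<mu> where \<mu>: "left_invariant \<mu>" "\<mu> \<one>\<^bsub>G\<^esub> = 0"
    "\<forall>n. (\<forall>\<gamma>\<in>K. \<forall>x\<in>carrier G. n \<cdot> b \<gamma> x = 0) \<longrightarrow> (\<forall>x\<in>carrier G. n \<cdot> \<mu> x = 0)"
    "\<forall>\<gamma>\<in>K. \<forall>x\<in>carrier G. card K \<cdot> (b \<gamma> x - b \<gamma> \<one>\<^bsub>G\<^esub>) = \<mu> x - \<mu> (x \<otimes>\<^bsub>G\<^esub> \<tau> \<gamma>) + \<mu> (\<tau> \<gamma>)"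
    using cocycle_mod_const_average[OF Q.triv_subgroup K one_in_K b const, unfolded card_cosets_in_trivial[OF K]] .
  have "finite K" using finite_subset[OF subgroup.subset[OF K] finite_Q] .
  then have "0 < card K" using Q.finite_subgroup_card_pos[OF K] by blast
  then obtain u where u: "\<And>a::'b. n \<cdot> a = 0 \<Longrightarrow> u \<cdot> card K \<cdot> a = a"
    using ntimes_coprime_left_inverse n by (metis coprime_commute)
  show ?thesis
  proof (rule that[of "\<lambda>x. u \<cdot> \<mu> x"])
    show "left_invariant (\<lambda>x. u \<cdot> \<mu> x)" using \<mu>(1) by (rule left_invariant_comp)
    show "u \<cdot> \<mu> \<one>\<^bsub>G\<^esub> = 0" by (simp add: \<mu>(2))
    show "\<forall>x\<in>carrier G. n \<cdot> u \<cdot> \<mu> x = 0"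
      using \<mu>(3) torsion by (simp add: ntimes_commute[of n])
  next
    show "\<forall>\<gamma>\<in>K. \<forall>x\<in>carrier G. b \<gamma> x - b \<gamma> \<one>\<^bsub>G\<^esub> = u \<cdot> \<mu> x - u \<cdot> \<mu> (x \<otimes>\<^bsub>G\<^esub> \<tau> \<gamma>) + u \<cdot> \<mu> (\<tau> \<gamma>)"
    proof (intro ballI)
      fix \<gamma> x assume \<gamma>x: "\<gamma> \<in> K" "x \<in> carrier G"
      then have "n \<cdot> (b \<gamma> x - b \<gamma> \<one>\<^bsub>G\<^esub>) = 0" by (simp add: ntimes_diff_right torsion)
      then have "b \<gamma> x - b \<gamma> \<one>\<^bsub>G\<^esub> = u \<cdot> card K \<cdot> (b \<gamma> x - b \<gamma> \<one>\<^bsub>G\<^esub>)" by (rule u[symmetric])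
      also have "\<dots> = u \<cdot> (\<mu> x - \<mu> (x \<otimes>\<^bsub>G\<^esub> \<tau> \<gamma>) + \<mu> (\<tau> \<gamma>))" using \<mu>(4) \<gamma>x by simp
      finally show "b \<gamma> x - b \<gamma> \<one>\<^bsub>G\<^esub> = u \<cdot> \<mu> x - u \<cdot> \<mu> (x \<otimes>\<^bsub>G\<^esub> \<tau> \<gamma>) + u \<cdot> \<mu> (\<tau> \<gamma>)"
        by (simp add: ntimes_diff_right ntimes_add_right)
    qed
  qed
qed

lemma torsion_representativeE:
  fixes b :: "'c \<Rightarrow> 'a \<Rightarrow> circle"
  assumes n: "0 < n" and triv: "coboundary_mod_const K (\<lambda>\<gamma> x. n \<cdot> b \<gamma> x)"
  obtains m e where "left_invariant m"
    "\<forall>\<gamma>\<in>K. \<forall>x\<in>carrier G. n \<cdot> (b \<gamma> x - (m (x \<otimes>\<^bsub>G\<^esub> \<tau> \<gamma>) - m x + e \<gamma>)) = 0"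
proof -
  obtain m e where m: "left_invariant m"
    and me: "\<And>\<gamma> x. \<lbrakk>\<gamma> \<in> K; x \<in> carrier G\<rbrakk> \<Longrightarrow> n \<cdot> b \<gamma> x = m (x \<otimes>\<^bsub>G\<^esub> \<tau> \<gamma>) - m x + e \<gamma>"
    using coboundary_mod_constE[OF triv] by blast
  have "\<forall>a::circle. \<exists>b. n \<cdot> b = a" using circle_divisible[OF n] by metis
  then obtain d where d: "\<And>a::circle. n \<cdot> d a = a" by metis
  show ?thesis
    by (rule that[OF left_invariant_comp[OF m, of d], of "\<lambda>\<gamma>. d (e \<gamma>)"])
      (simp add: me d ntimes_diff_right ntimes_add_right)
qed

lemma crossed_hom_left_invariant: "\<lbrakk>crossed_hom K b; \<gamma> \<in> K\<rbrakk> \<Longrightarrow> left_invariant (b \<gamma>)"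
  by (simp add: crossed_hom_def)

lemma crossed_hom_mult:
  "\<lbrakk>crossed_hom K b; \<gamma> \<in> K; \<delta> \<in> K; x \<in> carrier G\<rbrakk> \<Longrightarrow> b (\<gamma> \<otimes>\<^bsub>Q\<^esub> \<delta>) x = b \<gamma> x + b \<delta> (x \<otimes>\<^bsub>G\<^esub> \<tau> \<gamma>)"
  by (simp add: crossed_hom_def)

lemma crossed_hom_subset: "\<lbrakk>crossed_hom K b; L \<subseteq> K\<rbrakk> \<Longrightarrow> crossed_hom L b"
  unfolding crossed_hom_def by blast

lemma crossed_hom_diff:
  "\<lbrakk>crossed_hom K b; crossed_hom K c\<rbrakk> \<Longrightarrow> crossed_hom K (\<lambda>\<gamma> x. b \<gamma> x - c \<gamma> x)"
  by (simp add: crossed_hom_def left_invariant_def)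

lemma crossed_hom_ntimes: "crossed_hom K b \<Longrightarrow> crossed_hom K (\<lambda>\<gamma> x. n \<cdot> b \<gamma> x)"
  by (simp add: crossed_hom_def left_invariant_def ntimes_add_right)

lemma crossed_hom_diff_character:
  "\<lbrakk>crossed_hom K b; Q.character K \<chi>\<rbrakk> \<Longrightarrow> crossed_hom K (\<lambda>\<gamma> x. b \<gamma> x - \<chi> \<gamma>)"
  by (simp add: crossed_hom_def left_invariant_def Q.character_def)

lemma crossed_hom_coboundary:
  assumes "left_invariant m" "K \<subseteq> carrier Q"
  shows "crossed_hom K (\<lambda>\<gamma> x. m (x \<otimes>\<^bsub>G\<^esub> \<tau> \<gamma>) - m x)"
  unfolding crossed_hom_def
proof (intro conjI ballI)
  show "left_invariant (\<lambda>x. m (x \<otimes>\<^bsub>G\<^esub> \<tau> \<gamma>) - m x)" if "\<gamma> \<in> K" for \<gamma>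
    using left_invariant_translate[OF assms(1), of "\<tau> \<gamma>"] assms that by (auto simp: left_invariant_def)
qed (use assms in \<open>auto simp: left_invariant_tau_mult subset_iff\<close>)

lemma character_if_crossed_hom_const:
  assumes b: "crossed_hom K b" and const: "\<And>\<gamma> x. \<lbrakk>\<gamma> \<in> K; x \<in> carrier G\<rbrakk> \<Longrightarrow> b \<gamma> x = e \<gamma>"
    and K: "subgroup K Q"
  shows "Q.character K e"
  unfolding Q.character_def
proof (intro ballI)
  fix \<gamma> \<delta> assume \<gamma>\<delta>: "\<gamma> \<in> K" "\<delta> \<in> K"
  have "b (\<gamma> \<otimes>\<^bsub>Q\<^esub> \<delta>) \<one>\<^bsub>G\<^esub> = b \<gamma> \<one>\<^bsub>G\<^esub> + b \<delta> (\<one>\<^bsub>G\<^esub> \<otimes>\<^bsub>G\<^esub> \<tau> \<gamma>)"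
    by (rule crossed_hom_mult[OF b \<gamma>\<delta> G.one_closed])
  then show "e (\<gamma> \<otimes>\<^bsub>Q\<^esub> \<delta>) = e \<gamma> + e \<delta>"
    using \<gamma>\<delta> subgroup.m_closed[OF K] subgroup.mem_carrier[OF K] by (simp add: const)
qed

lemma cocycle_mod_const_if_crossed_hom:
  assumes "crossed_hom K b"
  shows "cocycle_mod_const K b"
  using assms by (simp add: crossed_hom_def cocycle_mod_const_def mult_defect_def)

end

context coset_cocycles
begin

context
  fixes D and b :: "'c \<Rightarrow> 'a \<Rightarrow> 'b::ab_group_add"
  assumes D: "subgroup D Q" and b: "crossed_hom D b"
    and vanishes: "\<And>\<delta> x. \<lbrakk>\<delta> \<in> D; x \<in> carrier G; H #>\<^bsub>G\<^esub> (x \<otimes>\<^bsub>G\<^esub> \<tau> \<delta>) = H #>\<^bsub>G\<^esub> x\<rbrakk> \<Longrightarrow> b \<delta> x = 0"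
begin

lemma crossed_hom_eq_if_same_rcoset:
  assumes \<gamma>: "\<gamma> \<in> D" and \<delta>: "\<delta> \<in> D" and x: "x \<in> carrier G"
    and eq: "H #>\<^bsub>G\<^esub> (x \<otimes>\<^bsub>G\<^esub> \<tau> \<gamma>) = H #>\<^bsub>G\<^esub> (x \<otimes>\<^bsub>G\<^esub> \<tau> \<delta>)"
  shows "b \<gamma> x = b \<delta> x"
proof -
  define \<kappa> where "\<kappa> = \<gamma> \<otimes>\<^bsub>Q\<^esub> inv\<^bsub>Q\<^esub> \<delta>"
  have \<delta>': "inv\<^bsub>Q\<^esub> \<delta> \<in> D" and \<kappa>: "\<kappa> \<in> D"
    using subgroup.m_inv_closed[OF D \<delta>] subgroup.m_closed[OF D \<gamma>] by (auto simp: \<kappa>_def)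
  note carr = \<gamma>[THEN subgroup.mem_carrier[OF D]] \<delta>[THEN subgroup.mem_carrier[OF D]]
    \<delta>'[THEN subgroup.mem_carrier[OF D]] \<kappa>[THEN subgroup.mem_carrier[OF D]]
  have rcoset: "left_invariant (\<lambda>x. H #>\<^bsub>G\<^esub> x)"
    using G.rcoset_absorb[OF subgroup_H] by (simp add: left_invariant_def)
  have "H #>\<^bsub>G\<^esub> (x \<otimes>\<^bsub>G\<^esub> \<tau> \<kappa>) = H #>\<^bsub>G\<^esub> (x \<otimes>\<^bsub>G\<^esub> \<tau> \<gamma> \<otimes>\<^bsub>G\<^esub> \<tau> (inv\<^bsub>Q\<^esub> \<delta>))"
    unfolding \<kappa>_def by (rule tau_mult[OF carr(1,3) x])
  also have "\<dots> = H #>\<^bsub>G\<^esub> (x \<otimes>\<^bsub>G\<^esub> \<tau> \<delta> \<otimes>\<^bsub>G\<^esub> \<tau> (inv\<^bsub>Q\<^esub> \<delta>))"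
    by (rule G.rcoset_mult_right_cong[OF subgroup_H _ _ _ eq]) (use carr x in auto)
  also have "\<dots> = H #>\<^bsub>G\<^esub> (x \<otimes>\<^bsub>G\<^esub> \<tau> (\<delta> \<otimes>\<^bsub>Q\<^esub> inv\<^bsub>Q\<^esub> \<delta>))" by (rule tau_mult[OF carr(2,3) x, symmetric])
  also have "\<dots> = H #>\<^bsub>G\<^esub> x" using left_invariant_tau_one[OF rcoset x] carr(2) by simp
  finally have fixed: "H #>\<^bsub>G\<^esub> (x \<otimes>\<^bsub>G\<^esub> \<tau> \<kappa>) = H #>\<^bsub>G\<^esub> x" .
  have "b (\<kappa> \<otimes>\<^bsub>Q\<^esub> \<delta>) x = b \<kappa> x + b \<delta> (x \<otimes>\<^bsub>G\<^esub> \<tau> \<kappa>)" by (rule crossed_hom_mult[OF b \<kappa> \<delta> x])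
  moreover have "b \<delta> (x \<otimes>\<^bsub>G\<^esub> \<tau> \<kappa>) = b \<delta> x"
    by (rule left_invariant_rcoset[OF crossed_hom_left_invariant[OF b \<delta>] _ x fixed]) (use carr x in auto)
  moreover have "\<kappa> \<otimes>\<^bsub>Q\<^esub> \<delta> = \<gamma>" using carr by (simp add: \<kappa>_def Q.m_assoc)
  ultimately show ?thesis using vanishes[OF \<kappa> x fixed] by simp
qed

text \<open>
  Choose a base point in every orbit of \<open>D\<close>; a primitive of \<open>b\<close> at \<open>x\<close> is \<open>- b \<delta> x\<close>, where \<open>\<delta>\<close> moves \<open>x\<close>
  to the base point.
\<close>

lemma coboundary_mod_const_if_vanishes_on_stabilisers: "coboundary_mod_const D b"
proof -
  define orbit where "orbit x = (\<lambda>\<delta>. H #>\<^bsub>G\<^esub> (x \<otimes>\<^bsub>G\<^esub> \<tau> \<delta>)) ` D" for x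
  define base where "base x = (SOME C. C \<in> orbit x)" for x
  define path where "path x = (SOME \<delta>. \<delta> \<in> D \<and> H #>\<^bsub>G\<^esub> (x \<otimes>\<^bsub>G\<^esub> \<tau> \<delta>) = base x)" for x
  note carr = subgroup.mem_carrier[OF D]
  have path: "path x \<in> D \<and> H #>\<^bsub>G\<^esub> (x \<otimes>\<^bsub>G\<^esub> \<tau> (path x)) = base x" for x
  proof -
    have "base x \<in> orbit x" unfolding base_def using subgroup.one_closed[OF D] by (auto simp: orbit_def intro: someI)
    then have "\<exists>\<delta>. \<delta> \<in> D \<and> H #>\<^bsub>G\<^esub> (x \<otimes>\<^bsub>G\<^esub> \<tau> \<delta>) = base x" by (auto simp: orbit_def)
    then show ?thesis unfolding path_def by (rule someI_ex)
  qed
  have base: "base (x \<otimes>\<^bsub>G\<^esub> \<tau> \<gamma>) = base x" if \<gamma>: "\<gamma> \<in> D" and x: "x \<in> carrier G" for \<gamma> x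
  proof -
    have "orbit (x \<otimes>\<^bsub>G\<^esub> \<tau> \<gamma>) = (\<lambda>\<delta>. H #>\<^bsub>G\<^esub> (x \<otimes>\<^bsub>G\<^esub> \<tau> \<delta>)) ` (\<lambda>\<delta>. \<gamma> \<otimes>\<^bsub>Q\<^esub> \<delta>) ` D"
      unfolding orbit_def image_image by (rule image_cong[OF refl]) (use tau_mult[OF carr carr x] \<gamma> in auto)
    also have "\<dots> = orbit x"
      using Q.bij_betw_subgroup_translate[OF D \<gamma>] by (simp add: orbit_def bij_betw_def)
    finally show ?thesis by (simp add: base_def)
  qed
  have path_H: "path (h \<otimes>\<^bsub>G\<^esub> x) = path x" if "h \<in> H" "x \<in> carrier G" for h x
  proof -
    have "H #>\<^bsub>G\<^esub> (h \<otimes>\<^bsub>G\<^esub> x \<otimes>\<^bsub>G\<^esub> \<tau> \<delta>) = H #>\<^bsub>G\<^esub> (x \<otimes>\<^bsub>G\<^esub> \<tau> \<delta>)" if "\<delta> \<in> D" for \<delta>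
      using \<open>h \<in> H\<close> \<open>x \<in> carrier G\<close> carr[OF that] G.rcoset_absorb[OF subgroup_H] H_carrier by (simp add: G.m_assoc)
    then show ?thesis by (simp add: path_def base_def orbit_def cong: conj_cong image_cong)
  qed
  show ?thesis
  proof (rule coboundary_mod_constI[of "\<lambda>x. - b (path x) x" _ _ "\<lambda>_. 0"])
    have "left_invariant (b (path x))" for x using path crossed_hom_left_invariant[OF b] by blast
    then show "left_invariant (\<lambda>x. - b (path x) x)" by (simp add: left_invariant_def path_H)
    fix \<gamma> x assume \<gamma>: "\<gamma> \<in> D" and x: "x \<in> carrier G"
    let ?\<delta> = "path (x \<otimes>\<^bsub>G\<^esub> \<tau> \<gamma>)"
    have \<delta>: "?\<delta> \<in> D" using path by blast
    have "H #>\<^bsub>G\<^esub> (x \<otimes>\<^bsub>G\<^esub> \<tau> (\<gamma> \<otimes>\<^bsub>Q\<^esub> ?\<delta>)) = H #>\<^bsub>G\<^esub> (x \<otimes>\<^bsub>G\<^esub> \<tau> (path x))"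
      using tau_mult[OF carr[OF \<gamma>] carr[OF \<delta>] x] path[of x] path[of "x \<otimes>\<^bsub>G\<^esub> \<tau> \<gamma>"] base[OF \<gamma> x] by simp
    then have "b (path x) x = b (\<gamma> \<otimes>\<^bsub>Q\<^esub> ?\<delta>) x"
      using crossed_hom_eq_if_same_rcoset[OF subgroup.m_closed[OF D \<gamma> \<delta>] _ x] path by metis
    also have "\<dots> = b \<gamma> x + b ?\<delta> (x \<otimes>\<^bsub>G\<^esub> \<tau> \<gamma>)" by (rule crossed_hom_mult[OF b \<gamma> \<delta> x])
    finally show "b \<gamma> x = - b ?\<delta> (x \<otimes>\<^bsub>G\<^esub> \<tau> \<gamma>) - - b (path x) x + 0" by simp
  qed
qed

end

end

section \<open>The connecting homomorphism\<close>

locale coset_cohomology = coset_cocycles G H Q \<tau>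
  for G :: "('a, 'x) monoid_scheme" (structure) and H
    and Q :: "('c, 'y) monoid_scheme" (structure) and \<tau> +
  fixes act :: "'c \<Rightarrow> ('a \<Rightarrow> int) set \<Rightarrow> ('a \<Rightarrow> int) set"
  assumes act_eq: "\<lbrakk>\<gamma> \<in> carrier Q; m \<in> carrier (J G H)\<rbrakk> \<Longrightarrow> act \<gamma> m = J_act G (\<tau> \<gamma>) m"
begin

lemma act_J_class:
  "\<lbrakk>\<gamma> \<in> carrier Q; integral_mod_const f\<rbrakk> \<Longrightarrow> act \<gamma> (J_class f) = J_class (\<lambda>x. f (x \<otimes>\<^bsub>G\<^esub> \<tau> \<gamma>))"
  by (simp add: act_eq J_act_J_class)

lemma module_action_J: "module_action Q (J G H) act"
proof -
  interpret J: comm_group "J G H" by (rule comm_group_J)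
  show ?thesis
  proof unfold_locales
    fix \<gamma> assume \<gamma>: "\<gamma> \<in> carrier Q"
    have translate: "integral_mod_const (\<lambda>x. f (x \<otimes>\<^bsub>G\<^esub> \<tau> \<gamma>))" if "integral_mod_const f" for f
      using integral_mod_const_translate[OF that tau_closed[OF \<gamma>]] .
    show "act \<gamma> \<in> hom (J G H) (J G H)"
      by (rule homI) (auto elim!: J_cases simp: \<gamma> act_J_class J_class_mult translate integral_mod_const_add)
    fix \<delta> m assume \<delta>: "\<delta> \<in> carrier Q" and "m \<in> carrier (J G H)"
    then obtain f where f: "integral_mod_const f" "m = J_class f" using J_cases by blast
    then have "left_invariant f" by (simp add: integral_mod_const_def)
    then have "J_class (\<lambda>x. f (x \<otimes>\<^bsub>G\<^esub> \<tau> (\<gamma> \<otimes>\<^bsub>Q\<^esub> \<delta>))) = J_class (\<lambda>x. f (x \<otimes>\<^bsub>G\<^esub> \<tau> \<gamma> \<otimes>\<^bsub>G\<^esub> \<tau> \<delta>))"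
      using \<gamma> \<delta> by (intro J_class_cong[where c = 0]) (simp add: left_invariant_tau_mult)
    then show "act (\<gamma> \<otimes>\<^bsub>Q\<^esub> \<delta>) m = act \<gamma> (act \<delta> m)"
      using \<gamma> \<delta> f integral_mod_const_translate[OF f(1) tau_closed[OF \<delta>]] by (simp add: act_J_class)
  qed
qed

sublocale M: module_action Q "J G H" act
  by (rule module_action_J)

lemmas J_class_arith = J_class_mult J_class_inv
  integral_mod_const_add integral_mod_const_diff integral_mod_const_uminus

definition integral_cochain :: "('c \<Rightarrow> 'a \<Rightarrow> real) \<Rightarrow> bool" where
  "integral_cochain B \<longleftrightarrow> (\<forall>\<gamma>\<in>carrier Q. left_invariant (B \<gamma>)) \<and>
     (\<forall>\<gamma>\<in>carrier Q. \<forall>\<delta>\<in>carrier Q. integral_mod_const (mult_defect B \<gamma> \<delta>))"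

definition connecting_cocycle :: "('c \<Rightarrow> 'a \<Rightarrow> real) \<Rightarrow> 'c \<times> 'c \<Rightarrow> ('a \<Rightarrow> int) set" where
  "connecting_cocycle B = (\<lambda>(\<gamma>, \<delta>)\<in>carrier Q \<times> carrier Q. J_class (mult_defect B \<gamma> \<delta>))"

lemma integral_cochain_left_invariant: "\<lbrakk>integral_cochain B; \<gamma> \<in> carrier Q\<rbrakk> \<Longrightarrow> left_invariant (B \<gamma>)"
  by (simp add: integral_cochain_def)

lemma integral_cochain_mult_defect:
  "\<lbrakk>integral_cochain B; \<gamma> \<in> carrier Q; \<delta> \<in> carrier Q\<rbrakk> \<Longrightarrow> integral_mod_const (mult_defect B \<gamma> \<delta>)"
  by (simp add: integral_cochain_def)

lemma connecting_cocycle_in_cocycles2: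
  assumes B: "integral_cochain B"
  shows "connecting_cocycle B \<in> carrier (cocycles2 Q (J G H) act)"
  unfolding M.cocycles2_iff
proof (intro conjI ballI)
  note defect = integral_cochain_mult_defect[OF B]
  show "connecting_cocycle B \<in> carrier Q \<times> carrier Q \<rightarrow>\<^sub>E carrier (J G H)"
    using defect by (auto simp: connecting_cocycle_def)
  fix g h k assume g: "g \<in> carrier Q" "h \<in> carrier Q" "k \<in> carrier Q"
  have "act g (connecting_cocycle B (h, k)) \<otimes>\<^bsub>J G H\<^esub> inv\<^bsub>J G H\<^esub> connecting_cocycle B (g \<otimes>\<^bsub>Q\<^esub> h, k)
        \<otimes>\<^bsub>J G H\<^esub> connecting_cocycle B (g, h \<otimes>\<^bsub>Q\<^esub> k) \<otimes>\<^bsub>J G H\<^esub> inv\<^bsub>J G H\<^esub> connecting_cocycle B (g, h)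
     = J_class (\<lambda>x. mult_defect B h k (x \<otimes>\<^bsub>G\<^esub> \<tau> g) - mult_defect B (g \<otimes>\<^bsub>Q\<^esub> h) k x
        + mult_defect B g (h \<otimes>\<^bsub>Q\<^esub> k) x - mult_defect B g h x)"
    using g integral_mod_const_translate[OF defect[OF g(2,3)] tau_closed[OF g(1)]]
    by (simp add: connecting_cocycle_def act_J_class defect J_class_arith)
  also have "\<dots> = J_class (\<lambda>_. 0)"
    using mult_defect_cocycle[of B k, OF integral_cochain_left_invariant[OF B g(3)] g]
    by (intro J_class_cong[where c = 0]) simp
  finally show "act g (connecting_cocycle B (h, k)) \<otimes>\<^bsub>J G H\<^esub> inv\<^bsub>J G H\<^esub> connecting_cocycle B (g \<otimes>\<^bsub>Q\<^esub> h, k)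
        \<otimes>\<^bsub>J G H\<^esub> connecting_cocycle B (g, h \<otimes>\<^bsub>Q\<^esub> k) \<otimes>\<^bsub>J G H\<^esub> inv\<^bsub>J G H\<^esub> connecting_cocycle B (g, h) = \<one>\<^bsub>J G H\<^esub>"
    by (simp add: J_class_zero)
qed

lemma integral_cochain_add:
  assumes B: "integral_cochain B" and C: "integral_cochain C"
  shows "integral_cochain (\<lambda>\<gamma> x. B \<gamma> x + C \<gamma> x)"
    and "connecting_cocycle (\<lambda>\<gamma> x. B \<gamma> x + C \<gamma> x)
      = connecting_cocycle B \<otimes>\<^bsub>cocycles2 Q (J G H) act\<^esub> connecting_cocycle C"
proof -
  have defect: "mult_defect (\<lambda>\<gamma> x. B \<gamma> x + C \<gamma> x) \<gamma> \<delta> = (\<lambda>x. mult_defect B \<gamma> \<delta> x + mult_defect C \<gamma> \<delta> x)" for \<gamma> \<delta>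
    by (rule ext) (rule mult_defect_add)
  show "integral_cochain (\<lambda>\<gamma> x. B \<gamma> x + C \<gamma> x)"
    using assms by (simp add: integral_cochain_def defect integral_mod_const_add left_invariant_def)
  show "connecting_cocycle (\<lambda>\<gamma> x. B \<gamma> x + C \<gamma> x)
      = connecting_cocycle B \<otimes>\<^bsub>cocycles2 Q (J G H) act\<^esub> connecting_cocycle C"
    using integral_cochain_mult_defect[OF B] integral_cochain_mult_defect[OF C]
    by (auto simp: connecting_cocycle_def cocycles2_def cochains2_def defect J_class_mult fun_eq_iff restrict_def)
qed

lemma integral_cochain_diff:
  assumes "integral_cochain B" "integral_cochain C"
  shows "integral_cochain (\<lambda>\<gamma> x. B \<gamma> x - C \<gamma> x)"
proof -
  have "mult_defect (\<lambda>\<gamma> x. B \<gamma> x - C \<gamma> x) \<gamma> \<delta> = (\<lambda>x. mult_defect B \<gamma> \<delta> x - mult_defect C \<gamma> \<delta> x)" for \<gamma> \<delta>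
    by (rule ext) (rule mult_defect_diff)
  then show ?thesis
    using assms by (simp add: integral_cochain_def integral_mod_const_diff left_invariant_def)
qed

lemma diff1_J_class:
  assumes D: "subgroup D Q" and N: "\<And>\<gamma>. \<gamma> \<in> D \<Longrightarrow> integral_mod_const (N \<gamma>)"
    and \<beta>: "\<And>\<gamma>. \<gamma> \<in> D \<Longrightarrow> \<beta> \<gamma> = J_class (N \<gamma>)" and \<gamma>\<delta>: "\<gamma> \<in> D" "\<delta> \<in> D"
  shows "diff1 (Q\<lparr>carrier := D\<rparr>) (J G H) act \<beta> (\<gamma>, \<delta>) = J_class (mult_defect N \<gamma> \<delta>)"
proof -
  note carr = subgroup.mem_carrier[OF D] and mult = subgroup.m_closed[OF D \<gamma>\<delta>]
  have "diff1 (Q\<lparr>carrier := D\<rparr>) (J G H) act \<beta> (\<gamma>, \<delta>)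
      = J_class (\<lambda>x. N \<delta> (x \<otimes>\<^bsub>G\<^esub> \<tau> \<gamma>) - N (\<gamma> \<otimes>\<^bsub>Q\<^esub> \<delta>) x + N \<gamma> x)"
    using \<gamma>\<delta> mult carr integral_mod_const_translate[OF N[OF \<gamma>\<delta>(2)] tau_closed[OF carr[OF \<gamma>\<delta>(1)]]]
    by (simp add: diff1_def \<beta> N act_J_class J_class_arith)
  also have "\<dots> = J_class (mult_defect N \<gamma> \<delta>)"
    by (rule J_class_cong[where c = 0]) (simp add: mult_defect_def)
  finally show ?thesis .
qed

lemma restrict_connecting_cocycle_in_coboundaries2:
  assumes B: "integral_cochain B" and D: "subgroup D Q"
    and triv: "coboundary_mod_const D (\<lambda>\<gamma> x. circ (B \<gamma> x))"
  shows "restrict (connecting_cocycle B) (D \<times> D) \<in> coboundaries2 (Q\<lparr>carrier := D\<rparr>) (J G H) act"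
proof -
  note carr = subgroup.mem_carrier[OF D]
  obtain m e where m: "left_invariant m"
    and me: "\<And>\<gamma> x. \<lbrakk>\<gamma> \<in> D; x \<in> carrier G\<rbrakk> \<Longrightarrow> circ (B \<gamma> x) = m (x \<otimes>\<^bsub>G\<^esub> \<tau> \<gamma>) - m x + e \<gamma>"
    using coboundary_mod_constE[OF triv] by blast
  define P where "P \<gamma> x = rep_circle (m (x \<otimes>\<^bsub>G\<^esub> \<tau> \<gamma>)) - rep_circle (m x) + rep_circle (e \<gamma>)" for \<gamma> x
  define N where "N \<gamma> x = B \<gamma> x - P \<gamma> x" for \<gamma> x
  have P: "cocycle_mod_const D P"
    unfolding P_def by (rule cocycle_mod_const_coboundary[OF left_invariant_comp[OF m] subgroup.subset[OF D]])
  have N: "integral_mod_const (N \<gamma>)" if \<gamma>: "\<gamma> \<in> D" for \<gamma>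
    unfolding integral_mod_const_def
  proof (intro conjI ballI)
    show "left_invariant (N \<gamma>)"
      using integral_cochain_left_invariant[OF B carr[OF \<gamma>]] cocycle_mod_const_left_invariant[OF P \<gamma>]
      by (simp add: N_def left_invariant_def)
    fix x assume "x \<in> carrier G"
    then have "circ (N \<gamma> x) = circ (N \<gamma> \<one>\<^bsub>G\<^esub>)"
      using \<gamma> carr[OF \<gamma>] me[OF \<gamma>] by (simp add: N_def P_def circ_diff circ_add)
    then show "N \<gamma> x - N \<gamma> \<one>\<^bsub>G\<^esub> \<in> \<int>" by (simp add: circ_eq_iff)
  qed
  define \<beta> where "\<beta> = (\<lambda>\<gamma>\<in>D. J_class (N \<gamma>))"
  have "connecting_cocycle B (\<gamma>, \<delta>) = diff1 (Q\<lparr>carrier := D\<rparr>) (J G H) act \<beta> (\<gamma>, \<delta>)"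
    if "\<gamma> \<in> D" "\<delta> \<in> D" for \<gamma> \<delta>
  proof -
    have "J_class (mult_defect B \<gamma> \<delta>) = J_class (mult_defect N \<gamma> \<delta>)"
    proof (rule J_class_cong[where c = "mult_defect P \<gamma> \<delta> \<one>\<^bsub>G\<^esub>"])
      fix x assume "x \<in> carrier G"
      from mult_defect_const[OF P that this]
      show "mult_defect B \<gamma> \<delta> x = mult_defect N \<gamma> \<delta> x + mult_defect P \<gamma> \<delta> \<one>\<^bsub>G\<^esub>"
        unfolding N_def mult_defect_diff by simp
    qed
    then show ?thesis
      using that carr diff1_J_class[where \<beta> = \<beta> and N = N, OF D N _ that] by (simp add: connecting_cocycle_def \<beta>_def)
  qed
  then have "restrict (connecting_cocycle B) (D \<times> D) = diff1 (Q\<lparr>carrier := D\<rparr>) (J G H) act \<beta>"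
    by (auto simp: diff1_def fun_eq_iff restrict_def)
  moreover have "\<beta> \<in> carrier (cochains1 (Q\<lparr>carrier := D\<rparr>) (J G H))"
    using N by (auto simp: \<beta>_def cochains1_def)
  ultimately show ?thesis unfolding coboundaries2_def by blast
qed

lemma real_cocycle_mod_const_coboundary:
  fixes R :: "'c \<Rightarrow> 'a \<Rightarrow> real"
  assumes K: "subgroup K Q" and R: "cocycle_mod_const K R"
  shows "coboundary_mod_const K R"
proof -
  have "finite K" using finite_subset[OF subgroup.subset[OF K] finite_Q] .
  then have n: "0 < real (card K)" using Q.finite_subgroup_card_pos[OF K] by simp
  obtain m e where m: "left_invariant m"
    and me: "\<And>\<gamma> x. \<lbrakk>\<gamma> \<in> K; x \<in> carrier G\<rbrakk> \<Longrightarrow> card K \<cdot> R \<gamma> x = m (x \<otimes>\<^bsub>G\<^esub> \<tau> \<gamma>) - m x + e \<gamma>"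
    using coboundary_mod_constE[OF coboundary_mod_const_card[OF K R]] by blast
  have "R \<gamma> x = m (x \<otimes>\<^bsub>G\<^esub> \<tau> \<gamma>) / card K - m x / card K + e \<gamma> / card K" if "\<gamma> \<in> K" "x \<in> carrier G" for \<gamma> x
    using me[OF that] n by (simp add: ntimes_real field_simps)
  then show ?thesis by (rule coboundary_mod_constI[OF left_invariant_comp[OF m, of "\<lambda>a. a / card K"]])
qed

lemma circ_coboundary_mod_const_if_in_coboundaries2:
  assumes B: "integral_cochain B" and D: "subgroup D Q"
    and c: "restrict (connecting_cocycle B) (D \<times> D) \<in> coboundaries2 (Q\<lparr>carrier := D\<rparr>) (J G H) act"
  shows "coboundary_mod_const D (\<lambda>\<gamma> x. circ (B \<gamma> x))"
proof -
  note carr = subgroup.mem_carrier[OF D]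
  obtain \<beta> where \<beta>: "\<beta> \<in> D \<rightarrow>\<^sub>E carrier (J G H)"
    and eq: "restrict (connecting_cocycle B) (D \<times> D) = diff1 (Q\<lparr>carrier := D\<rparr>) (J G H) act \<beta>"
    using c by (auto simp: coboundaries2_def cochains1_def)
  have "\<exists>f. integral_mod_const f \<and> \<beta> \<gamma> = J_class f" if "\<gamma> \<in> D" for \<gamma>
    using J_cases[OF PiE_mem[OF \<beta> that]] by blast
  then obtain N where N: "\<And>\<gamma>. \<gamma> \<in> D \<Longrightarrow> integral_mod_const (N \<gamma>)" "\<And>\<gamma>. \<gamma> \<in> D \<Longrightarrow> \<beta> \<gamma> = J_class (N \<gamma>)"
    by metis
  define R where "R \<gamma> x = B \<gamma> x - N \<gamma> x" for \<gamma> x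
  have R: "cocycle_mod_const D R"
  proof (rule cocycle_mod_constI)
    show "left_invariant (R \<gamma>)" if "\<gamma> \<in> D" for \<gamma>
      using integral_cochain_left_invariant[OF B carr[OF that]] N(1)[OF that]
      by (simp add: R_def integral_mod_const_def left_invariant_def)
    fix \<gamma> \<delta> x assume \<gamma>\<delta>: "\<gamma> \<in> D" "\<delta> \<in> D" and x: "x \<in> carrier G"
    have "J_class (mult_defect B \<gamma> \<delta>) = diff1 (Q\<lparr>carrier := D\<rparr>) (J G H) act \<beta> (\<gamma>, \<delta>)"
      using \<gamma>\<delta> carr by (simp flip: eq add: connecting_cocycle_def)
    also have "\<dots> = J_class (mult_defect N \<gamma> \<delta>)" by (rule diff1_J_class[OF D N \<gamma>\<delta>])
    finally have "\<exists>k. \<forall>y\<in>carrier G. mult_defect B \<gamma> \<delta> y = mult_defect N \<gamma> \<delta> y + k"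
      using J_class_eq_iff[OF integral_cochain_mult_defect[OF B carr[OF \<gamma>\<delta>(1)] carr[OF \<gamma>\<delta>(2)]]] by simp
    then obtain k where k: "\<forall>y\<in>carrier G. mult_defect B \<gamma> \<delta> y = mult_defect N \<gamma> \<delta> y + k" ..
    show "mult_defect R \<gamma> \<delta> x = mult_defect R \<gamma> \<delta> \<one>\<^bsub>G\<^esub>"
      unfolding R_def mult_defect_diff using bspec[OF k x] bspec[OF k G.one_closed] by simp
  qed
  obtain m e where m: "left_invariant m"
    and me: "\<And>\<gamma> x. \<lbrakk>\<gamma> \<in> D; x \<in> carrier G\<rbrakk> \<Longrightarrow> R \<gamma> x = m (x \<otimes>\<^bsub>G\<^esub> \<tau> \<gamma>) - m x + e \<gamma>"
    using coboundary_mod_constE[OF real_cocycle_mod_const_coboundary[OF D R]] by blast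
  have "circ (B \<gamma> x) = circ (m (x \<otimes>\<^bsub>G\<^esub> \<tau> \<gamma>)) - circ (m x) + circ (e \<gamma> + N \<gamma> \<one>\<^bsub>G\<^esub>)"
    if "\<gamma> \<in> D" "x \<in> carrier G" for \<gamma> x
  proof -
    have "B \<gamma> x = m (x \<otimes>\<^bsub>G\<^esub> \<tau> \<gamma>) - m x + e \<gamma> + N \<gamma> x" using me[OF that] by (simp add: R_def)
    moreover have "circ (N \<gamma> x) = circ (N \<gamma> \<one>\<^bsub>G\<^esub>)"
      using N(1)[OF that(1)] that(2) by (simp add: circ_eq_iff integral_mod_const_def)
    ultimately show ?thesis by (simp add: circ_add circ_diff)
  qed
  then show ?thesis by (rule coboundary_mod_constI[OF left_invariant_comp[OF m]])
qed

lemma left_invariant_mult_defect: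
  assumes "\<And>\<gamma>. \<gamma> \<in> carrier Q \<Longrightarrow> left_invariant (B \<gamma>)" "\<gamma> \<in> carrier Q" "\<delta> \<in> carrier Q"
  shows "left_invariant (mult_defect B \<gamma> \<delta>)"
  using assms left_invariant_translate[OF assms(1)[OF assms(3)] tau_closed[OF assms(2)]]
  by (simp add: mult_defect_def left_invariant_def)

lemma mult_defect_averaged_cochain:
  fixes \<phi> :: "'c \<Rightarrow> 'c \<Rightarrow> 'a \<Rightarrow> real"
  assumes \<gamma>\<delta>: "\<gamma> \<in> carrier Q" "\<delta> \<in> carrier Q"
    and cocycle: "\<And>\<kappa>. \<kappa> \<in> carrier Q \<Longrightarrow> \<exists>k. \<forall>x\<in>carrier G.
      \<phi> \<delta> \<kappa> (x \<otimes>\<^bsub>G\<^esub> \<tau> \<gamma>) - \<phi> (\<gamma> \<otimes>\<^bsub>Q\<^esub> \<delta>) \<kappa> x + \<phi> \<gamma> (\<delta> \<otimes>\<^bsub>Q\<^esub> \<kappa>) x - \<phi> \<gamma> \<delta> x = k"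
  shows "\<exists>k. \<forall>x\<in>carrier G.
    mult_defect (\<lambda>\<gamma> x. (\<Sum>\<kappa>\<in>carrier Q. \<phi> \<gamma> \<kappa> x) / card (carrier Q)) \<gamma> \<delta> x = \<phi> \<gamma> \<delta> x + k"
proof -
  define n where "n = real (card (carrier Q))"
  have n: "n > 0" using Q.finite_subgroup_card_pos[OF Q.subgroup_self finite_Q] by (simp add: n_def)
  obtain k where k: "\<forall>\<kappa>\<in>carrier Q. \<forall>x\<in>carrier G.
      \<phi> \<delta> \<kappa> (x \<otimes>\<^bsub>G\<^esub> \<tau> \<gamma>) - \<phi> (\<gamma> \<otimes>\<^bsub>Q\<^esub> \<delta>) \<kappa> x + \<phi> \<gamma> (\<delta> \<otimes>\<^bsub>Q\<^esub> \<kappa>) x - \<phi> \<gamma> \<delta> x = k \<kappa>"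
    using bchoice[of "carrier Q"] cocycle by metis
  have "mult_defect (\<lambda>\<gamma> x. (\<Sum>\<kappa>\<in>carrier Q. \<phi> \<gamma> \<kappa> x) / n) \<gamma> \<delta> x = \<phi> \<gamma> \<delta> x + (\<Sum>\<kappa>\<in>carrier Q. k \<kappa>) / n"
    if x: "x \<in> carrier G" for x
  proof -
    have "(\<Sum>\<kappa>\<in>carrier Q. k \<kappa>) = (\<Sum>\<kappa>\<in>carrier Q. \<phi> \<delta> \<kappa> (x \<otimes>\<^bsub>G\<^esub> \<tau> \<gamma>) - \<phi> (\<gamma> \<otimes>\<^bsub>Q\<^esub> \<delta>) \<kappa> x
        + \<phi> \<gamma> (\<delta> \<otimes>\<^bsub>Q\<^esub> \<kappa>) x - \<phi> \<gamma> \<delta> x)"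
      using k x by (intro sum.cong) auto
    also have "\<dots> = (\<Sum>\<kappa>\<in>carrier Q. \<phi> \<delta> \<kappa> (x \<otimes>\<^bsub>G\<^esub> \<tau> \<gamma>)) - (\<Sum>\<kappa>\<in>carrier Q. \<phi> (\<gamma> \<otimes>\<^bsub>Q\<^esub> \<delta>) \<kappa> x)
        + (\<Sum>\<kappa>\<in>carrier Q. \<phi> \<gamma> (\<delta> \<otimes>\<^bsub>Q\<^esub> \<kappa>) x) - n * \<phi> \<gamma> \<delta> x"
      by (simp add: sum.distrib sum_subtractf n_def)
    also have "(\<Sum>\<kappa>\<in>carrier Q. \<phi> \<gamma> (\<delta> \<otimes>\<^bsub>Q\<^esub> \<kappa>) x) = (\<Sum>\<kappa>\<in>carrier Q. \<phi> \<gamma> \<kappa> x)"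
      by (rule sum.reindex_bij_betw[OF Q.bij_betw_subgroup_translate[OF Q.subgroup_self \<gamma>\<delta>(2)]])
    finally have sum_k: "(\<Sum>\<kappa>\<in>carrier Q. k \<kappa>) = (\<Sum>\<kappa>\<in>carrier Q. \<phi> \<delta> \<kappa> (x \<otimes>\<^bsub>G\<^esub> \<tau> \<gamma>))
        - (\<Sum>\<kappa>\<in>carrier Q. \<phi> (\<gamma> \<otimes>\<^bsub>Q\<^esub> \<delta>) \<kappa> x) + (\<Sum>\<kappa>\<in>carrier Q. \<phi> \<gamma> \<kappa> x) - n * \<phi> \<gamma> \<delta> x" .
    show ?thesis
      unfolding mult_defect_def sum_k using n by (simp add: add_divide_distrib diff_divide_distrib)
  qed
  then show ?thesis unfolding n_def by blast
qed

lemma cocycles2_real_representativesE: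
  assumes c: "c \<in> carrier (cocycles2 Q (J G H) act)"
  obtains \<phi> where "\<forall>\<gamma>\<in>carrier Q. \<forall>\<delta>\<in>carrier Q. integral_mod_const (\<phi> \<gamma> \<delta>) \<and> c (\<gamma>, \<delta>) = J_class (\<phi> \<gamma> \<delta>)"
    "\<forall>\<gamma>\<in>carrier Q. \<forall>\<delta>\<in>carrier Q. \<forall>\<kappa>\<in>carrier Q. \<exists>k. \<forall>x\<in>carrier G.
      \<phi> \<delta> \<kappa> (x \<otimes>\<^bsub>G\<^esub> \<tau> \<gamma>) - \<phi> (\<gamma> \<otimes>\<^bsub>Q\<^esub> \<delta>) \<kappa> x + \<phi> \<gamma> (\<delta> \<otimes>\<^bsub>Q\<^esub> \<kappa>) x - \<phi> \<gamma> \<delta> x = k"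
proof -
  have "c \<in> carrier Q \<times> carrier Q \<rightarrow>\<^sub>E carrier (J G H)" using c by (simp add: M.cocycles2_iff)
  then have "\<exists>f. integral_mod_const f \<and> c (\<gamma>, \<delta>) = J_class f" if "\<gamma> \<in> carrier Q" "\<delta> \<in> carrier Q" for \<gamma> \<delta>
    using J_cases[of "c (\<gamma>, \<delta>)"] that by (metis PiE_mem mem_Sigma_iff)
  then obtain \<phi> where \<phi>: "\<And>\<gamma> \<delta>. \<lbrakk>\<gamma> \<in> carrier Q; \<delta> \<in> carrier Q\<rbrakk> \<Longrightarrow> integral_mod_const (\<phi> \<gamma> \<delta>)"
    "\<And>\<gamma> \<delta>. \<lbrakk>\<gamma> \<in> carrier Q; \<delta> \<in> carrier Q\<rbrakk> \<Longrightarrow> c (\<gamma>, \<delta>) = J_class (\<phi> \<gamma> \<delta>)" by metis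
  have \<phi>_cocycle: "\<exists>k. \<forall>x\<in>carrier G. \<phi> \<delta> \<kappa> (x \<otimes>\<^bsub>G\<^esub> \<tau> \<gamma>) - \<phi> (\<gamma> \<otimes>\<^bsub>Q\<^esub> \<delta>) \<kappa> x + \<phi> \<gamma> (\<delta> \<otimes>\<^bsub>Q\<^esub> \<kappa>) x - \<phi> \<gamma> \<delta> x = k"
    if g: "\<gamma> \<in> carrier Q" "\<delta> \<in> carrier Q" "\<kappa> \<in> carrier Q" for \<gamma> \<delta> \<kappa>
  proof -
    note translate = integral_mod_const_translate[OF \<phi>(1)[OF g(2,3)] tau_closed[OF g(1)]]
    let ?f = "\<lambda>x. \<phi> \<delta> \<kappa> (x \<otimes>\<^bsub>G\<^esub> \<tau> \<gamma>) - \<phi> (\<gamma> \<otimes>\<^bsub>Q\<^esub> \<delta>) \<kappa> x + \<phi> \<gamma> (\<delta> \<otimes>\<^bsub>Q\<^esub> \<kappa>) x - \<phi> \<gamma> \<delta> x"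
    have "J_class ?f = act \<gamma> (c (\<delta>, \<kappa>)) \<otimes>\<^bsub>J G H\<^esub> inv\<^bsub>J G H\<^esub> c (\<gamma> \<otimes>\<^bsub>Q\<^esub> \<delta>, \<kappa>)
          \<otimes>\<^bsub>J G H\<^esub> c (\<gamma>, \<delta> \<otimes>\<^bsub>Q\<^esub> \<kappa>) \<otimes>\<^bsub>J G H\<^esub> inv\<^bsub>J G H\<^esub> c (\<gamma>, \<delta>)"
      using g translate by (simp add: \<phi> act_J_class J_class_arith)
    also have "\<dots> = \<one>\<^bsub>J G H\<^esub>" using c g by (simp add: M.cocycles2_iff)
    finally have "J_class ?f = \<one>\<^bsub>J G H\<^esub>" .
    moreover have "integral_mod_const ?f"
      using g translate \<phi>(1) by (intro integral_mod_const_add integral_mod_const_diff) auto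
    ultimately show ?thesis using J_class_eq_one_iff by blast
  qed
  show ?thesis by (rule that[of \<phi>]) (use \<phi> \<phi>_cocycle in auto)
qed

lemma connecting_cocycle_surj:
  assumes c: "c \<in> carrier (cocycles2 Q (J G H) act)"
  obtains B where "integral_cochain B" "c = connecting_cocycle B"
proof -
  obtain \<phi> where \<phi>: "\<forall>\<gamma>\<in>carrier Q. \<forall>\<delta>\<in>carrier Q. integral_mod_const (\<phi> \<gamma> \<delta>) \<and> c (\<gamma>, \<delta>) = J_class (\<phi> \<gamma> \<delta>)"
    and \<phi>_cocycle: "\<forall>\<gamma>\<in>carrier Q. \<forall>\<delta>\<in>carrier Q. \<forall>\<kappa>\<in>carrier Q. \<exists>k. \<forall>x\<in>carrier G.
      \<phi> \<delta> \<kappa> (x \<otimes>\<^bsub>G\<^esub> \<tau> \<gamma>) - \<phi> (\<gamma> \<otimes>\<^bsub>Q\<^esub> \<delta>) \<kappa> x + \<phi> \<gamma> (\<delta> \<otimes>\<^bsub>Q\<^esub> \<kappa>) x - \<phi> \<gamma> \<delta> x = k"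
    using cocycles2_real_representativesE[OF c] .
  define B where "B \<gamma> x = (\<Sum>\<kappa>\<in>carrier Q. \<phi> \<gamma> \<kappa> x) / card (carrier Q)" for \<gamma> x
  have B_inv: "left_invariant (B \<gamma>)" if "\<gamma> \<in> carrier Q" for \<gamma>
    using \<phi> that by (simp add: B_def integral_mod_const_def left_invariant_def cong: sum.cong)
  have defect: "\<exists>k. \<forall>x\<in>carrier G. mult_defect B \<gamma> \<delta> x = \<phi> \<gamma> \<delta> x + k"
    if "\<gamma> \<in> carrier Q" "\<delta> \<in> carrier Q" for \<gamma> \<delta>
    unfolding B_def using \<phi>_cocycle that by (intro mult_defect_averaged_cochain[OF that]) blast
  have "integral_mod_const (mult_defect B \<gamma> \<delta>)" if g: "\<gamma> \<in> carrier Q" "\<delta> \<in> carrier Q" for \<gamma> \<delta>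
  proof -
    obtain k where "\<forall>x\<in>carrier G. mult_defect B \<gamma> \<delta> x = \<phi> \<gamma> \<delta> x + k" using defect[OF g] ..
    then show ?thesis
      using \<phi> g left_invariant_mult_defect[OF B_inv g] by (simp add: integral_mod_const_def)
  qed
  then have "integral_cochain B" using B_inv by (simp add: integral_cochain_def)
  moreover have "c = connecting_cocycle B"
  proof (rule PiE_ext)
    show "c \<in> carrier Q \<times> carrier Q \<rightarrow>\<^sub>E carrier (J G H)" using c by (simp add: M.cocycles2_iff)
    show "connecting_cocycle B \<in> carrier Q \<times> carrier Q \<rightarrow>\<^sub>E carrier (J G H)"
      using connecting_cocycle_in_cocycles2[OF calculation] by (simp add: M.cocycles2_iff)
    fix q assume "q \<in> carrier Q \<times> carrier Q"
    then obtain \<gamma> \<delta> where q: "q = (\<gamma>, \<delta>)" "\<gamma> \<in> carrier Q" "\<delta> \<in> carrier Q" by blast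
    obtain k where "\<forall>x\<in>carrier G. mult_defect B \<gamma> \<delta> x = \<phi> \<gamma> \<delta> x + k" using defect[OF q(2,3)] ..
    from J_class_cong[OF bspec[OF this]] show "c q = connecting_cocycle B q"
      using \<phi> q by (simp add: connecting_cocycle_def)
  qed
  ultimately show ?thesis using that by blast
qed

definition connecting :: "('c \<Rightarrow> 'a \<Rightarrow> circle) \<Rightarrow> ('c \<times> 'c \<Rightarrow> ('a \<Rightarrow> int) set) set" where
  "connecting b = M.cohom_class (connecting_cocycle (\<lambda>\<gamma> x. rep_circle (b \<gamma> x)))"

lemma integral_cochain_circ_iff:
  assumes "\<And>\<gamma>. \<gamma> \<in> carrier Q \<Longrightarrow> left_invariant (B \<gamma>)"
  shows "integral_cochain B \<longleftrightarrow> cocycle_mod_const (carrier Q) (\<lambda>\<gamma> x. circ (B \<gamma> x))"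
proof -
  have "mult_defect (\<lambda>\<gamma> x. circ (B \<gamma> x)) \<gamma> \<delta> x = circ (mult_defect B \<gamma> \<delta> x)" for \<gamma> \<delta> x
    by (simp add: mult_defect_def circ_add circ_diff)
  then show ?thesis
    using assms left_invariant_mult_defect[OF assms]
    by (auto simp: integral_cochain_def cocycle_mod_const_def integral_mod_const_def circ_eq_iff left_invariant_comp)
qed

lemma integral_cochain_rep_circle:
  assumes "cocycle_mod_const (carrier Q) b"
  shows "integral_cochain (\<lambda>\<gamma> x. rep_circle (b \<gamma> x))"
  using assms left_invariant_comp[OF cocycle_mod_const_left_invariant[OF assms]]
  by (subst integral_cochain_circ_iff) auto

lemma cohom_class_connecting_cocycle_eq_one_iff:
  assumes "integral_cochain B"
  shows "M.cohom_class (connecting_cocycle B) = \<one>\<^bsub>H2 Q (J G H) act\<^esub>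
    \<longleftrightarrow> coboundary_mod_const (carrier Q) (\<lambda>\<gamma> x. circ (B \<gamma> x))"
proof -
  have "restrict (connecting_cocycle B) (carrier Q \<times> carrier Q) = connecting_cocycle B"
    by (auto simp: connecting_cocycle_def fun_eq_iff)
  then show ?thesis
    using restrict_connecting_cocycle_in_coboundaries2[OF assms Q.subgroup_self]
      circ_coboundary_mod_const_if_in_coboundaries2[OF assms Q.subgroup_self]
    by (auto simp: M.cohom_class_eq_one_iff[OF connecting_cocycle_in_cocycles2[OF assms]])
qed

lemma cohom_class_connecting_cocycle_cong:
  assumes B: "integral_cochain B" and C: "integral_cochain C"
    and eq: "\<And>\<gamma> x. \<lbrakk>\<gamma> \<in> carrier Q; x \<in> carrier G\<rbrakk> \<Longrightarrow> circ (B \<gamma> x) = circ (C \<gamma> x)"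
  shows "M.cohom_class (connecting_cocycle B) = M.cohom_class (connecting_cocycle C)"
proof -
  interpret H2: comm_group "H2 Q (J G H) act" by (rule M.comm_group_H2)
  have D: "integral_cochain (\<lambda>\<gamma> x. B \<gamma> x - C \<gamma> x)" by (rule integral_cochain_diff[OF B C])
  have "coboundary_mod_const (carrier Q) (\<lambda>\<gamma> x. circ (B \<gamma> x - C \<gamma> x))"
    by (rule coboundary_mod_const_if_const[where e = "\<lambda>_. 0"]) (simp add: eq circ_diff)
  then have one: "M.cohom_class (connecting_cocycle (\<lambda>\<gamma> x. B \<gamma> x - C \<gamma> x)) = \<one>\<^bsub>H2 Q (J G H) act\<^esub>"
    using cohom_class_connecting_cocycle_eq_one_iff[OF D] by simp
  have "connecting_cocycle B = connecting_cocycle (\<lambda>\<gamma> x. (B \<gamma> x - C \<gamma> x) + C \<gamma> x)" by simp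
  also have "\<dots> = connecting_cocycle (\<lambda>\<gamma> x. B \<gamma> x - C \<gamma> x) \<otimes>\<^bsub>cocycles2 Q (J G H) act\<^esub> connecting_cocycle C"
    by (rule integral_cochain_add(2)[OF D C])
  finally show ?thesis
    using one M.cohom_class_mult[OF D[THEN connecting_cocycle_in_cocycles2] C[THEN connecting_cocycle_in_cocycles2]]
      connecting_cocycle_in_cocycles2[OF C]
    by (simp add: M.carrier_H2)
qed

lemma connecting_closed: "cocycle_mod_const (carrier Q) b \<Longrightarrow> connecting b \<in> carrier (H2 Q (J G H) act)"
  using connecting_cocycle_in_cocycles2[OF integral_cochain_rep_circle] by (auto simp: connecting_def M.carrier_H2)

lemma connecting_add:
  assumes "cocycle_mod_const (carrier Q) b" "cocycle_mod_const (carrier Q) c"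
  shows "connecting (\<lambda>\<gamma> x. b \<gamma> x + c \<gamma> x) = connecting b \<otimes>\<^bsub>H2 Q (J G H) act\<^esub> connecting c"
proof -
  note int = assms[THEN integral_cochain_rep_circle]
  have "connecting (\<lambda>\<gamma> x. b \<gamma> x + c \<gamma> x)
      = M.cohom_class (connecting_cocycle (\<lambda>\<gamma> x. rep_circle (b \<gamma> x) + rep_circle (c \<gamma> x)))"
    unfolding connecting_def
    by (rule cohom_class_connecting_cocycle_cong[OF
          integral_cochain_rep_circle[OF cocycle_mod_const_add[OF assms]] integral_cochain_add(1)[OF int]])
      (simp add: circ_add)
  also have "\<dots> = connecting b \<otimes>\<^bsub>H2 Q (J G H) act\<^esub> connecting c"
    unfolding connecting_def integral_cochain_add(2)[OF int]
    by (rule M.cohom_class_mult[OF int[THEN connecting_cocycle_in_cocycles2]])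
  finally show ?thesis .
qed

lemma connecting_eq_one_iff:
  "cocycle_mod_const (carrier Q) b \<Longrightarrow>
    connecting b = \<one>\<^bsub>H2 Q (J G H) act\<^esub> \<longleftrightarrow> coboundary_mod_const (carrier Q) b"
  using cohom_class_connecting_cocycle_eq_one_iff[OF integral_cochain_rep_circle] by (simp add: connecting_def)

lemma connecting_eqI:
  assumes b: "cocycle_mod_const (carrier Q) b" and c: "cocycle_mod_const (carrier Q) c"
    and triv: "coboundary_mod_const (carrier Q) (\<lambda>\<gamma> x. b \<gamma> x - c \<gamma> x)"
  shows "connecting b = connecting c"
proof -
  interpret H2: comm_group "H2 Q (J G H) act" by (rule M.comm_group_H2)
  have "connecting (\<lambda>\<gamma> x. b \<gamma> x - c \<gamma> x) = \<one>\<^bsub>H2 Q (J G H) act\<^esub>"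
    using connecting_eq_one_iff[OF cocycle_mod_const_diff[OF b c]] triv by simp
  moreover have "connecting b = connecting (\<lambda>\<gamma> x. (b \<gamma> x - c \<gamma> x) + c \<gamma> x)" by simp
  ultimately show ?thesis
    using connecting_add[OF cocycle_mod_const_diff[OF b c] c] connecting_closed[OF c] by simp
qed

lemma connecting_surj:
  assumes "y \<in> carrier (H2 Q (J G H) act)"
  obtains b where "cocycle_mod_const (carrier Q) b" "y = connecting b"
proof -
  obtain c where c: "c \<in> carrier (cocycles2 Q (J G H) act)" "y = M.cohom_class c"
    using assms by (auto simp: M.carrier_H2)
  obtain B where B: "integral_cochain B" "c = connecting_cocycle B" using connecting_cocycle_surj[OF c(1)] .
  have cocycle: "cocycle_mod_const (carrier Q) (\<lambda>\<gamma> x. circ (B \<gamma> x))"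
    using B(1) integral_cochain_circ_iff integral_cochain_left_invariant by blast
  have "y = connecting (\<lambda>\<gamma> x. circ (B \<gamma> x))"
    unfolding c(2) B(2) connecting_def
    by (rule cohom_class_connecting_cocycle_cong[OF B(1) integral_cochain_rep_circle[OF cocycle]]) simp
  then show ?thesis using that cocycle by blast
qed

lemma connecting_in_Sha2_iff:
  assumes D: "\<And>D. D \<in> \<D> \<Longrightarrow> subgroup D Q" and b: "cocycle_mod_const (carrier Q) b"
  shows "connecting b \<in> carrier (Sha2 Q \<D> (J G H) act) \<longleftrightarrow> (\<forall>D\<in>\<D>. coboundary_mod_const D b)"
proof -
  note int = integral_cochain_rep_circle[OF b]
  show ?thesis
    using restrict_connecting_cocycle_in_coboundaries2[OF int D]
      circ_coboundary_mod_const_if_in_coboundaries2[OF int D]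
    by (auto simp: connecting_def M.cohom_class_in_Sha2_iff[OF D connecting_cocycle_in_cocycles2[OF int]])
qed

lemma connecting_pow:
  assumes "cocycle_mod_const (carrier Q) b"
  shows "connecting (\<lambda>\<gamma> x. n \<cdot> b \<gamma> x) = connecting b [^]\<^bsub>H2 Q (J G H) act\<^esub> n"
proof (induction n)
  case 0
  then show ?case
    using connecting_eq_one_iff[OF cocycle_mod_const_zero] coboundary_mod_const_const[of _ "\<lambda>_. 0"] by simp
next
  case (Suc n)
  interpret H2: comm_group "H2 Q (J G H) act" by (rule M.comm_group_H2)
  show ?case
    using Suc connecting_add[OF assms cocycle_mod_const_ntimes[OF assms]] connecting_closed[OF assms]
    by (simp add: H2.m_comm)
qed

lemma connecting_pow_eq_one_iff:
  assumes "cocycle_mod_const (carrier Q) b"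
  shows "connecting b [^]\<^bsub>H2 Q (J G H) act\<^esub> n = \<one>\<^bsub>H2 Q (J G H) act\<^esub>
    \<longleftrightarrow> coboundary_mod_const (carrier Q) (\<lambda>\<gamma> x. n \<cdot> b \<gamma> x)"
  using connecting_eq_one_iff[OF cocycle_mod_const_ntimes[OF assms]] connecting_pow[OF assms] by simp

end

context coset_cohomology
begin

definition locally_trivial_cocycles :: "'c set set \<Rightarrow> ('c \<Rightarrow> 'a \<Rightarrow> circle) monoid" where
  "locally_trivial_cocycles \<D> =
    \<lparr>carrier = {b. cocycle_mod_const (carrier Q) b \<and> (\<forall>D\<in>\<D>. coboundary_mod_const D b)},
     monoid.mult = (\<lambda>b c \<gamma> x. b \<gamma> x + c \<gamma> x), one = (\<lambda>_ _. 0)\<rparr>"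

lemma group_locally_trivial_cocycles: "group (locally_trivial_cocycles \<D>)"
proof (rule groupI)
  fix b assume b: "b \<in> carrier (locally_trivial_cocycles \<D>)"
  show "\<exists>c\<in>carrier (locally_trivial_cocycles \<D>). c \<otimes>\<^bsub>locally_trivial_cocycles \<D>\<^esub> b = \<one>\<^bsub>locally_trivial_cocycles \<D>\<^esub>"
  proof
    show "(\<lambda>\<gamma> x. - b \<gamma> x) \<in> carrier (locally_trivial_cocycles \<D>)"
      using b by (simp add: locally_trivial_cocycles_def cocycle_mod_const_uminus coboundary_mod_const_uminus)
  qed (simp add: locally_trivial_cocycles_def)
qed (auto simp: locally_trivial_cocycles_def add_ac cocycle_mod_const_zero
    coboundary_mod_const_const[of _ "\<lambda>_. 0"] intro: cocycle_mod_const_add coboundary_mod_const_add)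

lemma Sha2_simps:
  "\<one>\<^bsub>Sha2 Q \<D> (J G H) act\<^esub> = \<one>\<^bsub>H2 Q (J G H) act\<^esub>"
  "x \<otimes>\<^bsub>Sha2 Q \<D> (J G H) act\<^esub> y = x \<otimes>\<^bsub>H2 Q (J G H) act\<^esub> y"
  "x [^]\<^bsub>Sha2 Q \<D> (J G H) act\<^esub> (n::nat) = x [^]\<^bsub>H2 Q (J G H) act\<^esub> n"
  by (simp_all add: Sha2_def nat_pow_def)

context
  fixes \<D>
  assumes \<D>: "\<And>D. D \<in> \<D> \<Longrightarrow> subgroup D Q"
begin

lemma Sha2E:
  assumes "y \<in> carrier (Sha2 Q \<D> (J G H) act)"
  obtains b where "b \<in> carrier (locally_trivial_cocycles \<D>)" "y = connecting b"
proof -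
  have "y \<in> carrier (H2 Q (J G H) act)" using assms by (simp add: Sha2_def kernel_def)
  then obtain b where "cocycle_mod_const (carrier Q) b" "y = connecting b" using connecting_surj by blast
  then show ?thesis
    using that assms connecting_in_Sha2_iff[OF \<D>] by (auto simp: locally_trivial_cocycles_def)
qed

lemma connecting_image: "connecting ` carrier (locally_trivial_cocycles \<D>) = carrier (Sha2 Q \<D> (J G H) act)"
  using connecting_in_Sha2_iff[OF \<D>] by (auto simp: locally_trivial_cocycles_def elim!: Sha2E)

lemma connecting_hom: "connecting \<in> hom (locally_trivial_cocycles \<D>) (Sha2 Q \<D> (J G H) act)"
  using connecting_image connecting_add
  by (auto simp: hom_def locally_trivial_cocycles_def Sha2_simps)

lemma comm_group_Sha2: "comm_group (Sha2 Q \<D> (J G H) act)"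
proof -
  interpret H2: comm_group "H2 Q (J G H) act" by (rule M.comm_group_H2)
  interpret h: group_hom "locally_trivial_cocycles \<D>" "H2 Q (J G H) act" connecting
    using group_locally_trivial_cocycles connecting_closed connecting_add
    by (auto simp: group_hom_def group_hom_axioms_def H2.is_group hom_def locally_trivial_cocycles_def)
  have "comm_group ((H2 Q (J G H) act)\<lparr>carrier := carrier (Sha2 Q \<D> (J G H) act)\<rparr>)"
    using H2.comm_group_subgroup[OF h.img_is_subgroup] by (simp add: connecting_image)
  then show ?thesis by (simp add: Sha2_def)
qed

end

end

section \<open>Inflation from the quotient by a normal Sylow subgroup\<close>

locale normal_sylow = coset_module G H + S?: normal S G
  for G :: "('a, 'x) monoid_scheme" (structure) and H and S +
  fixes p :: nat
  assumes finite_G: "finite (carrier G)" and prime_p: "prime p"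
    and card_S_power: "\<exists>a. card S = p ^ a" and coprime_index: "coprime p (card (rcosets S))"
begin

lemma S_carrier: "s \<in> S \<Longrightarrow> s \<in> carrier G"
  using S.subset by blast

lemma finite_S: "finite S"
  using finite_subset[OF S.subset finite_G] .

lemma subgroup_HS: "subgroup (H <#> S) G"
  using G.mult_norm_subgroup[OF S.normal_axioms subgroup_H] G.commut_normal[OF subgroup_H S.normal_axioms]
  by simp

lemma S_subset_HS: "S \<subseteq> H <#> S"
  by (rule G.subset_set_mult(1)[OF subgroup_H S.subset])

sublocale coset_cohomology G H G "\<lambda>x. x" "J_act G"
  by unfold_locales (auto simp: finite_G G.m_assoc)

lemma carrier_Mod: "carrier (G Mod S) = (\<lambda>g. S #> g) ` carrier G"
  by (auto simp: FactGroup_def RCOSETS_def)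

lemma mult_Mod: "\<lbrakk>g \<in> carrier G; h \<in> carrier G\<rbrakk> \<Longrightarrow> (S #> g) \<otimes>\<^bsub>G Mod S\<^esub> (S #> h) = S #> (g \<otimes> h)"
  by (simp add: FactGroup_def S.rcos_sum)

lemma S_coset_rep: "C \<in> carrier (G Mod S) \<Longrightarrow> coset_rep C \<in> carrier G" "C \<in> carrier (G Mod S) \<Longrightarrow> S #> coset_rep C = C"
  unfolding carrier_Mod using G.coset_rep_carrier[OF S.subgroup_axioms] G.rcoset_coset_rep[OF S.subgroup_axioms]
  by auto

lemma rcoset_HS_absorb:
  assumes "x \<in> carrier G" "s \<in> S" "y \<in> carrier G"
  shows "(H <#> S) #> (x \<otimes> (s \<otimes> y)) = (H <#> S) #> (x \<otimes> y)"
proof -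
  have "x \<otimes> s \<otimes> inv x \<in> H <#> S" using S.inv_op_closed2 assms S_subset_HS by blast
  from G.rcoset_absorb[OF subgroup_HS this, of "x \<otimes> y"] show ?thesis
    using assms S_carrier by (simp add: G.word_simps)
qed

lemma rcoset_HS_coset_rep:
  assumes "x \<in> carrier G" "g \<in> carrier G"
  shows "(H <#> S) #> (x \<otimes> coset_rep (S #> g)) = (H <#> S) #> (x \<otimes> g)"
proof -
  obtain s where "s \<in> S" "coset_rep (S #> g) = s \<otimes> g"
    using G.coset_rep_eqE[OF S.subgroup_axioms assms(2)] .
  then show ?thesis using rcoset_HS_absorb assms by simp
qed

sublocale quot: coset_module G "H <#> S"
  by (rule coset_module.intro[OF G.is_group coset_module_axioms.intro[OF subgroup_HS]])

lemma quotient_act_J_act: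
  assumes C: "C \<in> carrier (G Mod S)" and m: "m \<in> carrier (J G (H <#> S))"
  shows "quotient_act (J_act G) C m = J_act G (coset_rep C) m"
proof -
  obtain f where f: "quot.integral_mod_const f" "m = quot.J_class f" using quot.J_cases[OF m] by blast
  have "J_act G g m = J_act G (coset_rep C) m" if g: "g \<in> C" for g
  proof -
    have gG: "g \<in> carrier G" and Cg: "C = S #> g"
      using g C S.subset G.r_coset_subset_G G.repr_independence[OF _ _ S.subgroup_axioms] by (auto simp: carrier_Mod)
    have f_inv: "quot.left_invariant f" using f(1) by (simp add: quot.integral_mod_const_def)
    have "f (x \<otimes> g) = f (x \<otimes> coset_rep C)" if "x \<in> carrier G" for x
      using quot.left_invariant_rcoset[OF f_inv _ _ rcoset_HS_coset_rep[OF that gG]] that gG S_coset_rep(1)[OF C]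
      by (simp add: Cg)
    then have "quot.J_class (\<lambda>x. f (x \<otimes> g)) = quot.J_class (\<lambda>x. f (x \<otimes> coset_rep C))"
      by (intro quot.J_class_cong[where c = 0]) simp
    then show ?thesis using gG S_coset_rep(1)[OF C] by (simp add: f(2) quot.J_act_J_class)
  qed
  moreover have "coset_rep C \<in> C" using C G.coset_rep_in_coset[OF S.subgroup_axioms] by (auto simp: carrier_Mod)
  ultimately have "(\<lambda>g. J_act G g m) ` C = {J_act G (coset_rep C) m}" by blast
  then show ?thesis by (simp add: quotient_act_def)
qed

sublocale quot: coset_cohomology G "H <#> S" "G Mod S" coset_rep "quotient_act (J_act G)"
proof -
  interpret Q: group "G Mod S" by (rule S.factorgroup_is_group)
  show "coset_cohomology G (H <#> S) (G Mod S) coset_rep (quotient_act (J_act G))"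
  proof (intro coset_cohomology.intro coset_cocycles.intro coset_cohomology_axioms.intro
      coset_cocycles_axioms.intro quot.coset_module_axioms Q.is_group quotient_act_J_act S_coset_rep(1))
    show "finite (carrier (G Mod S))" unfolding carrier_Mod using finite_G by blast
    fix C D x assume C: "C \<in> carrier (G Mod S)" "D \<in> carrier (G Mod S)" and x: "x \<in> carrier G"
    have "C \<otimes>\<^bsub>G Mod S\<^esub> D = S #> (coset_rep C \<otimes> coset_rep D)"
      using C S_coset_rep mult_Mod by metis
    then show "(H <#> S) #> (x \<otimes> coset_rep (C \<otimes>\<^bsub>G Mod S\<^esub> D)) = (H <#> S) #> (x \<otimes> coset_rep C \<otimes> coset_rep D)"
      using rcoset_HS_coset_rep[OF x] C S_coset_rep(1) x by (simp add: G.m_assoc)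
  qed
qed

lemma quot_left_invariant_iff:
  "quot.left_invariant m \<longleftrightarrow> left_invariant m \<and> (\<forall>x\<in>carrier G. \<forall>s\<in>S. m (x \<otimes> s) = m x)"
proof (intro iffI conjI ballI)
  assume m: "quot.left_invariant m"
  have "H \<subseteq> H <#> S"
    by (rule G.subset_set_mult(2)[OF S.subgroup_axioms subgroup.subset[OF subgroup_H]])
  then show "left_invariant m" using m unfolding left_invariant_def quot.left_invariant_def by blast
  show "m (x \<otimes> s) = m x" if "x \<in> carrier G" "s \<in> S" for x s
    using quot.left_invariant_rcoset[OF m _ _ rcoset_HS_absorb[OF that G.one_closed]] that S_carrier by simp
next
  assume m: "left_invariant m \<and> (\<forall>x\<in>carrier G. \<forall>s\<in>S. m (x \<otimes> s) = m x)"
  show "quot.left_invariant m"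
    unfolding quot.left_invariant_def
  proof (intro ballI)
    fix x a assume x: "x \<in> carrier G" and "a \<in> H <#> S"
    then obtain h s where a: "h \<in> H" "s \<in> S" "a = h \<otimes> s" by (auto simp: set_mult_def)
    have "a \<otimes> x = h \<otimes> (x \<otimes> (inv x \<otimes> s \<otimes> x))" using a x H_carrier S_carrier by (simp add: G.word_simps)
    moreover have "inv x \<otimes> s \<otimes> x \<in> S" using S.inv_op_closed1 x a by blast
    ultimately show "m (a \<otimes> x) = m x" using m x a(1) S_carrier by (simp add: left_invariant_def)
  qed
qed

lemma quot_left_invariant_coset_rep:
  assumes "quot.left_invariant m" "x \<in> carrier G" "g \<in> carrier G"
  shows "m (x \<otimes> coset_rep (S #> g)) = m (x \<otimes> g)"
  by (rule quot.left_invariant_rcoset[OF assms(1) _ _ rcoset_HS_coset_rep[OF assms(2,3)]])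
    (use assms G.coset_rep_carrier[OF S.subgroup_axioms] in auto)

lemma coprime_card_S: "coprime k p \<Longrightarrow> coprime k (card S)"
  using card_S_power by auto

lemma coprime_card_Mod_subgroup:
  assumes "subgroup E (G Mod S)"
  shows "coprime (card E) p"
proof -
  have "card E dvd card (rcosets S)"
    using group.lagrange[OF S.factorgroup_is_group assms]
    by (metis FactGroup_def dvd_triv_right order_def partial_object.select_convs(1))
  then show ?thesis using coprime_index by (metis coprime_commute coprime_divisors dvd_refl)
qed

lemma subgroup_image_Mod:
  assumes D: "subgroup D G"
  shows "subgroup ((\<lambda>g. S #> g) ` D) (G Mod S)"
proof -
  interpret h: group_hom G "G Mod S" "\<lambda>g. S #> g"
    using S.r_coset_hom_Mod G.is_group S.factorgroup_is_group
    by (simp add: group_hom_def group_hom_axioms_def)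
  show ?thesis using h.subgroup_img_is_subgroup[OF D] .
qed

lemma subgroup_S_Int: "subgroup D G \<Longrightarrow> subgroup (S \<inter> D) G"
  using G.subgroups_Inter_pair[OF S.subgroup_axioms] .

lemma coprime_card_cosets_in_S_Int:
  assumes D: "subgroup D G"
  shows "coprime (card (cosets_in G (S \<inter> D) D)) p" "0 < card (cosets_in G (S \<inter> D) D)"
proof -
  note SD = subgroup_S_Int[OF D]
  have "card (cosets_in G (S \<inter> D) D) = card ((\<lambda>k. S #> k) ` D)"
    unfolding cosets_in_def
  proof (rule card_image_eq)
    fix h h' assume h: "h \<in> D" "h' \<in> D"
    then have "h \<otimes> inv h' \<in> D" using subgroup.m_closed[OF D] subgroup.m_inv_closed[OF D] by blast
    then show "(S \<inter> D) #> h = (S \<inter> D) #> h' \<longleftrightarrow> S #> h = S #> h'"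
      using h subgroup.mem_carrier[OF D] by (simp add: G.rcoset_eq_iff[OF SD] G.rcoset_eq_iff[OF S.subgroup_axioms])
  qed
  then show coprime: "coprime (card (cosets_in G (S \<inter> D) D)) p"
    using coprime_card_Mod_subgroup[OF subgroup_image_Mod[OF D]] by simp
  show "0 < card (cosets_in G (S \<inter> D) D)"
    using coprime prime_gt_1_nat[OF prime_p] by (cases "card (cosets_in G (S \<inter> D) D)") auto
qed

lemma coboundary_mod_const_if_on_Sylow:
  assumes D: "subgroup D G" and b: "cocycle_mod_const (carrier G) b"
    and on_S: "coboundary_mod_const (S \<inter> D) b"
    and torsion: "coboundary_mod_const D (\<lambda>g x. (p ^ k) \<cdot> b g x)"
  shows "coboundary_mod_const D b"
proof (rule coboundary_mod_const_coprime)
  note index = coprime_card_cosets_in_S_Int[OF D]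
  show "coprime (card (cosets_in G (S \<inter> D) D)) (p ^ k)" using index(1) by simp
  show "0 < card (cosets_in G (S \<inter> D) D)" by (rule index(2))
  show "coboundary_mod_const D (\<lambda>g x. card (cosets_in G (S \<inter> D) D) \<cdot> b g x)"
    by (rule coboundary_mod_const_average[OF subgroup_S_Int[OF D] D _
          cocycle_mod_const_subset[OF b subgroup.subset[OF D]] on_S]) blast
qed (rule torsion)

definition inflate :: "('a set \<Rightarrow> 'a \<Rightarrow> circle) \<Rightarrow> 'a \<Rightarrow> 'a \<Rightarrow> circle" where
  "inflate b g x = b (S #> g) x"

lemma inflate_mult_defect:
  assumes "quot.left_invariant (b (S #> h))" "g \<in> carrier G" "h \<in> carrier G" "x \<in> carrier G"
  shows "mult_defect (inflate b) g h x = quot.mult_defect b (S #> g) (S #> h) x"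
  using quot_left_invariant_coset_rep[OF assms(1,4,2)] assms
  by (simp add: mult_defect_def quot.mult_defect_def inflate_def S.rcos_sum)

lemma cocycle_mod_const_inflate:
  assumes b: "quot.cocycle_mod_const (carrier (G Mod S)) b"
  shows "cocycle_mod_const (carrier G) (inflate b)"
proof (rule cocycle_mod_constI)
  have Mod: "S #> g \<in> carrier (G Mod S)" if "g \<in> carrier G" for g using that by (simp add: carrier_Mod)
  note inv = quot.cocycle_mod_const_left_invariant[OF b Mod]
  show "left_invariant (inflate b g)" if "g \<in> carrier G" for g
    using inv[OF that] by (simp add: quot_left_invariant_iff inflate_def[abs_def])
  fix g h x assume g: "g \<in> carrier G" and h: "h \<in> carrier G" and x: "x \<in> carrier G"
  show "mult_defect (inflate b) g h x = mult_defect (inflate b) g h \<one>"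
    using quot.mult_defect_const[OF b Mod[OF g] Mod[OF h] x]
    by (simp add: inflate_mult_defect[of b, OF inv[OF h] g h] x)
qed

definition S_sum :: "('a \<Rightarrow> 'b::ab_group_add) \<Rightarrow> 'a \<Rightarrow> 'b" where
  "S_sum m x = (\<Sum>s\<in>S. m (x \<otimes> s))"

lemma quot_left_invariant_S_sum:
  assumes "left_invariant m"
  shows "quot.left_invariant (S_sum m)"
  unfolding quot_left_invariant_iff
proof (intro conjI ballI)
  show "left_invariant (S_sum m)"
    using assms H_carrier S_carrier
    by (simp add: left_invariant_def S_sum_def G.m_assoc cong: sum.cong)
  fix x s assume "x \<in> carrier G" "s \<in> S"
  then have "S_sum m (x \<otimes> s) = (\<Sum>t\<in>S. m (x \<otimes> (s \<otimes> t)))"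
    using S_carrier by (simp add: S_sum_def G.m_assoc cong: sum.cong)
  also have "\<dots> = S_sum m x"
    unfolding S_sum_def
    by (rule sum.reindex_bij_betw[OF G.bij_betw_subgroup_translate[OF S.subgroup_axioms \<open>s \<in> S\<close>]])
  finally show "S_sum m (x \<otimes> s) = S_sum m x" .
qed

lemma S_sum_translate:
  assumes "x \<in> carrier G" "g \<in> carrier G"
  shows "(\<Sum>s\<in>S. m (x \<otimes> s \<otimes> g)) = S_sum m (x \<otimes> g)"
proof -
  have "bij_betw (\<lambda>s. inv g \<otimes> s \<otimes> g) S S"
    by (rule bij_betw_byWitness[where f' = "\<lambda>s. g \<otimes> s \<otimes> inv g"])
      (use assms S_carrier S.inv_op_closed1 S.inv_op_closed2 in \<open>auto simp: G.word_simps\<close>)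
  then have "(\<Sum>s\<in>S. m (x \<otimes> g \<otimes> (inv g \<otimes> s \<otimes> g))) = S_sum m (x \<otimes> g)"
    unfolding S_sum_def by (rule sum.reindex_bij_betw)
  then show ?thesis using assms S_carrier by (simp add: G.word_simps cong: sum.cong)
qed

lemma quot_coboundary_card_S:
  assumes b: "quot.cocycle_mod_const (carrier (G Mod S)) b" and D: "subgroup D G"
    and triv: "coboundary_mod_const D (inflate b)"
  shows "quot.coboundary_mod_const ((\<lambda>g. S #> g) ` D) (\<lambda>\<gamma> x. card S \<cdot> b \<gamma> x)"
proof -
  obtain m e where m: "left_invariant m"
    and me: "\<And>g x. \<lbrakk>g \<in> D; x \<in> carrier G\<rbrakk> \<Longrightarrow> inflate b g x = m (x \<otimes> g) - m x + e g"
    using coboundary_mod_constE[OF triv] by blast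
  note carr = subgroup.mem_carrier[OF D] and inv = quot_left_invariant_S_sum[OF m]
  have sum: "card S \<cdot> b (S #> g) x = S_sum m (x \<otimes> coset_rep (S #> g)) - S_sum m x + card S \<cdot> e g"
    if g: "g \<in> D" and x: "x \<in> carrier G" for g x
  proof -
    have "quot.left_invariant (b (S #> g))"
      using quot.cocycle_mod_const_left_invariant[OF b] carr[OF g] by (simp add: carrier_Mod)
    then have "card S \<cdot> b (S #> g) x = (\<Sum>s\<in>S. b (S #> g) (x \<otimes> s))"
      using x by (simp add: quot_left_invariant_iff sum_constant_ntimes)
    also have "\<dots> = (\<Sum>s\<in>S. m (x \<otimes> s \<otimes> g) - m (x \<otimes> s) + e g)"
      using me[OF g] x S_carrier by (intro sum.cong) (auto simp: inflate_def)
    finally show ?thesis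
      using S_sum_translate[OF x carr[OF g]] quot_left_invariant_coset_rep[OF inv x carr[OF g]]
      by (simp add: sum.distrib sum_subtractf sum_constant_ntimes S_sum_def)
  qed
  show ?thesis
  proof (rule quot.coboundary_mod_constI[OF inv])
    fix \<gamma> x assume \<gamma>: "\<gamma> \<in> (\<lambda>g. S #> g) ` D" and x: "x \<in> carrier G"
    then obtain g where g: "g \<in> D" "\<gamma> = S #> g" by blast
    from sum[OF g(1) x] sum[OF g(1) G.one_closed]
    show "card S \<cdot> b \<gamma> x = S_sum m (x \<otimes> coset_rep \<gamma>) - S_sum m x
        + (card S \<cdot> b \<gamma> \<one> - S_sum m (\<one> \<otimes> coset_rep \<gamma>) + S_sum m \<one>)"
      by (simp add: g(2))
  qed
qed

lemma coboundary_inflate_iff: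
  assumes b: "quot.cocycle_mod_const (carrier (G Mod S)) b" and D: "subgroup D G"
  shows "coboundary_mod_const D (inflate b) \<longleftrightarrow> quot.coboundary_mod_const ((\<lambda>g. S #> g) ` D) b"
proof
  let ?E = "(\<lambda>g. S #> g) ` D"
  note carr = subgroup.mem_carrier[OF D] and E = subgroup_image_Mod[OF D]
  assume "coboundary_mod_const D (inflate b)"
  note triv_S = quot_coboundary_card_S[OF b D this]
  have "quot.coboundary_mod_const ?E (\<lambda>\<gamma> x. card ?E \<cdot> b \<gamma> x)"
    by (rule quot.coboundary_mod_const_card[OF E quot.cocycle_mod_const_subset[OF b subgroup.subset[OF E]]])
  moreover have "0 < card ?E"
    using quot.Q.finite_subgroup_card_pos[OF E] finite_subset[OF subgroup.subset[OF D] finite_G] by simp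
  ultimately show "quot.coboundary_mod_const ?E b"
    using quot.coboundary_mod_const_coprime[OF coprime_card_S[OF coprime_card_Mod_subgroup[OF E]]] triv_S by blast
next
  note carr = subgroup.mem_carrier[OF D]
  assume "quot.coboundary_mod_const ((\<lambda>g. S #> g) ` D) b"
  then obtain m e where m: "quot.left_invariant m"
    and me: "\<And>\<gamma> x. \<lbrakk>\<gamma> \<in> (\<lambda>g. S #> g) ` D; x \<in> carrier G\<rbrakk> \<Longrightarrow> b \<gamma> x = m (x \<otimes> coset_rep \<gamma>) - m x + e \<gamma>"
    using quot.coboundary_mod_constE by blast
  have "inflate b g x = m (x \<otimes> g) - m x + e (S #> g)" if "g \<in> D" "x \<in> carrier G" for g x
    using that by (simp add: inflate_def me quot_left_invariant_coset_rep[OF m] carr)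
  then show "coboundary_mod_const D (inflate b)"
    using m quot_left_invariant_iff by (intro coboundary_mod_constI[of m]) auto
qed

end

context normal_sylow
begin

context
  fixes c :: "'a \<Rightarrow> 'a \<Rightarrow> circle" and n :: nat
  assumes c: "cocycle_mod_const (carrier G) c" and coprime_n: "coprime n p"
    and torsion: "\<And>g x. \<lbrakk>g \<in> carrier G; x \<in> carrier G\<rbrakk> \<Longrightarrow> n \<cdot> c g x = 0"
    and on_S: "\<And>s x. \<lbrakk>s \<in> S; x \<in> carrier G\<rbrakk> \<Longrightarrow> c s x = 0"
    and at_one: "\<And>g. g \<in> carrier G \<Longrightarrow> c g \<one> = 0"
begin

lemma vanishing_on_S_mult_right:
  assumes g: "g \<in> carrier G" and s: "s \<in> S" and x: "x \<in> carrier G"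
  shows "c (g \<otimes> s) x = c g x"
  using mult_defect_const[OF c g S_carrier[OF s] x] g s x S_carrier[OF s]
  by (simp add: mult_defect_def on_S at_one)

lemma vanishing_on_S_rcoset_eq:
  assumes g: "g \<in> carrier G" and h: "h \<in> carrier G" and eq: "S #> g = S #> h" and x: "x \<in> carrier G"
  shows "c g x = c h x"
proof -
  have "inv h \<otimes> g \<in> S"
    using eq g h G.rcoset_eq_iff[OF S.subgroup_axioms g h] S.inv_op_closed1[of h "g \<otimes> inv h"]
    by (simp add: G.word_simps)
  from vanishing_on_S_mult_right[OF h this x] show ?thesis using g h by (simp add: G.word_simps)
qed

lemma vanishing_on_S_add:
  assumes g: "g \<in> carrier G" and s: "s \<in> S" and x: "x \<in> carrier G"
  shows "c g (x \<otimes> s) = c g x + c g s"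
proof -
  have "c (s \<otimes> g) x = c g x"
    by (rule vanishing_on_S_rcoset_eq[OF _ g G.rcoset_absorb[OF S.subgroup_axioms s g] x])
      (use g S_carrier[OF s] in simp)
  then show ?thesis
    using mult_defect_const[OF c S_carrier[OF s] g x] g s x S_carrier[OF s]
    by (simp add: mult_defect_def on_S at_one diff_eq_eq add.commute)
qed

lemma vanishing_on_S_eq_0:
  assumes g: "g \<in> carrier G" and s: "s \<in> S"
  shows "c g s = 0"
proof -
  have "G.character S (c g)" using vanishing_on_S_add[OF g] S_carrier by (simp add: G.character_def)
  from G.character_nat_pow[OF S.subgroup_axioms this s]
  have "card S \<cdot> c g s = c g (s [^] card S)" by (rule sym)
  also have "\<dots> = 0" using G.pow_card_subgroup[OF S.subgroup_axioms s] at_one[OF g] by simp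
  finally show ?thesis
    using ntimes_coprime_zero[OF _ _ torsion[OF g S_carrier[OF s]]] coprime_card_S[OF coprime_n]
      G.finite_subgroup_card_pos[OF S.subgroup_axioms finite_S] by (metis coprime_commute)
qed

lemma deflate_vanishing_on_S:
  obtains d where "quot.cocycle_mod_const (carrier (G Mod S)) d"
    "\<forall>g\<in>carrier G. \<forall>x\<in>carrier G. inflate d g x = c g x"
proof -
  let ?d = "\<lambda>\<gamma>. c (coset_rep \<gamma>)"
  have eq: "inflate ?d g x = c g x" if "g \<in> carrier G" "x \<in> carrier G" for g x
    unfolding inflate_def
    by (rule vanishing_on_S_rcoset_eq[OF _ that(1) _ that(2)]) (use S_coset_rep that(1) in \<open>auto simp: carrier_Mod\<close>)
  have inv: "quot.left_invariant (?d \<gamma>)" if "\<gamma> \<in> carrier (G Mod S)" for \<gamma>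
    using cocycle_mod_const_left_invariant[OF c] vanishing_on_S_add vanishing_on_S_eq_0 S_coset_rep(1)[OF that]
    by (simp add: quot_left_invariant_iff)
  have "quot.cocycle_mod_const (carrier (G Mod S)) ?d"
  proof (rule quot.cocycle_mod_constI[OF inv])
    fix \<gamma> \<delta> x assume "\<gamma> \<in> carrier (G Mod S)" "\<delta> \<in> carrier (G Mod S)" and x: "x \<in> carrier G"
    then obtain g h where g: "g \<in> carrier G" "\<gamma> = S #> g" and h: "h \<in> carrier G" "\<delta> = S #> h"
      by (auto simp: carrier_Mod)
    have "quot.mult_defect ?d \<gamma> \<delta> y = mult_defect c g h y" if "y \<in> carrier G" for y
    proof -
      have "quot.mult_defect ?d \<gamma> \<delta> y = mult_defect (inflate ?d) g h y"
        using inflate_mult_defect[of ?d, OF inv g(1) h(1) that] h(1) by (simp add: g(2) h(2) carrier_Mod)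
      then show ?thesis using g(1) h(1) that by (simp add: mult_defect_def eq)
    qed
    then show "quot.mult_defect ?d \<gamma> \<delta> x = quot.mult_defect ?d \<gamma> \<delta> \<one>"
      using mult_defect_const[OF c g(1) h(1) x] x by simp
  qed
  then show ?thesis using that eq by blast
qed

end

lemma vanishing_on_S_representativeE:
  fixes b :: "'a \<Rightarrow> 'a \<Rightarrow> circle"
  assumes b: "cocycle_mod_const (carrier G) b" and n: "0 < n" "coprime n p"
    and triv: "coboundary_mod_const (carrier G) (\<lambda>g x. n \<cdot> b g x)"
  obtains c where "cocycle_mod_const (carrier G) c" "coboundary_mod_const (carrier G) (\<lambda>g x. b g x - c g x)"
    "\<forall>g\<in>carrier G. \<forall>x\<in>carrier G. n \<cdot> c g x = 0" "\<forall>s\<in>S. \<forall>x\<in>carrier G. c s x = 0"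
    "\<forall>g\<in>carrier G. c g \<one> = 0"
proof -
  obtain m e where m: "left_invariant m"
    and tors: "\<forall>g\<in>carrier G. \<forall>x\<in>carrier G. n \<cdot> (b g x - (m (x \<otimes> g) - m x + e g)) = 0"
    using torsion_representativeE[OF n(1) triv] .
  define b' where "b' g x = b g x - (m (x \<otimes> g) - m x + e g)" for g x
  have b': "cocycle_mod_const (carrier G) b'"
    unfolding b'_def by (rule cocycle_mod_const_diff[OF b cocycle_mod_const_coboundary[OF m subset_refl]])
  have tors': "n \<cdot> b' g x = 0" if "g \<in> carrier G" "x \<in> carrier G" for g x
    using tors that by (simp add: b'_def)
  obtain \<nu> where \<nu>: "left_invariant \<nu>" "\<nu> \<one> = 0" "\<forall>x\<in>carrier G. n \<cdot> \<nu> x = 0"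
    "\<forall>s\<in>S. \<forall>x\<in>carrier G. b' s x - b' s \<one> = \<nu> x - \<nu> (x \<otimes> s) + \<nu> s"
    using torsion_cocycle_trivialE[OF S.subgroup_axioms cocycle_mod_const_subset[OF b' S.subset]
        coprime_card_S[OF n(2)] tors'[OF S_carrier]] .
  define c where "c g x = b' g x + (\<nu> (x \<otimes> g) - \<nu> x + - (b' g \<one> + \<nu> g))" for g x
  show ?thesis
  proof (rule that[of c])
    show "cocycle_mod_const (carrier G) c"
      unfolding c_def by (rule cocycle_mod_const_add[OF b' cocycle_mod_const_coboundary[OF \<nu>(1) subset_refl]])
    show "coboundary_mod_const (carrier G) (\<lambda>g x. b g x - c g x)"
      by (rule coboundary_mod_constI[of "\<lambda>x. m x - \<nu> x" _ _ "\<lambda>g. e g + b' g \<one> + \<nu> g"])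
        (use m \<nu>(1) in \<open>simp_all add: left_invariant_def c_def b'_def[of _ x for x]\<close>)
    show "\<forall>g\<in>carrier G. \<forall>x\<in>carrier G. n \<cdot> c g x = 0"
      using tors' \<nu>(3) by (simp add: c_def ntimes_add_right ntimes_diff_right ntimes_minus_right)
    show "\<forall>s\<in>S. \<forall>x\<in>carrier G. c s x = 0" using \<nu>(4) by (simp add: c_def algebra_simps)
    show "\<forall>g\<in>carrier G. c g \<one> = 0" by (simp add: c_def \<nu>(2))
  qed
qed

lemma inflate_surj:
  assumes "cocycle_mod_const (carrier G) b" "0 < n" "coprime n p"
    and "coboundary_mod_const (carrier G) (\<lambda>g x. n \<cdot> b g x)"
  obtains d where "quot.cocycle_mod_const (carrier (G Mod S)) d"
    "coboundary_mod_const (carrier G) (\<lambda>g x. b g x - inflate d g x)"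
proof -
  obtain c where c: "cocycle_mod_const (carrier G) c" "coboundary_mod_const (carrier G) (\<lambda>g x. b g x - c g x)"
    and vanishing: "\<forall>g\<in>carrier G. \<forall>x\<in>carrier G. n \<cdot> c g x = 0" "\<forall>s\<in>S. \<forall>x\<in>carrier G. c s x = 0"
    "\<forall>g\<in>carrier G. c g \<one> = 0"
    using vanishing_on_S_representativeE[OF assms] .
  obtain d where d: "quot.cocycle_mod_const (carrier (G Mod S)) d"
    and eq: "\<forall>g\<in>carrier G. \<forall>x\<in>carrier G. inflate d g x = c g x"
    using deflate_vanishing_on_S[OF c(1) assms(3)] vanishing by metis
  have "coboundary_mod_const (carrier G) (\<lambda>g x. b g x - inflate d g x)"
    using c(2) eq by (simp cong: coboundary_mod_const_cong)
  then show ?thesis using that d by blast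
qed

lemma coboundary_inflate_carrier_iff:
  "quot.cocycle_mod_const (carrier (G Mod S)) b \<Longrightarrow>
    coboundary_mod_const (carrier G) (inflate b) \<longleftrightarrow> quot.coboundary_mod_const (carrier (G Mod S)) b"
  using coboundary_inflate_iff[OF _ G.subgroup_self] by (simp add: carrier_Mod)

lemma quotient_subgroups_eq:
  assumes "\<And>D. D \<in> \<D> \<Longrightarrow> subgroup D G"
  shows "quotient_subgroups G S \<D> = (\<lambda>D. (\<lambda>g. S #> g) ` D) ` \<D>"
  unfolding quotient_subgroups_def
proof (rule image_cong[OF refl])
  fix D assume "D \<in> \<D>"
  then have D: "subgroup D G" using assms by blast
  have SDS: "D <#> S = S <#> D" using G.commut_normal[OF D S.normal_axioms] .
  have "S #> (s \<otimes> d) = S #> d" if "s \<in> S" "d \<in> D" for s d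
    by (rule G.rcoset_absorb[OF S.subgroup_axioms that(1) subgroup.mem_carrier[OF D that(2)]])
  moreover have "D \<subseteq> S <#> D"
    by (rule G.subset_set_mult(1)[OF S.subgroup_axioms subgroup.subset[OF D]])
  ultimately have "(\<lambda>g. S #> g) ` (S <#> D) = (\<lambda>g. S #> g) ` D"
    by (auto simp: set_mult_def)
  then show "carrier (G\<lparr>carrier := D <#> S\<rparr> Mod S) = (\<lambda>g. S #> g) ` D"
    unfolding SDS FactGroup_def RCOSETS_def by (simp add: UNION_singleton_eq_range)
qed

context
  fixes \<D>
  assumes \<D>: "\<And>D. D \<in> \<D> \<Longrightarrow> subgroup D G"
begin

lemma subgroup_quotient_subgroups: "E \<in> quotient_subgroups G S \<D> \<Longrightarrow> subgroup E (G Mod S)"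
  using \<D> subgroup_image_Mod by (auto simp: quotient_subgroups_eq)

lemma quot_locally_trivial_iff:
  "b \<in> carrier (quot.locally_trivial_cocycles (quotient_subgroups G S \<D>)) \<longleftrightarrow>
    quot.cocycle_mod_const (carrier (G Mod S)) b \<and> inflate b \<in> carrier (locally_trivial_cocycles \<D>)"
  using coboundary_inflate_iff[OF _ \<D>] cocycle_mod_const_inflate
  by (auto simp: quot.locally_trivial_cocycles_def locally_trivial_cocycles_def quotient_subgroups_eq[OF \<D>])

lemma connecting_inflate_in_prime_to_part:
  assumes "b \<in> carrier (quot.locally_trivial_cocycles (quotient_subgroups G S \<D>))"
  shows "connecting (inflate b) \<in> carrier (prime_to_part p (Sha2 G \<D> (J G H) (J_act G)))"
proof -
  let ?n = "card (carrier (G Mod S))"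
  have b: "quot.cocycle_mod_const (carrier (G Mod S)) b"
    and infl: "inflate b \<in> carrier (locally_trivial_cocycles \<D>)"
    using assms by (simp_all add: quot_locally_trivial_iff)
  have "quot.coboundary_mod_const (carrier (G Mod S)) (\<lambda>\<gamma> x. ?n \<cdot> b \<gamma> x)"
    by (rule quot.coboundary_mod_const_card[OF quot.Q.subgroup_self b])
  then have "coboundary_mod_const (carrier G) (\<lambda>g x. ?n \<cdot> inflate b g x)"
    using coboundary_inflate_carrier_iff[OF quot.cocycle_mod_const_ntimes[OF b]] by (simp add: inflate_def[abs_def])
  then have "connecting (inflate b) [^]\<^bsub>H2 G (J G H) (J_act G)\<^esub> ?n = \<one>\<^bsub>H2 G (J G H) (J_act G)\<^esub>"
    using connecting_pow_eq_one_iff[OF cocycle_mod_const_inflate[OF b]] by simp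
  moreover have "0 < ?n"
    using quot.Q.finite_subgroup_card_pos[OF quot.Q.subgroup_self] quot.finite_Q by blast
  ultimately show ?thesis
    using infl coprime_card_Mod_subgroup[OF quot.Q.subgroup_self] connecting_image[OF \<D>]
    by (auto simp: prime_to_part_def Sha2_simps)
qed

lemma connecting_inflate_hom:
  "(\<lambda>b. connecting (inflate b)) \<in> hom (quot.locally_trivial_cocycles (quotient_subgroups G S \<D>))
     (prime_to_part p (Sha2 G \<D> (J G H) (J_act G)))"
proof (rule homI[OF connecting_inflate_in_prime_to_part])
  let ?P = "quot.locally_trivial_cocycles (quotient_subgroups G S \<D>)"
  let ?A = "prime_to_part p (Sha2 G \<D> (J G H) (J_act G))"
  fix b c assume "b \<in> carrier ?P" "c \<in> carrier ?P"
  then have "cocycle_mod_const (carrier G) (inflate b)" "cocycle_mod_const (carrier G) (inflate c)"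
    using quot_locally_trivial_iff cocycle_mod_const_inflate by blast+
  from connecting_add[OF this]
  show "connecting (inflate (b \<otimes>\<^bsub>?P\<^esub> c)) = connecting (inflate b) \<otimes>\<^bsub>?A\<^esub> connecting (inflate c)"
    by (simp add: quot.locally_trivial_cocycles_def inflate_def[abs_def] prime_to_part_def Sha2_simps)
qed

lemma connecting_inflate_surj:
  "(\<lambda>b. connecting (inflate b)) ` carrier (quot.locally_trivial_cocycles (quotient_subgroups G S \<D>))
    = carrier (prime_to_part p (Sha2 G \<D> (J G H) (J_act G)))"
proof (intro equalityI subsetI)
  fix y assume "y \<in> carrier (prime_to_part p (Sha2 G \<D> (J G H) (J_act G)))"
  then obtain k :: nat where y: "y \<in> carrier (Sha2 G \<D> (J G H) (J_act G))"
    and k: "0 < k" "coprime k p" "y [^]\<^bsub>H2 G (J G H) (J_act G)\<^esub> k = \<one>\<^bsub>H2 G (J G H) (J_act G)\<^esub>"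
    by (auto simp: prime_to_part_def Sha2_simps)
  obtain b where b: "cocycle_mod_const (carrier G) b" "y = connecting b"
    using Sha2E[OF \<D> y] unfolding locally_trivial_cocycles_def by auto
  have "coboundary_mod_const (carrier G) (\<lambda>g x. k \<cdot> b g x)"
    using k(3) connecting_pow_eq_one_iff[OF b(1)] b(2) by simp
  then obtain d where d: "quot.cocycle_mod_const (carrier (G Mod S)) d"
    and eq: "coboundary_mod_const (carrier G) (\<lambda>g x. b g x - inflate d g x)"
    using inflate_surj[OF b(1) k(1,2)] by blast
  note infl = cocycle_mod_const_inflate[OF d]
  have y_eq: "y = connecting (inflate d)" using connecting_eqI[OF b(1) infl eq] b(2) by simp
  then have "inflate d \<in> carrier (locally_trivial_cocycles \<D>)"
    using y infl connecting_in_Sha2_iff[OF \<D> infl] by (simp add: locally_trivial_cocycles_def)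
  then show "y \<in> (\<lambda>b. connecting (inflate b)) ` carrier (quot.locally_trivial_cocycles (quotient_subgroups G S \<D>))"
    using d y_eq quot_locally_trivial_iff by blast
qed (use connecting_inflate_in_prime_to_part in blast)

theorem prime_to_part_Sha2:
  "prime_to_part p (Sha2 G \<D> (J G H) (J_act G))
     \<cong> Sha2 (G Mod S) (quotient_subgroups G S \<D>) (J G (H <#> S)) (quotient_act (J_act G))"
proof (rule iso_of_equal_kernels[OF quot.group_locally_trivial_cocycles _ _
      connecting_inflate_hom connecting_inflate_surj quot.connecting_hom[OF subgroup_quotient_subgroups]
      quot.connecting_image[OF subgroup_quotient_subgroups]])
  show "group (prime_to_part p (Sha2 G \<D> (J G H) (J_act G)))"
    using comm_group_prime_to_part[OF comm_group_Sha2[OF \<D>]] by (simp add: comm_group_def)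
  show "group (Sha2 (G Mod S) (quotient_subgroups G S \<D>) (J G (H <#> S)) (quotient_act (J_act G)))"
    using quot.comm_group_Sha2[OF subgroup_quotient_subgroups] by (simp add: comm_group_def)
  fix b assume "b \<in> carrier (quot.locally_trivial_cocycles (quotient_subgroups G S \<D>))"
  then have "quot.cocycle_mod_const (carrier (G Mod S)) b" by (simp add: quot_locally_trivial_iff)
  then show "connecting (inflate b) = \<one>\<^bsub>prime_to_part p (Sha2 G \<D> (J G H) (J_act G))\<^esub>
    \<longleftrightarrow> quot.connecting b = \<one>\<^bsub>Sha2 (G Mod S) (quotient_subgroups G S \<D>) (J G (H <#> S)) (quotient_act (J_act G))\<^esub>"
    using connecting_eq_one_iff[OF cocycle_mod_const_inflate] quot.connecting_eq_one_iff
      coboundary_inflate_carrier_iff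
    by (simp add: prime_to_part_def Sha2_simps quot.Sha2_simps)
qed

end

end

section \<open>Point stabilisers in the Sylow subgroup\<close>

context normal_sylow
begin

definition stab :: "'a \<Rightarrow> 'a set" where
  "stab x = {s \<in> S. x \<otimes> s \<otimes> inv x \<in> H}"

lemma stab_subset: "stab x \<subseteq> S"
  by (auto simp: stab_def)

lemma stab_S: "k \<in> stab x \<Longrightarrow> k \<in> S"
  by (simp add: stab_def)

lemma stab_carrier: "k \<in> stab x \<Longrightarrow> k \<in> carrier G"
  using S_carrier stab_S by blast

lemma stab_one: "stab \<one> = S \<inter> H"
  using S_carrier by (auto simp: stab_def)

lemma stab_iff_rcoset: "\<lbrakk>x \<in> carrier G; s \<in> S\<rbrakk> \<Longrightarrow> s \<in> stab x \<longleftrightarrow> H #> (x \<otimes> s) = H #> x"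
  using S_carrier by (simp add: stab_def G.rcoset_eq_iff[OF subgroup_H])

lemma left_invariant_stab:
  "\<lbrakk>left_invariant m; x \<in> carrier G; k \<in> stab x\<rbrakk> \<Longrightarrow> m (x \<otimes> k) = m x"
  by (rule left_invariant_rcoset) (auto simp: stab_carrier stab_S simp flip: stab_iff_rcoset)

lemma subgroup_stab:
  assumes x: "x \<in> carrier G"
  shows "subgroup (stab x) G"
proof (rule G.subgroupI)
  show "stab x \<subseteq> carrier G" using stab_carrier by blast
  have "\<one> \<in> stab x" using x subgroup.one_closed[OF subgroup_H] by (simp add: stab_def)
  then show "stab x \<noteq> {}" by blast
  show "inv s \<in> stab x" if "s \<in> stab x" for s
    using that x stab_carrier[OF that] subgroup.m_inv_closed[OF subgroup_H, of "x \<otimes> s \<otimes> inv x"]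
    by (auto simp: stab_def G.word_simps)
  show "s \<otimes> t \<in> stab x" if "s \<in> stab x" "t \<in> stab x" for s t
    using that x that[THEN stab_carrier]
      subgroup.m_closed[OF subgroup_H, of "x \<otimes> s \<otimes> inv x" "x \<otimes> t \<otimes> inv x"]
    by (auto simp: stab_def G.word_simps)
qed

lemma stab_m_closed: "\<lbrakk>x \<in> carrier G; k \<in> stab x; l \<in> stab x\<rbrakk> \<Longrightarrow> k \<otimes> l \<in> stab x"
  using subgroup.m_closed[OF subgroup_stab] .

lemma stab_inv_closed: "\<lbrakk>x \<in> carrier G; k \<in> stab x\<rbrakk> \<Longrightarrow> inv k \<in> stab x"
  using subgroup.m_inv_closed[OF subgroup_stab] .

lemma stab_nat_pow_closed: "\<lbrakk>x \<in> carrier G; k \<in> stab x\<rbrakk> \<Longrightarrow> k [^] (n::nat) \<in> stab x"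
  using G.subgroup_nat_pow_closed[OF subgroup_stab] .

lemma one_in_stab: "x \<in> carrier G \<Longrightarrow> \<one> \<in> stab x"
  using subgroup.one_closed[OF subgroup_stab] .

lemma stab_conj_iff:
  assumes "x \<in> carrier G" "g \<in> carrier G" "s \<in> S"
  shows "inv g \<otimes> s \<otimes> g \<in> stab (x \<otimes> g) \<longleftrightarrow> s \<in> stab x"
  using assms S_carrier[OF assms(3)] S.inv_op_closed1[OF assms(2,3)] by (simp add: stab_def G.word_simps)

lemma card_stab:
  assumes x: "x \<in> carrier G"
  shows "card (stab x) = card (S \<inter> H)"
proof -
  have "bij_betw (\<lambda>s. x \<otimes> s \<otimes> inv x) (stab x) (S \<inter> H)"
    by (rule bij_betw_byWitness[where f' = "\<lambda>s. inv x \<otimes> s \<otimes> x"])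
      (use x S_carrier S.inv_op_closed1 S.inv_op_closed2 in \<open>auto simp: stab_def G.word_simps\<close>)
  then show ?thesis by (rule bij_betw_same_card)
qed

lemma coboundary_in_S_if_vanishes_on_stabilisers:
  assumes D: "subgroup D G" "D \<subseteq> S" and b: "crossed_hom D b"
    and vanishes: "\<And>k x. \<lbrakk>k \<in> D; x \<in> carrier G; k \<in> stab x\<rbrakk> \<Longrightarrow> b k x = 0"
  shows "coboundary_mod_const D b"
  by (rule coboundary_mod_const_if_vanishes_on_stabilisers[OF D(1) b])
    (use vanishes D(2) in \<open>auto simp: stab_iff_rcoset\<close>)

end

locale core_free_sylow = normal_sylow G H S p
  for G :: "('a, 'x) monoid_scheme" (structure) and H S p +
  assumes core: "\<lbrakk>g \<in> carrier G; \<And>x. x \<in> carrier G \<Longrightarrow> x \<otimes> g \<otimes> inv x \<in> H\<rbrakk> \<Longrightarrow> g = \<one>"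
    and card_S_Int_H: "card S = p * card (S \<inter> H)"
begin

lemma stab_index: "x \<in> carrier G \<Longrightarrow> card S = p * card (stab x)"
  using card_S_Int_H card_stab by simp

lemma in_all_stab: "\<lbrakk>s \<in> S; \<And>x. x \<in> carrier G \<Longrightarrow> s \<in> stab x\<rbrakk> \<Longrightarrow> s = \<one>"
  using core S_carrier by (auto simp: stab_def)

lemma S_commute:
  assumes s: "s \<in> S" and t: "t \<in> S"
  shows "s \<otimes> t = t \<otimes> s"
proof -
  obtain a where a: "card S = p ^ a" using card_S_power by blast
  have "s \<otimes> t \<otimes> inv s \<otimes> inv t \<in> stab x" if "x \<in> carrier G" for x
    by (rule G.index_p_commutator_mem[OF S.subgroup_axioms finite_S prime_p a subgroup_stab[OF that]
          stab_subset stab_index[OF that] s t])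
  then have "s \<otimes> t \<otimes> inv (t \<otimes> s) = \<one>"
    using in_all_stab s t S_carrier by (simp add: G.word_simps)
  from G.inv_equality[OF this] show ?thesis using s t S_carrier by simp
qed

lemma S_nat_pow_p:
  assumes s: "s \<in> S"
  shows "s [^] p = \<one>"
proof -
  obtain a where a: "card S = p ^ a" using card_S_power by blast
  have "s [^] p \<in> stab x" if "x \<in> carrier G" for x
    by (rule G.index_p_nat_pow_mem[OF S.subgroup_axioms finite_S prime_p a subgroup_stab[OF that]
          stab_subset stab_index[OF that] s])
  then show ?thesis using in_all_stab G.subgroup_nat_pow_closed[OF S.subgroup_axioms s] by blast
qed

lemma S_conj_eq: "\<lbrakk>s \<in> S; k \<in> S\<rbrakk> \<Longrightarrow> inv s \<otimes> k \<otimes> s = k"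
  using S_commute S_carrier by (metis G.conj_eq_iff(2))

lemma stab_translateE:
  assumes x: "x \<in> carrier G" and t: "t \<in> S" "t \<notin> stab x" and u: "u \<in> S"
  obtains i where "u \<otimes> t [^] (i::nat) \<in> stab x"
proof -
  obtain a where a: "card S = p ^ a" using card_S_power by blast
  show ?thesis
    using G.index_p_translate_meets[OF S.subgroup_axioms finite_S prime_p a subgroup_stab[OF x]
        stab_subset stab_index[OF x] t u] that by blast
qed

lemma stab_mult_S:
  assumes x: "x \<in> carrier G" and s: "s \<in> S"
  shows "stab (x \<otimes> s) = stab x"
  using stab_conj_iff[OF x S_carrier[OF s]] stab_subset by (auto simp: S_conj_eq[OF s])

lemma stab_not_subsetE:
  assumes x: "x \<in> carrier G" and y: "y \<in> carrier G" and ne: "stab x \<noteq> stab y"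
  obtains t where "t \<in> stab x" "t \<notin> stab y"
proof -
  have "\<not> stab x \<subseteq> stab y"
    using card_subset_eq[of "stab y" "stab x"] ne card_stab[OF x] card_stab[OF y]
      finite_subset[OF stab_subset finite_S] by auto
  then show ?thesis using that by blast
qed

lemma S_eq_stab_mult_stab:
  assumes x: "x \<in> carrier G" and y: "y \<in> carrier G" and ne: "stab x \<noteq> stab y"
  shows "stab x <#> stab y = S"
proof (intro equalityI subsetI)
  fix s assume s: "s \<in> S"
  obtain t where t: "t \<in> stab y" "t \<notin> stab x" using stab_not_subsetE[OF y x ne[symmetric]] .
  obtain i where i: "s \<otimes> t [^] (i::nat) \<in> stab x" using stab_translateE[OF x stab_S[OF t(1)] t(2) s] .
  have "inv (t [^] i) \<in> stab y" using t(1) stab_nat_pow_closed[OF y] stab_inv_closed[OF y] by blast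
  then have "s \<otimes> t [^] i \<otimes> inv (t [^] i) \<in> stab x <#> stab y" using i unfolding set_mult_def by blast
  then show "s \<in> stab x <#> stab y" using S_carrier[OF s] stab_carrier[OF t(1)] by (simp add: G.m_assoc)
qed (auto simp: set_mult_def stab_S)

lemma exists_other_stab:
  assumes "card S \<noteq> p"
  shows "\<exists>y\<in>carrier G. stab y \<noteq> stab \<one>"
proof (rule ccontr)
  assume "\<not> ?thesis"
  then have "k = \<one>" if "k \<in> stab \<one>" for k using in_all_stab[OF stab_S[OF that]] that by blast
  then have "stab \<one> = {\<one>}" using one_in_stab[OF G.one_closed] by blast
  then show False using stab_index[OF G.one_closed] assms by simp
qed

lemma comm_group_S: "comm_group (G\<lparr>carrier := S\<rparr>)"
  using group.group_comm_groupI[OF G.subgroup_imp_group[OF S.subgroup_axioms]] S_commute by simp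

lemma S_iso_DirProd_if_disjoint:
  assumes x: "x \<in> carrier G" and y: "y \<in> carrier G" and ne: "stab x \<noteq> stab y"
    and disjoint: "stab x \<inter> stab y = {\<one>}"
    and iso: "G\<lparr>carrier := stab x\<rparr> \<cong> A" "G\<lparr>carrier := stab y\<rparr> \<cong> B"
  shows "G\<lparr>carrier := S\<rparr> \<cong> A \<times>\<times> B"
proof -
  interpret S: comm_group "G\<lparr>carrier := S\<rparr>" by (rule comm_group_S)
  have sub: "subgroup (stab z) (G\<lparr>carrier := S\<rparr>)" if "z \<in> carrier G" for z
    using G.subgroup_incl[OF subgroup_stab[OF that] S.subgroup_axioms stab_subset] .
  show ?thesis
    by (rule S.iso_DirProd_if_complements[OF sub[OF x] sub[OF y]])
      (use disjoint S_eq_stab_mult_stab[OF x y ne] iso in \<open>simp_all add: set_mult_def\<close>)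
qed

lemma card_S_if_disjoint:
  assumes x: "x \<in> carrier G" and y: "y \<in> carrier G" and ne: "stab x \<noteq> stab y"
    and disjoint: "stab x \<inter> stab y = {\<one>}"
  shows "card S = p\<^sup>2"
proof -
  have "G\<lparr>carrier := S\<rparr> \<cong> G\<lparr>carrier := stab x\<rparr> \<times>\<times> G\<lparr>carrier := stab y\<rparr>"
    by (rule S_iso_DirProd_if_disjoint[OF assms iso_refl iso_refl])
  then have "card S = card (stab x) * card (stab y)" using iso_same_card by (fastforce simp: card_cartesian_product)
  then have "p * card (S \<inter> H) = card (S \<inter> H) * card (S \<inter> H)"
    using card_S_Int_H by (simp add: card_stab[OF x] card_stab[OF y])
  moreover have "0 < card (S \<inter> H)"
    using G.finite_subgroup_card_pos[OF subgroup_stab[OF G.one_closed]] finite_S by (simp add: stab_one)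
  ultimately show ?thesis using card_S_Int_H by (simp add: power2_eq_square)
qed

end

section \<open>Locally trivial cocycles on the Sylow subgroup\<close>

context core_free_sylow
begin

definition constant_on_fixed_points :: "('a \<Rightarrow> 'a \<Rightarrow> 'b) \<Rightarrow> bool" where
  "constant_on_fixed_points b \<longleftrightarrow> (\<forall>x\<in>carrier G. \<forall>y\<in>carrier G. \<forall>k\<in>stab x \<inter> stab y. b k x = b k y)"

definition vanishes_on_stab :: "('a \<Rightarrow> 'a \<Rightarrow> 'b::zero) \<Rightarrow> 'a \<Rightarrow> bool" where
  "vanishes_on_stab b x \<longleftrightarrow> (\<forall>k\<in>stab x. b k x = 0)"

lemma constant_on_fixed_pointsD:
  "\<lbrakk>constant_on_fixed_points b; x \<in> carrier G; y \<in> carrier G; k \<in> stab x; k \<in> stab y\<rbrakk> \<Longrightarrow> b k x = b k y"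
  unfolding constant_on_fixed_points_def by blast

lemma constant_on_fixed_points_diff:
  "\<lbrakk>constant_on_fixed_points b; constant_on_fixed_points c\<rbrakk> \<Longrightarrow> constant_on_fixed_points (\<lambda>g x. b g x - c g x)"
  unfolding constant_on_fixed_points_def by metis

lemma constant_on_fixed_points_const: "constant_on_fixed_points (\<lambda>g x. e g)"
  by (simp add: constant_on_fixed_points_def)

lemma constant_on_fixed_points_if_locally_trivial:
  assumes "\<And>g. g \<in> S \<Longrightarrow> coboundary_mod_const (generate G {g}) b"
  shows "constant_on_fixed_points b"
  unfolding constant_on_fixed_points_def
proof (intro ballI)
  fix x y k assume x: "x \<in> carrier G" and y: "y \<in> carrier G" and k: "k \<in> stab x \<inter> stab y"
  have gen: "k \<in> generate G {k}" by (rule generate.incl) simp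
  obtain m e where m: "left_invariant m"
    and me: "\<And>g z. \<lbrakk>g \<in> generate G {k}; z \<in> carrier G\<rbrakk> \<Longrightarrow> b g z = m (z \<otimes> g) - m z + e g"
    using coboundary_mod_constE[OF assms] k stab_S by blast
  show "b k x = b k y"
    using me[OF gen x] me[OF gen y] left_invariant_stab[OF m x] left_invariant_stab[OF m y] k by simp
qed

lemma coboundary_S_if_vanishes_on_stab:
  "\<lbrakk>crossed_hom S b; \<And>x. x \<in> carrier G \<Longrightarrow> vanishes_on_stab b x\<rbrakk> \<Longrightarrow> coboundary_mod_const S b"
  by (rule coboundary_in_S_if_vanishes_on_stabilisers[OF S.subgroup_axioms])
    (auto simp: vanishes_on_stab_def)

lemma crossed_hom_stab_mult:
  assumes b: "crossed_hom S b" and x: "x \<in> carrier G" and k: "k \<in> stab x" and l: "l \<in> S"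
  shows "b (k \<otimes> l) x = b k x + b l x"
  using crossed_hom_mult[OF b stab_S[OF k] l x] left_invariant_stab[OF crossed_hom_left_invariant[OF b l] x k] by simp

lemma character_on_stab: "\<lbrakk>crossed_hom S b; x \<in> carrier G\<rbrakk> \<Longrightarrow> G.character (stab x) (\<lambda>k. b k x)"
  using crossed_hom_stab_mult stab_S unfolding G.character_def by blast

lemma crossed_hom_stab_nat_pow:
  "\<lbrakk>crossed_hom S b; x \<in> carrier G; k \<in> stab x\<rbrakk> \<Longrightarrow> b (k [^] (n::nat)) x = n \<cdot> b k x"
  using G.character_nat_pow[OF subgroup_stab character_on_stab] .

context
  fixes b :: "'a \<Rightarrow> 'a \<Rightarrow> 'b::ab_group_add" and x
  assumes b: "cocycle_mod_const S b" and const: "constant_on_fixed_points b"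
    and x: "x \<in> carrier G" and at_x: "\<And>s. s \<in> S \<Longrightarrow> b s x = 0"
begin

lemma normalised_mult:
  assumes "s \<in> S" "t \<in> S" "z \<in> carrier G"
  shows "b (s \<otimes> t) z = b s z + b t (z \<otimes> s) - b t (x \<otimes> s)"
  using trans[OF mult_defect_const[OF b assms] mult_defect_const[OF b assms(1,2) x, symmetric]] assms
  by (simp add: mult_defect_def at_x) (simp add: algebra_simps)

lemma normalised_stab:
  assumes k: "k \<in> stab x" and s: "s \<in> S"
  shows "b k (x \<otimes> s) = 0"
  using constant_on_fixed_pointsD[OF const _ x _ k, of "x \<otimes> s"] at_x[OF stab_S[OF k]] x k S_carrier[OF s]
  by (simp add: stab_mult_S[OF x s])

lemma normalised_left_stab:
  assumes "k \<in> stab x" "s \<in> S" "z \<in> carrier G"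
  shows "b (k \<otimes> s) z = b k z + b s (z \<otimes> k)"
  using normalised_mult[OF stab_S[OF assms(1)] assms(2,3)] at_x[OF assms(2)]
    left_invariant_stab[OF cocycle_mod_const_left_invariant[OF b assms(2)] x assms(1)] by simp

lemma normalised_translate:
  assumes k: "k \<in> stab x" and k': "k' \<in> stab x" and l: "l \<in> S" and l': "l' \<in> S"
  shows "b (k' \<otimes> l') (x \<otimes> (k \<otimes> l)) = b l' (x \<otimes> l)"
proof -
  note carr = x stab_carrier[OF k] stab_carrier[OF k'] S_carrier[OF l] S_carrier[OF l']
  note inv = cocycle_mod_const_left_invariant[OF b]
  have rcoset: "H #> (x \<otimes> (k'' \<otimes> l)) = H #> (x \<otimes> l)" if "k'' \<in> stab x" for k''
    using G.rcoset_mult_right_cong[OF subgroup_H _ x carr(4), of "x \<otimes> k''"] that carr(1,4) stab_carrier[OF that]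
      stab_iff_rcoset[OF x stab_S[OF that]] by (simp add: G.m_assoc)
  have "b (k' \<otimes> l') (x \<otimes> (k \<otimes> l)) = b (k' \<otimes> l') (x \<otimes> l)"
    by (rule left_invariant_rcoset[OF inv _ _ rcoset[OF k]]) (use carr k' l' stab_S in auto)
  also have "\<dots> = b l' (x \<otimes> (k' \<otimes> l))"
    using normalised_left_stab[OF k' l', of "x \<otimes> l"] normalised_stab[OF k' l] S_commute[OF l stab_S[OF k']] carr
    by (simp add: G.m_assoc)
  also have "\<dots> = b l' (x \<otimes> l)"
    by (rule left_invariant_rcoset[OF inv[OF l'] _ _ rcoset[OF k']]) (use carr in auto)
  finally show ?thesis .
qed

lemma normalised_cong:
  assumes y: "y \<in> carrier G" and k: "k \<in> stab x" "k' \<in> stab x" and l: "l \<in> stab y" "l' \<in> stab y"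
    and eq: "k \<otimes> l = k' \<otimes> l'"
  shows "b l y = b l' y"
proof -
  note carr = k[THEN stab_carrier] l[THEN stab_carrier]
  define z where "z = inv k' \<otimes> k"
  have zx: "z \<in> stab x" unfolding z_def using k stab_inv_closed[OF x] stab_m_closed[OF x] by blast
  have "inv k' \<otimes> (k \<otimes> l) = inv k' \<otimes> (k' \<otimes> l')" by (simp add: eq)
  then have zl: "l' = z \<otimes> l" using carr by (simp add: z_def G.word_simps)
  have "l' \<otimes> inv l \<in> stab y" using l stab_inv_closed[OF y] stab_m_closed[OF y] by blast
  then have zy: "z \<in> stab y" using carr by (simp add: zl z_def G.m_assoc)
  have "b z y = 0" using constant_on_fixed_pointsD[OF const y x zy zx] at_x[OF stab_S[OF zx]] by simp
  then show ?thesis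
    using normalised_left_stab[OF zx stab_S[OF l(1)] y]
      left_invariant_stab[OF cocycle_mod_const_left_invariant[OF b] y zy] stab_S[OF l(1)] by (simp add: zl)
qed

text \<open>
  As \<open>stab x\<close> and \<open>stab y\<close> generate \<open>S\<close>, the constants to be subtracted are forced: \<open>0\<close> on \<open>stab x\<close> and
  \<open>b l y\<close> on \<open>stab y\<close>.
\<close>

lemma normalised_splitE:
  assumes y: "y \<in> carrier G" and ne: "stab x \<noteq> stab y"
  obtains e where "crossed_hom S (\<lambda>s z. b s z - e s)" "\<forall>k\<in>stab x. e k = 0" "\<forall>l\<in>stab y. e l = b l y"
proof -
  have "\<exists>k l. k \<in> stab x \<and> l \<in> stab y \<and> s = k \<otimes> l" if "s \<in> stab x <#> stab y" for s
    using that by (auto simp: set_mult_def)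
  then obtain K L where KL: "\<And>s. s \<in> S \<Longrightarrow> K s \<in> stab x \<and> L s \<in> stab y \<and> s = K s \<otimes> L s"
    unfolding S_eq_stab_mult_stab[OF x y ne] by metis
  define e where "e s = b (L s) y" for s
  have e: "e (k \<otimes> l) = b l y" if "k \<in> stab x" "l \<in> stab y" for k l
    unfolding e_def
    by (rule normalised_cong[OF y _ that(1) _ that(2)]) (use KL[OF S.m_closed[OF that[THEN stab_S]]] in auto)
  have mult: "e (s \<otimes> t) = e s + e t - b t (x \<otimes> s)" if s: "s \<in> S" and t: "t \<in> S" for s t
  proof -
    define k l k' l' where "k = K s" and "l = L s" and "k' = K t" and "l' = L t"
    have kl: "k \<in> stab x" "l \<in> stab y" "k' \<in> stab x" "l' \<in> stab y" and st: "s = k \<otimes> l" "t = k' \<otimes> l'"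
      using KL[OF s] KL[OF t] by (simp_all add: k_def l_def k'_def l'_def)
    note carr = kl[THEN stab_carrier] and mem = kl[THEN stab_S]
    have "l \<otimes> (k' \<otimes> l') = k' \<otimes> (l \<otimes> l')" using S_commute[OF mem(2,3)] carr by (metis G.m_assoc)
    then have "s \<otimes> t = (k \<otimes> k') \<otimes> (l \<otimes> l')" using carr by (simp add: st G.m_assoc)
    then have "e (s \<otimes> t) = b (l \<otimes> l') y"
      using e[OF stab_m_closed[OF x kl(1,3)] stab_m_closed[OF y kl(2,4)]] by simp
    also have "\<dots> = b l y + b l' y - b l' (x \<otimes> l)"
      using normalised_mult[OF mem(2,4) y]
        left_invariant_stab[OF cocycle_mod_const_left_invariant[OF b mem(4)] y kl(2)] by simp
    finally show ?thesis
      using e[OF kl(1,2)] e[OF kl(3,4)] normalised_translate[OF kl(1,3) mem(2,4)] by (simp add: st)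
  qed
  show ?thesis
  proof (rule that[of e])
    show "crossed_hom S (\<lambda>s z. b s z - e s)"
      using cocycle_mod_const_left_invariant[OF b]
      by (simp add: crossed_hom_def left_invariant_def normalised_mult mult)
    show "\<forall>k\<in>stab x. e k = 0"
      using e[OF _ one_in_stab[OF y]] stab_carrier
        constant_on_fixed_pointsD[OF const y x one_in_stab[OF y] one_in_stab[OF x]] at_x[OF S.one_closed] by auto
    show "\<forall>l\<in>stab y. e l = b l y" using e[OF one_in_stab[OF x]] stab_carrier by auto
  qed
qed

end

lemma crossed_hom_representativeE:
  fixes b :: "'a \<Rightarrow> 'a \<Rightarrow> 'b::ab_group_add"
  assumes b: "cocycle_mod_const S b" and const: "constant_on_fixed_points b"
    and x: "x \<in> carrier G" and y: "y \<in> carrier G" and ne: "stab x \<noteq> stab y"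
  obtains e where "crossed_hom S (\<lambda>s z. b s z - e s)"
    "vanishes_on_stab (\<lambda>s z. b s z - e s) x" "vanishes_on_stab (\<lambda>s z. b s z - e s) y"
proof -
  let ?b = "\<lambda>s z. b s z - b s x"
  obtain e where e: "crossed_hom S (\<lambda>s z. ?b s z - e s)" "\<forall>k\<in>stab x. e k = 0" "\<forall>l\<in>stab y. e l = ?b l y"
    using normalised_splitE[OF cocycle_mod_const_diff[OF b cocycle_mod_const_const[of _ "\<lambda>s. b s x"]]
        constant_on_fixed_points_diff[OF const constant_on_fixed_points_const] x diff_self y ne] .
  show ?thesis
    by (rule that[of "\<lambda>s. b s x + e s"]) (use e in \<open>simp_all add: vanishes_on_stab_def diff_diff_eq\<close>)
qed

lemma vanishes_on_stab_propagate:
  assumes b: "crossed_hom S b" and const: "constant_on_fixed_points b"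
    and x: "x \<in> carrier G" "vanishes_on_stab b x" and y: "y \<in> carrier G" "vanishes_on_stab b y"
    and z: "z \<in> carrier G" and t: "t \<in> stab z" "t \<in> stab x" "t \<notin> stab y"
  shows "vanishes_on_stab b z"
  unfolding vanishes_on_stab_def
proof
  fix u assume u: "u \<in> stab z"
  obtain i where i: "u \<otimes> t [^] (i::nat) \<in> stab y"
    using stab_translateE[OF y(1) stab_S[OF t(1)] t(3) stab_S[OF u]] .
  note ti = stab_nat_pow_closed[OF z t(1)]
  have "b (u \<otimes> t [^] i) z = 0"
    using constant_on_fixed_pointsD[OF const z y(1) stab_m_closed[OF z u ti] i] y(2) i
    by (simp add: vanishes_on_stab_def)
  moreover have "b t z = 0"
    using constant_on_fixed_pointsD[OF const z x(1) t(1,2)] x(2) t(2) by (simp add: vanishes_on_stab_def)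
  ultimately show "b u z = 0"
    using crossed_hom_stab_mult[OF b z u stab_S[OF ti]] crossed_hom_stab_nat_pow[OF b z t(1)] by simp
qed

lemma vanishes_on_all_stab:
  assumes b: "crossed_hom S b" and const: "constant_on_fixed_points b"
    and x: "x \<in> carrier G" "vanishes_on_stab b x" and y: "y \<in> carrier G" "vanishes_on_stab b y"
    and ne: "stab x \<noteq> stab y" and w: "w \<in> stab x" "w \<in> stab y" "w \<noteq> \<one>" and z: "z \<in> carrier G"
  shows "vanishes_on_stab b z"
proof -
  have outside: "vanishes_on_stab b z" if z: "z \<in> carrier G" and wz: "w \<notin> stab z" for z
  proof -
    obtain v where v: "v \<in> stab x" "v \<notin> stab y" using stab_not_subsetE[OF x(1) y(1) ne] .
    obtain i where i: "v \<otimes> w [^] (i::nat) \<in> stab z" using stab_translateE[OF z stab_S[OF w(1)] wz stab_S[OF v(1)]] .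
    have "v \<otimes> w [^] i \<notin> stab y"
    proof
      assume "v \<otimes> w [^] i \<in> stab y"
      then have "v \<otimes> w [^] i \<otimes> inv (w [^] i) \<in> stab y"
        using w(2) stab_nat_pow_closed stab_inv_closed stab_m_closed y(1) by blast
      then show False using v stab_carrier[OF v(1)] stab_carrier[OF w(1)] by (simp add: G.m_assoc)
    qed
    moreover have "v \<otimes> w [^] i \<in> stab x" using stab_m_closed[OF x(1) v(1) stab_nat_pow_closed[OF x(1) w(1)]] .
    ultimately show ?thesis using vanishes_on_stab_propagate[OF b const x y z i] by blast
  qed
  show ?thesis
  proof (cases "w \<in> stab z")
    case True
    obtain u where u: "u \<in> carrier G" "w \<notin> stab u" using in_all_stab[OF stab_S[OF w(1)]] w(3) by blast
    show ?thesis by (rule vanishes_on_stab_propagate[OF b const x u(1) outside[OF u] z True w(1) u(2)])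
  qed (rule outside[OF z])
qed

theorem card_S_if_nontrivial_on_S:
  assumes b: "cocycle_mod_const S b" and triv: "\<And>g. g \<in> S \<Longrightarrow> coboundary_mod_const (generate G {g}) b"
    and nontriv: "\<not> coboundary_mod_const S b"
  shows "card S = p\<^sup>2"
proof (rule ccontr)
  assume not_square: "card S \<noteq> p\<^sup>2"
  have "card S \<noteq> p"
  proof
    assume card: "card S = p"
    then have "S \<noteq> {\<one>}" using prime_gt_1_nat[OF prime_p] by auto
    then obtain g where g: "g \<in> S" "g \<noteq> \<one>" using S.one_closed by blast
    show False
      using triv[OF g(1)] nontriv G.prime_order_subgroup_eq_generate[OF S.subgroup_axioms _ g] card prime_p by simp
  qed
  then obtain y where y: "y \<in> carrier G" "stab \<one> \<noteq> stab y" using exists_other_stab by metis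
  then obtain w where w: "w \<in> stab \<one>" "w \<in> stab y" "w \<noteq> \<one>"
    using card_S_if_disjoint[OF G.one_closed y(1)] not_square one_in_stab by blast
  have const: "constant_on_fixed_points b" using constant_on_fixed_points_if_locally_trivial[OF triv] .
  obtain e where e: "crossed_hom S (\<lambda>s z. b s z - e s)"
    "vanishes_on_stab (\<lambda>s z. b s z - e s) \<one>" "vanishes_on_stab (\<lambda>s z. b s z - e s) y"
    using crossed_hom_representativeE[OF b const G.one_closed y] .
  note const_e = constant_on_fixed_points_diff[OF const constant_on_fixed_points_const]
  have "coboundary_mod_const S (\<lambda>s z. b s z - e s)"
    by (rule coboundary_S_if_vanishes_on_stab[OF e(1)
          vanishes_on_all_stab[OF e(1) const_e G.one_closed e(2) y(1) e(3) y(2) w]])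
  then show False using nontriv by (simp add: coboundary_mod_const_diff_const_iff)
qed

end

section \<open>Invariant cocycles\<close>

context core_free_sylow
begin

lemma character_S_torsion:
  assumes "G.character S \<chi>" "k \<in> S"
  shows "p \<cdot> \<chi> k = 0"
  using G.character_nat_pow[OF S.subgroup_axioms assms, of p] G.character_one[OF S.subgroup_axioms assms(1)]
    S_nat_pow_p[OF assms(2)] by simp

definition conj_defect :: "('a \<Rightarrow> 'a \<Rightarrow> 'b::ab_group_add) \<Rightarrow> 'a \<Rightarrow> 'a \<Rightarrow> 'b" where
  "conj_defect b g k = b (inv g \<otimes> k \<otimes> g) g - b k \<one> - (b g k - b g \<one>)"

lemma crossed_hom_conj:
  assumes b: "crossed_hom S b" and g: "g \<in> carrier G"
  shows "crossed_hom S (\<lambda>k x. b (inv g \<otimes> k \<otimes> g) (x \<otimes> g))"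
  unfolding crossed_hom_def
proof (intro conjI ballI)
  fix k assume k: "k \<in> S"
  show "left_invariant (\<lambda>x. b (inv g \<otimes> k \<otimes> g) (x \<otimes> g))"
    by (rule left_invariant_translate[OF crossed_hom_left_invariant[OF b S.inv_op_closed1[OF g k]] g])
  fix l x assume l: "l \<in> S" and x: "x \<in> carrier G"
  note carr = S_carrier[OF k] S_carrier[OF l]
  have "inv g \<otimes> (k \<otimes> l) \<otimes> g = (inv g \<otimes> k \<otimes> g) \<otimes> (inv g \<otimes> l \<otimes> g)"
    and "x \<otimes> g \<otimes> (inv g \<otimes> k \<otimes> g) = x \<otimes> k \<otimes> g"
    using g x carr by (simp_all add: G.word_simps)
  then show "b (inv g \<otimes> (k \<otimes> l) \<otimes> g) (x \<otimes> g)
      = b (inv g \<otimes> k \<otimes> g) (x \<otimes> g) + b (inv g \<otimes> l \<otimes> g) (x \<otimes> k \<otimes> g)"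
    using crossed_hom_mult[OF b S.inv_op_closed1[OF g k] S.inv_op_closed1[OF g l], of "x \<otimes> g"] g x by simp
qed

context
  fixes b :: "'a \<Rightarrow> 'a \<Rightarrow> 'b::ab_group_add"
  assumes b: "cocycle_mod_const (carrier G) b" and b_S: "crossed_hom S b"
begin

lemma conj_defect_eq:
  assumes g: "g \<in> carrier G" and k: "k \<in> carrier G" and x: "x \<in> carrier G"
  shows "b (inv g \<otimes> k \<otimes> g) (x \<otimes> g) - b k x - (b g (x \<otimes> k) - b g x) = conj_defect b g k"
proof -
  let ?k = "inv g \<otimes> k \<otimes> g"
  have k': "?k \<in> carrier G" and comm: "g \<otimes> ?k = k \<otimes> g" using g k by (simp_all add: G.word_simps)
  have "b ?k (y \<otimes> g) - b k y - (b g (y \<otimes> k) - b g y) = mult_defect b g ?k y - mult_defect b k g y" for y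
    by (simp add: mult_defect_def comm)
  from this[of x] this[of \<one>] show ?thesis
    using mult_defect_const[OF b g k' x] mult_defect_const[OF b k g x] g k by (simp add: conj_defect_def)
qed

lemma character_conj_defect:
  assumes g: "g \<in> carrier G"
  shows "G.character S (conj_defect b g)"
proof (rule character_if_crossed_hom_const[OF _ _ S.subgroup_axioms])
  have inv: "left_invariant (b g)" by (rule cocycle_mod_const_left_invariant[OF b g])
  show "crossed_hom S (\<lambda>k x. b (inv g \<otimes> k \<otimes> g) (x \<otimes> g) - b k x - (b g (x \<otimes> k) - b g x))"
    by (rule crossed_hom_diff[OF crossed_hom_diff[OF crossed_hom_conj[OF b_S g] b_S]
          crossed_hom_coboundary[OF inv S.subset]])
qed (use conj_defect_eq g S_carrier in blast)

lemma conj_defect_mult: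
  assumes g: "g \<in> carrier G" and h: "h \<in> carrier G" and k: "k \<in> S"
  shows "conj_defect b (g \<otimes> h) k = conj_defect b g k + conj_defect b h (inv g \<otimes> k \<otimes> g)"
proof -
  note carr = g h S_carrier[OF k]
  let ?k = "inv g \<otimes> k \<otimes> g"
  have "b (g \<otimes> h) k - b (g \<otimes> h) \<one> = b g k - b g \<one> + (b h (k \<otimes> g) - b h g)"
    using cocycle_mod_const_mult[OF b g h carr(3)] cocycle_mod_const_mult[OF b g h G.one_closed] carr by simp
  moreover have "conj_defect b h ?k = b (inv h \<otimes> ?k \<otimes> h) (g \<otimes> h) - b ?k g - (b h (k \<otimes> g) - b h g)"
    using conj_defect_eq[OF h _ g, of ?k] carr by (simp add: G.word_simps)
  ultimately show ?thesis
    using carr by (simp add: conj_defect_def G.word_simps)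
qed

lemma conj_defect_S:
  assumes s: "s \<in> S" and k: "k \<in> S"
  shows "conj_defect b s k = 0"
  using crossed_hom_mult[OF b_S s k G.one_closed] crossed_hom_mult[OF b_S k s G.one_closed]
    S_commute[OF s k] S_carrier[OF s] S_carrier[OF k]
  by (simp add: conj_defect_def S_conj_eq[OF s k]) (simp add: algebra_simps)

lemma conj_defect_trivialE:
  obtains \<theta> where "G.character S \<theta>"
    "\<forall>g\<in>carrier G. \<forall>k\<in>S. conj_defect b g k = \<theta> (inv g \<otimes> k \<otimes> g) - \<theta> k"
proof -
  let ?C = "cosets_in G S (carrier G)"
  define w where "w k = (\<Sum>C\<in>?C. conj_defect b (inv (coset_rep C)) k)" for k
  have rep: "inv (coset_rep C) \<in> carrier G" if "C \<in> ?C" for C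
    using G.cosets_in_rep(1)[OF S.subgroup_axioms G.subgroup_self S.subset that] by blast
  have w: "G.character S w"
    using character_conj_defect[OF rep] by (simp add: w_def G.character_def sum.distrib)
  have average: "card ?C \<cdot> conj_defect b g k = w k - w (inv g \<otimes> k \<otimes> g)" if g: "g \<in> carrier G" and k: "k \<in> S" for g k
  proof -
    have "card ?C \<cdot> conj_defect b g k = w k - w (inv g \<otimes> k \<otimes> g) + w (inv g \<otimes> \<one> \<otimes> g)"
      unfolding w_def
    proof (rule G.crossed_hom_average[OF S.subgroup_axioms G.subgroup_self S.subset _ S.one_closed _ _ g k])
      fix g h i assume "g \<in> carrier G" "h \<in> carrier G" "i \<in> S"
      then show "conj_defect b (g \<otimes> h) i
          = conj_defect b g i + conj_defect b h (inv g \<otimes> i \<otimes> g) - conj_defect b h (inv g \<otimes> \<one> \<otimes> g)"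
        using G.character_one[OF S.subgroup_axioms character_conj_defect] by (simp add: conj_defect_mult)
    qed (auto simp: conj_defect_S intro: S.inv_op_closed1)
    then show ?thesis using G.character_one[OF S.subgroup_axioms w] g by simp
  qed
  have "S \<inter> carrier G = S" using S.subset by blast
  then have "coprime (card ?C) p" "0 < card ?C" using coprime_card_cosets_in_S_Int[OF G.subgroup_self] by simp_all
  then obtain u where u: "\<And>a::'b. p \<cdot> a = 0 \<Longrightarrow> u \<cdot> card ?C \<cdot> a = a"
    using ntimes_coprime_left_inverse by metis
  show ?thesis
  proof (rule that[of "\<lambda>k. - (u \<cdot> w k)"])
    show "G.character S (\<lambda>k. - (u \<cdot> w k))" using G.character_ntimes[OF w] by (simp add: G.character_def)
    show "\<forall>g\<in>carrier G. \<forall>k\<in>S. conj_defect b g k = - (u \<cdot> w (inv g \<otimes> k \<otimes> g)) - - (u \<cdot> w k)"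
    proof (intro ballI)
      fix g k assume gk: "g \<in> carrier G" "k \<in> S"
      have "conj_defect b g k = u \<cdot> card ?C \<cdot> conj_defect b g k"
        by (rule u[OF character_S_torsion[OF character_conj_defect[OF gk(1)] gk(2)], symmetric])
      then show "conj_defect b g k = - (u \<cdot> w (inv g \<otimes> k \<otimes> g)) - - (u \<cdot> w k)"
        unfolding average[OF gk] by (simp add: ntimes_diff_right)
    qed
  qed
qed

end

definition invariant_crossed_hom :: "('a \<Rightarrow> 'a \<Rightarrow> 'b::ab_group_add) \<Rightarrow> bool" where
  "invariant_crossed_hom b \<longleftrightarrow> crossed_hom S b \<and> constant_on_fixed_points b \<and>
     (\<forall>x\<in>carrier G. \<forall>g\<in>carrier G. \<forall>k\<in>stab x. b (inv g \<otimes> k \<otimes> g) (x \<otimes> g) = b k x)"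

lemma invariant_crossed_homD:
  assumes "invariant_crossed_hom b"
  shows "crossed_hom S b" "constant_on_fixed_points b"
    "\<lbrakk>x \<in> carrier G; g \<in> carrier G; k \<in> stab x\<rbrakk> \<Longrightarrow> b (inv g \<otimes> k \<otimes> g) (x \<otimes> g) = b k x"
  using assms unfolding invariant_crossed_hom_def by auto

lemma invariant_crossed_hom_diff:
  assumes "invariant_crossed_hom b" "invariant_crossed_hom c"
  shows "invariant_crossed_hom (\<lambda>g x. b g x - c g x)"
  using assms by (auto simp: invariant_crossed_hom_def intro: crossed_hom_diff constant_on_fixed_points_diff)

lemma invariant_crossed_hom_ntimes:
  "invariant_crossed_hom b \<Longrightarrow> invariant_crossed_hom (\<lambda>g x. n \<cdot> b g x)"
  unfolding invariant_crossed_hom_def constant_on_fixed_points_def using crossed_hom_ntimes by metis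

lemma invariant_crossed_hom_diff_character:
  assumes "invariant_crossed_hom b" "G.character S \<theta>"
    and "\<And>g s. \<lbrakk>g \<in> carrier G; s \<in> S\<rbrakk> \<Longrightarrow> \<theta> (inv g \<otimes> s \<otimes> g) = \<theta> s"
  shows "invariant_crossed_hom (\<lambda>g x. b g x - \<theta> g)"
  using assms by (auto simp: invariant_crossed_hom_def stab_S
      intro: crossed_hom_diff_character constant_on_fixed_points_diff[OF _ constant_on_fixed_points_const])

lemma invariant_representativeE:
  fixes b :: "'a \<Rightarrow> 'a \<Rightarrow> 'b::ab_group_add"
  assumes b: "cocycle_mod_const (carrier G) b"
    and triv: "\<And>g. g \<in> S \<Longrightarrow> coboundary_mod_const (generate G {g}) b" and not_prime: "card S \<noteq> p"
  obtains e where "invariant_crossed_hom (\<lambda>g z. b g z - e g)"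
proof -
  obtain y where y: "y \<in> carrier G" "stab \<one> \<noteq> stab y" using exists_other_stab[OF not_prime] by metis
  have const: "constant_on_fixed_points b" using constant_on_fixed_points_if_locally_trivial[OF triv] .
  obtain e where e: "crossed_hom S (\<lambda>s z. b s z - e s)"
    using crossed_hom_representativeE[OF cocycle_mod_const_subset[OF b S.subset] const G.one_closed y] .
  let ?b = "\<lambda>g z. b g z - e g"
  have b': "cocycle_mod_const (carrier G) ?b" by (rule cocycle_mod_const_diff[OF b cocycle_mod_const_const])
  obtain \<theta> where \<theta>: "G.character S \<theta>"
    "\<forall>g\<in>carrier G. \<forall>k\<in>S. conj_defect ?b g k = \<theta> (inv g \<otimes> k \<otimes> g) - \<theta> k"
    using conj_defect_trivialE[OF b' e] .
  have "?b (inv g \<otimes> k \<otimes> g) (x \<otimes> g) - \<theta> (inv g \<otimes> k \<otimes> g) = ?b k x - \<theta> k"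
    if "x \<in> carrier G" "g \<in> carrier G" "k \<in> stab x" for x g k
  proof -
    have "?b g (x \<otimes> k) = ?b g x"
      by (rule left_invariant_stab[OF cocycle_mod_const_left_invariant[OF b' that(2)] that(1,3)])
    then show ?thesis
      using conj_defect_eq[OF b' e that(2) stab_carrier[OF that(3)] that(1)] \<theta>(2) that stab_S[OF that(3)]
      by (simp add: algebra_simps)
  qed
  then have "invariant_crossed_hom (\<lambda>g z. b g z - (e g + \<theta> g))"
    using crossed_hom_diff_character[OF e \<theta>(1)] constant_on_fixed_points_diff[OF const constant_on_fixed_points_const]
    by (simp add: invariant_crossed_hom_def diff_diff_eq)
  then show ?thesis by (rule that)
qed

lemma coboundary_S_if_invariant:
  assumes b: "invariant_crossed_hom b" and one: "vanishes_on_stab b \<one>"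
  shows "coboundary_mod_const S b"
proof (rule coboundary_S_if_vanishes_on_stab[OF invariant_crossed_homD(1)[OF b]])
  fix x assume x: "x \<in> carrier G"
  show "vanishes_on_stab b x"
    unfolding vanishes_on_stab_def
  proof
    fix k assume k: "k \<in> stab x"
    let ?k = "x \<otimes> k \<otimes> inv x"
    have "?k \<in> stab \<one>"
      using k S.inv_op_closed2[OF x stab_S[OF k]] by (simp add: stab_one) (simp add: stab_def)
    then have "b (inv x \<otimes> ?k \<otimes> x) (\<one> \<otimes> x) = 0"
      using invariant_crossed_homD(3)[OF b G.one_closed x] one by (simp add: vanishes_on_stab_def)
    then show "b k x = 0" using x stab_carrier[OF k] by (simp add: G.word_simps)
  qed
qed

lemma crossed_hom_stab_torsion:
  assumes "crossed_hom S b" "x \<in> carrier G" "k \<in> stab x"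
  shows "p \<cdot> b k x = 0"
  using crossed_hom_stab_nat_pow[OF assms, of p] S_nat_pow_p[OF stab_S[OF assms(3)]]
    G.character_one[OF subgroup_stab character_on_stab, OF assms(2,1,2)] by simp

context
  assumes card_S: "card S = p\<^sup>2"
begin

lemma card_S_neq_p: "card S \<noteq> p"
  using card_S prime_gt_1_nat[OF prime_p] by (simp add: power2_eq_square)

lemma card_stab_eq_p: "x \<in> carrier G \<Longrightarrow> card (stab x) = p"
  using stab_index[of x] card_S prime_gt_0_nat[OF prime_p] by (simp add: power2_eq_square)

lemma prime_card_stab: "x \<in> carrier G \<Longrightarrow> prime (card (stab x))"
  using card_stab_eq_p prime_p by simp

lemma S_subset_if_meets_stab:
  assumes D: "subgroup D G" and x: "x \<in> carrier G" and k: "k \<in> stab x" "k \<in> D" "k \<noteq> \<one>"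
    and t: "t \<in> S" "t \<in> D" "t \<notin> stab x"
  shows "S \<subseteq> D"
proof
  fix s assume s: "s \<in> S"
  have "stab x \<subseteq> D"
    using G.prime_order_subgroup_eq_generate[OF subgroup_stab[OF x] prime_card_stab[OF x] k(1,3)]
      G.generate_singleton_subset[OF D k(2)] by simp
  moreover obtain i where i: "s \<otimes> t [^] (i::nat) \<in> stab x" using stab_translateE[OF x t(1,3) s] .
  ultimately have "s \<otimes> t [^] i \<otimes> inv (t [^] i) \<in> D"
    using subgroup.m_closed[OF D] subgroup.m_inv_closed[OF D] G.subgroup_nat_pow_closed[OF D t(2)] by blast
  then show "s \<in> D" using S_carrier[OF s] S_carrier[OF t(1)] by (simp add: G.m_assoc)
qed

lemma vanishes_on_stab_if_vanishes:
  assumes b: "crossed_hom S b" and x: "x \<in> carrier G" and k: "k \<in> stab x" "k \<noteq> \<one>" "b k x = 0"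
  shows "vanishes_on_stab b x"
  unfolding vanishes_on_stab_def
proof
  fix l assume "l \<in> stab x"
  then obtain i where "l = k [^] (i::nat)"
    using G.prime_order_subgroup_nat_pow[OF subgroup_stab[OF x] prime_card_stab[OF x] k(1,2)] by blast
  then show "b l x = 0" using crossed_hom_stab_nat_pow[OF b x k(1)] k(3) by simp
qed

lemma normalizer_eq_if_nontrivial:
  assumes b: "invariant_crossed_hom b" and nontriv: "\<not> coboundary_mod_const S b"
  shows "normalizer G (S \<inter> H) = centralizer G (S \<inter> H)"
proof (rule ccontr)
  note one = G.one_closed
  have K: "subgroup (stab \<one>) G" "finite (stab \<one>)"
    using subgroup_stab[OF one] finite_subset[OF stab_subset finite_S] by auto
  assume "normalizer G (S \<inter> H) \<noteq> centralizer G (S \<inter> H)"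
  then obtain g where "g \<in> normalizer G (stab \<one>)" "g \<notin> centralizer G (stab \<one>)"
    using G.centralizer_subset_normalizer[OF K] unfolding stab_one by blast
  then obtain k where g: "g \<in> carrier G" and normal: "\<forall>k\<in>stab \<one>. g \<otimes> k \<otimes> inv g \<in> stab \<one>"
    and k: "k \<in> stab \<one>" "g \<otimes> k \<noteq> k \<otimes> g"
    by (auto simp: G.normalizer_iff[OF K] centralizer_def)
  let ?l = "g \<otimes> k \<otimes> inv g"
  note kG = stab_carrier[OF k(1)] and cross = invariant_crossed_homD(1)[OF b]
  have l: "?l \<in> stab \<one>" and k_ne: "k \<noteq> \<one>" and l_ne: "?l \<noteq> k"
    using normal k g G.conj_eq_iff(1)[OF g kG kG] by auto
  have "k \<in> stab g" using l stab_S[OF k(1)] by (simp add: stab_one) (simp add: stab_def)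
  have "b ?l \<one> = b (inv g \<otimes> ?l \<otimes> g) (\<one> \<otimes> g)" by (rule invariant_crossed_homD(3)[OF b one g l, symmetric])
  also have "\<dots> = b k g" using g kG by (simp add: G.word_simps)
  also have "\<dots> = b k \<one>"
    by (rule constant_on_fixed_pointsD[OF invariant_crossed_homD(2)[OF b] g one \<open>k \<in> stab g\<close> k(1)])
  finally have same: "b ?l \<one> = b k \<one>" .
  obtain i where i: "?l = k [^] (i::nat)" "i < p"
    using G.prime_order_subgroup_nat_pow[OF K(1) prime_card_stab[OF one] k(1) k_ne l] card_stab_eq_p[OF one] by metis
  have multiple: "i \<cdot> b k \<one> = b k \<one>" using crossed_hom_stab_nat_pow[OF cross one k(1), of i] same i(1) by simp
  have "b k \<one> = 0"
  proof (cases i)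
    case (Suc j)
    then have "j \<noteq> 0" using l_ne i(1) kG by (intro notI) simp
    then have "coprime j p" using i(2) Suc prime_p prime_imp_coprime
      by (metis Suc_lessD coprime_commute dvd_imp_le gr0I linorder_not_less)
    moreover have "j \<cdot> b k \<one> = 0" using multiple Suc by simp
    ultimately show ?thesis using ntimes_coprime_zero crossed_hom_stab_torsion[OF cross one k(1)] by blast
  qed (use multiple in simp)
  then have "vanishes_on_stab b \<one>" by (rule vanishes_on_stab_if_vanishes[OF cross one k(1) k_ne])
  then show False using coboundary_S_if_invariant[OF b] nontriv by blast
qed

abbreviation commutators :: "'a set" where "commutators \<equiv> commutator_subgroup G S (carrier G)"

lemma commutators_not_subset_stab: "\<not> commutators \<subseteq> stab \<one>"
proof
  assume sub: "commutators \<subseteq> stab \<one>"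
  obtain y where y: "y \<in> carrier G" "stab \<one> \<noteq> stab y" using exists_other_stab[OF card_S_neq_p] by metis
  obtain k where k: "k \<in> stab \<one>" "k \<notin> stab y" using stab_not_subsetE[OF G.one_closed y] .
  have "inv k \<otimes> (k \<otimes> y \<otimes> inv k \<otimes> inv y) \<in> stab \<one>"
    using S.commutator_mem[OF stab_S[OF k(1)] y(1)] sub stab_inv_closed k(1) stab_m_closed G.one_closed by blast
  then have "y \<otimes> inv k \<otimes> inv y \<in> H" using y(1) stab_carrier[OF k(1)] by (simp add: stab_one G.word_simps)
  then have "inv k \<in> stab y" using S.m_inv_closed[OF stab_S[OF k(1)]] by (simp add: stab_def)
  then show False using stab_inv_closed[OF y(1)] k stab_carrier by fastforce
qed

lemma commutators_complement:
  assumes neq: "commutators \<noteq> S"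
  shows "stab \<one> \<inter> commutators = {\<one>}" "stab \<one> <#> commutators = S"
proof -
  note C = S.subgroup_commutator_subgroup and one = G.one_closed
  obtain t where t: "t \<in> commutators" "t \<notin> stab \<one>" using commutators_not_subset_stab by blast
  have tS: "t \<in> S" using t S.commutator_subgroup_subset by blast
  show "stab \<one> \<inter> commutators = {\<one>}"
    using S_subset_if_meets_stab[OF C one _ _ _ tS t] neq S.commutator_subgroup_subset
      one_in_stab[OF one] subgroup.one_closed[OF C] by blast
  show "stab \<one> <#> commutators = S"
  proof (intro equalityI subsetI)
    fix s assume s: "s \<in> S"
    obtain i where i: "s \<otimes> t [^] (i::nat) \<in> stab \<one>" using stab_translateE[OF one tS t(2) s] .
    have "inv (t [^] i) \<in> commutators"
      using G.subgroup_nat_pow_closed[OF C t(1)] subgroup.m_inv_closed[OF C] by blast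
    then have "s \<otimes> t [^] i \<otimes> inv (t [^] i) \<in> stab \<one> <#> commutators" using i unfolding set_mult_def by blast
    then show "s \<in> stab \<one> <#> commutators" using S_carrier[OF s] S_carrier[OF tS] by (simp add: G.m_assoc)
  qed (use S.commutator_subgroup_subset stab_S in \<open>auto simp: set_mult_def\<close>)
qed

lemma commutators_eq_S_if_nontrivial:
  assumes b: "invariant_crossed_hom b" and nontriv: "\<not> coboundary_mod_const S b"
  shows "commutators = S"
proof (rule ccontr)
  assume "commutators \<noteq> S"
  note complement = commutators_complement[OF this]
  note C = S.subgroup_commutator_subgroup and CS = S.commutator_subgroup_subset and one = G.one_closed
  have commute: "c \<otimes> k = k \<otimes> c" if "k \<in> stab \<one>" "c \<in> commutators" for k c
    using S_commute that CS stab_S by blast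
  obtain \<theta> where \<theta>: "G.character S \<theta>" "\<And>k c. \<lbrakk>k \<in> stab \<one>; c \<in> commutators\<rbrakk> \<Longrightarrow> \<theta> (k \<otimes> c) = b k \<one>"
    using G.character_extend_over_complement[OF subgroup_stab[OF one] C complement(1) commute
        character_on_stab[OF invariant_crossed_homD(1)[OF b] one]] unfolding complement(2) by blast
  have "\<theta> (inv g \<otimes> s \<otimes> g) = \<theta> s" if g: "g \<in> carrier G" and s: "s \<in> S" for g s
  proof -
    obtain k c where kc: "k \<in> stab \<one>" "c \<in> commutators" "s = k \<otimes> c"
      using s complement(2) unfolding set_mult_def by blast
    define d where "d = inv s \<otimes> (inv g \<otimes> s \<otimes> g)"
    have d: "d \<in> commutators" unfolding d_def by (rule S.inv_mult_conj_in_commutator_subgroup[OF s g])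
    have "inv g \<otimes> s \<otimes> g = s \<otimes> d" using g S_carrier[OF s] by (simp add: d_def G.word_simps)
    also have "\<dots> = k \<otimes> (c \<otimes> d)"
      using kc d CS S_carrier stab_carrier by (simp add: G.m_assoc subset_iff)
    finally show ?thesis using \<theta>(2)[OF kc(1) subgroup.m_closed[OF C kc(2) d]] \<theta>(2)[OF kc(1,2)] kc(3) by simp
  qed
  note inv = invariant_crossed_hom_diff_character[OF b \<theta>(1) this]
  have "vanishes_on_stab (\<lambda>g x. b g x - \<theta> g) \<one>"
    unfolding vanishes_on_stab_def using \<theta>(2)[OF _ subgroup.one_closed[OF C]] stab_carrier by auto
  from coboundary_S_if_invariant[OF inv this] show False
    using nontriv by (simp add: coboundary_mod_const_diff_const_iff)
qed

end

theorem conditions_if_nontrivial_on_S: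
  fixes b :: "'a \<Rightarrow> 'a \<Rightarrow> 'b::ab_group_add"
  assumes b: "cocycle_mod_const (carrier G) b"
    and triv: "\<And>g. g \<in> S \<Longrightarrow> coboundary_mod_const (generate G {g}) b"
    and nontriv: "\<not> coboundary_mod_const S b"
  shows "card S = p\<^sup>2" "commutator_subgroup G S (carrier G) = S"
    "normalizer G (S \<inter> H) = centralizer G (S \<inter> H)"
proof -
  show card: "card S = p\<^sup>2"
    by (rule card_S_if_nontrivial_on_S[OF cocycle_mod_const_subset[OF b S.subset] triv nontriv])
  obtain e where inv: "invariant_crossed_hom (\<lambda>g z. b g z - e g)"
    using invariant_representativeE[OF b triv card_S_neq_p[OF card]] .
  have "\<not> coboundary_mod_const S (\<lambda>g z. b g z - e g)" using nontriv by (simp add: coboundary_mod_const_diff_const_iff)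
  then show "commutator_subgroup G S (carrier G) = S" "normalizer G (S \<inter> H) = centralizer G (S \<inter> H)"
    using commutators_eq_S_if_nontrivial[OF card inv] normalizer_eq_if_nontrivial[OF card inv] by simp_all
qed

lemma multiple_of_invariantE:
  fixes b c :: "'a \<Rightarrow> 'a \<Rightarrow> circle"
  assumes card: "card S = p\<^sup>2" and b: "cocycle_mod_const (carrier G) b"
    and triv: "\<And>g. g \<in> S \<Longrightarrow> coboundary_mod_const (generate G {g}) b"
    and c: "invariant_crossed_hom c" and k: "k \<in> stab \<one>" "c k \<one> \<noteq> 0"
  obtains j where "coboundary_mod_const S (\<lambda>g z. b g z - j \<cdot> c g z)"
proof -
  note one = G.one_closed
  obtain e where inv: "invariant_crossed_hom (\<lambda>g z. b g z - e g)"
    using invariant_representativeE[OF b triv card_S_neq_p[OF card]] .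
  note torsion = crossed_hom_stab_torsion[OF invariant_crossed_homD(1) one k(1)]
  obtain j where j: "b k \<one> - e k = j \<cdot> c k \<one>"
    using circle_prime_torsion_multiple[OF prime_p torsion[OF c] k(2) torsion[OF inv]] .
  have "k \<noteq> \<one>"
    using k(2) G.character_one[OF subgroup_stab[OF one] character_on_stab[OF invariant_crossed_homD(1)[OF c] one]]
    by auto
  note diff = invariant_crossed_hom_diff[OF inv invariant_crossed_hom_ntimes[OF c]]
  have "vanishes_on_stab (\<lambda>g z. b g z - e g - j \<cdot> c g z) \<one>"
    by (rule vanishes_on_stab_if_vanishes[OF card invariant_crossed_homD(1)[OF diff] one k(1) \<open>k \<noteq> \<one>\<close>]) (simp add: j)
  from coboundary_S_if_invariant[OF diff this]
  have "coboundary_mod_const S (\<lambda>g z. (b g z - j \<cdot> c g z) - e g)" by (simp add: algebra_simps)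
  then show ?thesis using that by (simp add: coboundary_mod_const_diff_const_iff)
qed

end

section \<open>A nontrivial class by transfer\<close>

context normal_sylow
begin

definition induced :: "('a \<Rightarrow> 'b::ab_group_add) \<Rightarrow> 'a \<Rightarrow> 'a \<Rightarrow> 'b" where
  "induced \<chi> g x = \<chi> (G.retract H (x \<otimes> g)) - \<chi> (G.retract H x)"

lemma character_retract:
  "\<lbrakk>G.character H \<chi>; h \<in> H; x \<in> carrier G\<rbrakk> \<Longrightarrow> \<chi> (G.retract H (h \<otimes> x)) = \<chi> h + \<chi> (G.retract H x)"
  by (simp add: G.retract_mult[OF subgroup_H] G.retract_mem[OF subgroup_H] G.characterD)

lemma crossed_hom_induced:
  assumes \<chi>: "G.character H \<chi>"
  shows "crossed_hom (carrier G) (induced \<chi>)"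
  unfolding crossed_hom_def
proof (intro conjI ballI)
  show "left_invariant (induced \<chi> g)" if "g \<in> carrier G" for g
    using that H_carrier by (simp add: left_invariant_def induced_def G.m_assoc character_retract[OF \<chi>])
qed (simp add: induced_def G.m_assoc)

lemma induced_stab:
  assumes "G.character H \<chi>" "x \<in> carrier G" "k \<in> stab x"
  shows "induced \<chi> k x = \<chi> (x \<otimes> k \<otimes> inv x)"
proof -
  have "x \<otimes> k = (x \<otimes> k \<otimes> inv x) \<otimes> x" using assms(2) stab_carrier[OF assms(3)] by (simp add: G.m_assoc)
  then show ?thesis
    using character_retract[OF assms(1) _ assms(2), of "x \<otimes> k \<otimes> inv x"] assms(3)
    by (simp add: induced_def stab_def)
qed

end

context core_free_sylow
begin

context
  assumes normalizer: "normalizer G (S \<inter> H) = centralizer G (S \<inter> H)"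
begin

lemma in_centralizer_if_normalizes:
  assumes "g \<in> carrier G" "\<And>k. k \<in> stab \<one> \<Longrightarrow> g \<otimes> k \<otimes> inv g \<in> stab \<one>" and "k \<in> stab \<one>"
  shows "g \<otimes> k = k \<otimes> g"
proof -
  have "g \<in> normalizer G (stab \<one>)"
    using assms G.normalizer_iff[OF subgroup_stab[OF G.one_closed] finite_subset[OF stab_subset finite_S]] by blast
  then show ?thesis using normalizer assms(3) by (simp add: stab_one centralizer_def)
qed

lemma H_commute_stab_one:
  assumes h: "h \<in> H" and k: "k \<in> stab \<one>"
  shows "h \<otimes> k = k \<otimes> h"
proof (rule in_centralizer_if_normalizes[OF H_carrier[OF h] _ k])
  show "h \<otimes> l \<otimes> inv h \<in> stab \<one>" if "l \<in> stab \<one>" for l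
    using that h S.inv_op_closed2[OF H_carrier[OF h]]
      subgroup.m_closed[OF subgroup_H] subgroup.m_inv_closed[OF subgroup_H]
    by (auto simp: stab_one)
qed

context
  assumes card: "card S = p\<^sup>2"
begin

lemma conj_stab_eq:
  assumes x: "x \<in> carrier G" and y: "y \<in> carrier G" and k: "k \<in> stab x" "k \<in> stab y"
  shows "x \<otimes> k \<otimes> inv x = y \<otimes> k \<otimes> inv y"
proof (cases "k = \<one>")
  case False
  note one = G.one_closed and kG = stab_carrier[OF k(1)]
  define u v g where "u = x \<otimes> k \<otimes> inv x" and "v = y \<otimes> k \<otimes> inv y" and "g = y \<otimes> inv x"
  have g: "g \<in> carrier G" using x y by (simp add: g_def)
  have u: "u \<in> stab \<one>" and v: "v \<in> stab \<one>"
    using k S.inv_op_closed2[OF _ stab_S[OF k(1)]] x y unfolding stab_one by (auto simp: u_def v_def stab_def)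
  have "u \<noteq> \<one>" using False x kG G.conj_eq_iff(1)[OF x kG one] by (simp add: u_def)
  have guv: "g \<otimes> u \<otimes> inv g = v" using x y kG by (simp add: g_def u_def v_def G.word_simps)
  have "g \<otimes> w \<otimes> inv g \<in> stab \<one>" if w: "w \<in> stab \<one>" for w
  proof -
    obtain i where "w = u [^] (i::nat)"
      using G.prime_order_subgroup_nat_pow[OF subgroup_stab[OF one] prime_card_stab[OF card one] u \<open>u \<noteq> \<one>\<close> w] by blast
    then show ?thesis using G.conj_nat_pow[OF g stab_carrier[OF u]] guv stab_nat_pow_closed[OF one v] by simp
  qed
  then have "g \<otimes> u = u \<otimes> g" using in_centralizer_if_normalizes[OF g _ u] by blast
  then have "g \<otimes> u \<otimes> inv g = u" using G.conj_eq_iff(1)[OF g] stab_carrier[OF u] by blast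
  then show ?thesis using guv by (simp add: u_def v_def)
qed (use x y in simp)

lemma invariant_crossed_hom_induced:
  assumes \<chi>: "G.character H \<chi>"
  shows "invariant_crossed_hom (induced \<chi>)"
  unfolding invariant_crossed_hom_def
proof (intro conjI ballI)
  show "crossed_hom S (induced \<chi>)" by (rule crossed_hom_subset[OF crossed_hom_induced[OF \<chi>] S.subset])
  show "constant_on_fixed_points (induced \<chi>)"
    unfolding constant_on_fixed_points_def
  proof (intro ballI)
    fix x y k assume "x \<in> carrier G" "y \<in> carrier G" "k \<in> stab x \<inter> stab y"
    then show "induced \<chi> k x = induced \<chi> k y" using conj_stab_eq[of x y k] by (simp add: induced_stab[OF \<chi>])
  qed
  fix x g k assume x: "x \<in> carrier G" and g: "g \<in> carrier G" and k: "k \<in> stab x"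
  have "inv g \<otimes> k \<otimes> g \<in> stab (x \<otimes> g)" using stab_conj_iff[OF x g stab_S[OF k]] k by simp
  then show "induced \<chi> (inv g \<otimes> k \<otimes> g) (x \<otimes> g) = induced \<chi> k x"
    using x g k stab_carrier[OF k] by (simp add: induced_stab[OF \<chi>] G.word_simps)
qed

lemma exists_invariant_crossed_hom:
  obtains c :: "'a \<Rightarrow> 'a \<Rightarrow> circle" and k where "crossed_hom (carrier G) c" "invariant_crossed_hom c"
    "\<forall>g\<in>carrier G. \<forall>x\<in>carrier G. p \<cdot> c g x = 0" "k \<in> stab \<one>" "c k \<one> \<noteq> 0"
proof -
  let ?K = "stab \<one>"
  note one = G.one_closed
  note K = subgroup_stab[OF one]
  have KH: "?K \<subseteq> H" by (simp add: stab_one)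
  obtain a :: "'a \<Rightarrow> circle" where a: "G.character ?K a" and faithful: "\<forall>k\<in>?K. k \<noteq> \<one> \<longrightarrow> a k \<noteq> 0"
    using G.exists_faithful_character[OF K prime_card_stab[OF card one]] by metis
  define \<chi> where "\<chi> = G.transfer ?K H a"
  have \<chi>: "G.character H \<chi>" unfolding \<chi>_def by (rule G.character_transfer[OF K subgroup_H KH a])
  have a_torsion: "p \<cdot> a k = 0" if "k \<in> ?K" for k
    using G.character_nat_pow[OF K a that, of p] S_nat_pow_p[OF stab_S[OF that]] G.character_one[OF K a] by simp
  have torsion: "p \<cdot> \<chi> h = 0" if "h \<in> H" for h
    unfolding \<chi>_def by (rule G.ntimes_transfer_zero[OF K subgroup_H KH a a_torsion that])
  have "?K \<noteq> {\<one>}" using prime_card_stab[OF card one] by auto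
  then obtain k where k: "k \<in> ?K" "k \<noteq> \<one>" using one_in_stab[OF one] by blast
  have "\<chi> k = card (cosets_in G ?K H) \<cdot> a k"
    unfolding \<chi>_def by (rule G.transfer_central[OF K subgroup_H KH a H_commute_stab_one[OF _ k(1)] k(1)])
  moreover have "coprime (card (cosets_in G ?K H)) p"
    using coprime_card_cosets_in_S_Int[OF subgroup_H] by (simp add: stab_one)
  ultimately have "\<chi> k \<noteq> 0" using ntimes_coprime_zero a_torsion k faithful by metis
  then have "induced \<chi> k \<one> \<noteq> 0" using induced_stab[OF \<chi> one k(1)] stab_carrier[OF k(1)] by simp
  moreover have "p \<cdot> induced \<chi> g x = 0" if "g \<in> carrier G" "x \<in> carrier G" for g x
    using that by (simp add: induced_def ntimes_diff_right torsion G.retract_mem[OF subgroup_H])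
  ultimately show ?thesis
    using that[OF crossed_hom_induced[OF \<chi>] invariant_crossed_hom_induced[OF \<chi>] _ k(1)] by blast
qed

end

end

lemma not_coboundary_if_nonzero_at_one:
  assumes comm: "commutator_subgroup G S (carrier G) = S" and c: "crossed_hom (carrier G) c"
    and k: "k \<in> stab \<one>" "c k \<one> \<noteq> 0"
  shows "\<not> coboundary_mod_const (carrier G) c"
proof
  assume "coboundary_mod_const (carrier G) c"
  then obtain m e where m: "left_invariant m"
    and me: "\<And>g x. \<lbrakk>g \<in> carrier G; x \<in> carrier G\<rbrakk> \<Longrightarrow> c g x = m (x \<otimes> g) - m x + e g"
    using coboundary_mod_constE by blast
  have "crossed_hom (carrier G) (\<lambda>g x. c g x - (m (x \<otimes> g) - m x))"
    by (rule crossed_hom_diff[OF c crossed_hom_coboundary[OF m subset_refl]])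
  from character_if_crossed_hom_const[OF this _ G.subgroup_self, of e]
  have "G.character (carrier G) e" by (simp add: me)
  then have "e k = 0" using G.character_commutator_subgroup[OF _ S.subset] stab_S[OF k(1)] unfolding comm by blast
  then show False
    using me[OF stab_carrier[OF k(1)] G.one_closed] left_invariant_stab[OF m G.one_closed k(1)] k(2) by simp
qed

lemma coboundary_in_S_Int_if_not_S_subset:
  assumes card: "card S = p\<^sup>2" and c: "crossed_hom S c" "constant_on_fixed_points c"
    and D: "subgroup D G" "\<not> S \<subseteq> D"
  shows "coboundary_mod_const (S \<inter> D) c"
proof (cases "\<exists>x\<in>carrier G. \<exists>k\<in>stab x \<inter> D. k \<noteq> \<one>")
  case True
  then obtain x k where x: "x \<in> carrier G" and k: "k \<in> stab x" "k \<in> D" "k \<noteq> \<one>" by blast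
  have sub: "S \<inter> D \<subseteq> stab x" using S_subset_if_meets_stab[OF card D(1) x k] D(2) by blast
  then have "G.character (S \<inter> D) (\<lambda>g. c g x)"
    using character_on_stab[OF c(1) x] by (auto simp: G.character_def)
  then have "crossed_hom (S \<inter> D) (\<lambda>g z. c g z - c g x)"
    by (rule crossed_hom_diff_character[OF crossed_hom_subset[OF c(1) Int_lower1]])
  then have "coboundary_mod_const (S \<inter> D) (\<lambda>g z. c g z - c g x)"
    by (rule coboundary_in_S_if_vanishes_on_stabilisers[OF subgroup_S_Int[OF D(1)] Int_lower1])
      (use sub constant_on_fixed_pointsD[OF c(2) _ x] in auto)
  then show ?thesis by (simp add: coboundary_mod_const_diff_const_iff)
next
  case False
  show ?thesis
  proof (rule coboundary_in_S_if_vanishes_on_stabilisers[OF subgroup_S_Int[OF D(1)] Int_lower1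
        crossed_hom_subset[OF c(1) Int_lower1]])
    fix k x assume "k \<in> S \<inter> D" and x: "x \<in> carrier G" and "k \<in> stab x"
    then have "k = \<one>" using False by blast
    then show "c k x = 0" using G.character_one[OF subgroup_stab[OF x] character_on_stab[OF c(1) x]] by simp
  qed
qed

lemma coboundary_if_not_S_subset:
  assumes card: "card S = p\<^sup>2" and c: "crossed_hom (carrier G) c" "constant_on_fixed_points c"
    and torsion: "\<And>g x. \<lbrakk>g \<in> carrier G; x \<in> carrier G\<rbrakk> \<Longrightarrow> p \<cdot> c g x = 0"
    and D: "subgroup D G" "\<not> S \<subseteq> D"
  shows "coboundary_mod_const D c"
proof (rule coboundary_mod_const_if_on_Sylow[OF D(1) cocycle_mod_const_if_crossed_hom[OF c(1)]])
  show "coboundary_mod_const (S \<inter> D) c"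
    by (rule coboundary_in_S_Int_if_not_S_subset[OF card crossed_hom_subset[OF c(1) S.subset] c(2) D])
  show "coboundary_mod_const D (\<lambda>g x. (p ^ 1) \<cdot> c g x)"
    by (rule coboundary_mod_const_if_const[where e = "\<lambda>_. 0"]) (use torsion subgroup.mem_carrier[OF D(1)] in simp)
qed

end

section \<open>The primary part\<close>

context core_free_sylow
begin

lemma coboundary_if_on_S:
  assumes "cocycle_mod_const (carrier G) b" "coboundary_mod_const S b"
    and "coboundary_mod_const (carrier G) (\<lambda>g x. (p ^ k) \<cdot> b g x)"
  shows "coboundary_mod_const (carrier G) b"
proof -
  have "S \<inter> carrier G = S" using S.subset by blast
  then show ?thesis using coboundary_mod_const_if_on_Sylow[OF G.subgroup_self assms(1) _ assms(3)] assms(2) by simp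
qed

context
  fixes \<D> :: "'a set set"
begin

abbreviation primary_Sha :: "('a \<times> 'a \<Rightarrow> ('a \<Rightarrow> int) set) set monoid" where
  "primary_Sha \<equiv> primary_part p (Sha2 G \<D> (J G H) (J_act G))"

lemma primary_Sha_one: "\<one>\<^bsub>primary_Sha\<^esub> = \<one>\<^bsub>H2 G (J G H) (J_act G)\<^esub>"
  by (simp add: primary_part_def Sha2_simps)

lemma primary_Sha_pow: "x [^]\<^bsub>primary_Sha\<^esub> (n::nat) = x [^]\<^bsub>H2 G (J G H) (J_act G)\<^esub> n"
  by (simp add: primary_part_def nat_pow_def Sha2_def)

context
  assumes \<D>: "\<And>D. D \<in> \<D> \<Longrightarrow> subgroup D G"
begin

lemma comm_group_primary_Sha: "comm_group primary_Sha"
  by (rule comm_group_primary_part[OF comm_group_Sha2[OF \<D>]])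

lemma connecting_in_primary_Sha_iff:
  assumes "cocycle_mod_const (carrier G) b"
  shows "connecting b \<in> carrier primary_Sha \<longleftrightarrow>
    (\<forall>D\<in>\<D>. coboundary_mod_const D b) \<and> (\<exists>k. coboundary_mod_const (carrier G) (\<lambda>g x. (p ^ k) \<cdot> b g x))"
  using connecting_in_Sha2_iff[OF \<D> assms] connecting_pow_eq_one_iff[OF assms]
  by (simp add: primary_part_def Sha2_simps)

lemma primary_ShaE:
  assumes "y \<in> carrier primary_Sha"
  obtains b k where "cocycle_mod_const (carrier G) b" "y = connecting b" "\<forall>D\<in>\<D>. coboundary_mod_const D b"
    "coboundary_mod_const (carrier G) (\<lambda>g x. (p ^ k) \<cdot> b g x)"
proof -
  have y: "y \<in> carrier (Sha2 G \<D> (J G H) (J_act G))" using assms by (simp add: primary_part_def)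
  obtain b where b: "cocycle_mod_const (carrier G) b" "y = connecting b"
    using Sha2E[OF \<D> y] unfolding locally_trivial_cocycles_def by auto
  then show ?thesis using that assms connecting_in_primary_Sha_iff[OF b(1)] by blast
qed

lemma primary_Sha_trivialI:
  assumes "\<And>b :: 'a \<Rightarrow> 'a \<Rightarrow> circle.
    \<lbrakk>cocycle_mod_const (carrier G) b; \<forall>D\<in>\<D>. coboundary_mod_const D b\<rbrakk> \<Longrightarrow> coboundary_mod_const S b"
  shows "carrier primary_Sha = {\<one>\<^bsub>primary_Sha\<^esub>}"
proof -
  interpret A: comm_group primary_Sha by (rule comm_group_primary_Sha)
  have "y = \<one>\<^bsub>primary_Sha\<^esub>" if y: "y \<in> carrier primary_Sha" for y
  proof -
    obtain b k where b: "cocycle_mod_const (carrier G) b" "y = connecting b" "\<forall>D\<in>\<D>. coboundary_mod_const D b"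
      "coboundary_mod_const (carrier G) (\<lambda>g x. (p ^ k) \<cdot> b g x)"
      using primary_ShaE[OF y] .
    have "coboundary_mod_const (carrier G) b" by (rule coboundary_if_on_S[OF b(1) assms[OF b(1,3)] b(4)])
    then show ?thesis unfolding primary_Sha_one using connecting_eq_one_iff[OF b(1)] b(2) by simp
  qed
  then show ?thesis using A.one_closed by blast
qed

lemma primary_Sha_trivial_if_S_subset:
  assumes "D \<in> \<D>" "S \<subseteq> D"
  shows "carrier primary_Sha = {\<one>\<^bsub>primary_Sha\<^esub>}"
proof (rule primary_Sha_trivialI)
  fix b :: "'a \<Rightarrow> 'a \<Rightarrow> circle"
  assume "\<forall>D\<in>\<D>. coboundary_mod_const D b"
  then show "coboundary_mod_const S b" using coboundary_mod_const_subset assms by blast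
qed

context
  assumes cyclic: "\<And>g. g \<in> S \<Longrightarrow> generate G {g} \<in> \<D>"
begin

lemma conditions_if_primary_Sha_nontrivial:
  assumes "carrier primary_Sha \<noteq> {\<one>\<^bsub>primary_Sha\<^esub>}"
  shows "card S = p\<^sup>2 \<and> commutator_subgroup G S (carrier G) = S
    \<and> normalizer G (S \<inter> H) = centralizer G (S \<inter> H)"
proof -
  obtain b :: "'a \<Rightarrow> 'a \<Rightarrow> circle" where b: "cocycle_mod_const (carrier G) b"
    "\<forall>D\<in>\<D>. coboundary_mod_const D b" "\<not> coboundary_mod_const S b"
    using primary_Sha_trivialI assms by blast
  have "coboundary_mod_const (generate G {g}) b" if "g \<in> S" for g using b(2) cyclic[OF that] by blast
  from conditions_if_nontrivial_on_S[OF b(1) this b(3)] show ?thesis by blast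
qed

lemma primary_Sha_generated:
  assumes card: "card S = p\<^sup>2" and c: "invariant_crossed_hom c" "crossed_hom (carrier G) c"
    and torsion: "coboundary_mod_const (carrier G) (\<lambda>g x. p \<cdot> c g x)"
    and k: "k \<in> stab \<one>" "c k \<one> \<noteq> 0" and y: "y \<in> carrier primary_Sha"
  shows "\<exists>j::nat. y = connecting c [^]\<^bsub>primary_Sha\<^esub> j"
proof -
  obtain b i where b: "cocycle_mod_const (carrier G) b" "y = connecting b" "\<forall>D\<in>\<D>. coboundary_mod_const D b"
    and b_torsion: "coboundary_mod_const (carrier G) (\<lambda>g x. (p ^ i) \<cdot> b g x)"
    using primary_ShaE[OF y] .
  have "coboundary_mod_const (generate G {g}) b" if "g \<in> S" for g using b(3) cyclic[OF that] by blast
  then obtain j where j: "coboundary_mod_const S (\<lambda>g z. b g z - j \<cdot> c g z)"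
    using multiple_of_invariantE[OF card b(1) _ c(1) k] by blast
  note cocycle_c = cocycle_mod_const_if_crossed_hom[OF c(2)]
  note jc = cocycle_mod_const_ntimes[OF cocycle_c, of j]
  have "coboundary_mod_const (carrier G) (\<lambda>g x. p \<cdot> (p ^ i) \<cdot> b g x - (p ^ i * j) \<cdot> p \<cdot> c g x)"
    by (rule coboundary_mod_const_diff[OF
          coboundary_mod_const_ntimes[OF b_torsion] coboundary_mod_const_ntimes[OF torsion]])
  moreover have "p \<cdot> (p ^ i) \<cdot> u - (p ^ i * j) \<cdot> p \<cdot> v = (p ^ (i + 1)) \<cdot> (u - j \<cdot> v)" for u v :: circle
    by (simp add: ntimes_diff_right mult_ac flip: ntimes_mult)
  ultimately have "coboundary_mod_const (carrier G) (\<lambda>g x. (p ^ (i + 1)) \<cdot> (b g x - j \<cdot> c g x))" by simp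
  from connecting_eqI[OF b(1) jc coboundary_if_on_S[OF cocycle_mod_const_diff[OF b(1) jc] j this]]
  have "y = connecting c [^]\<^bsub>primary_Sha\<^esub> j"
    unfolding primary_Sha_pow using connecting_pow[OF cocycle_c] b(2) by simp
  then show ?thesis ..
qed

context
  assumes conditions: "card S = p\<^sup>2" "commutator_subgroup G S (carrier G) = S"
      "normalizer G (S \<inter> H) = centralizer G (S \<inter> H)"
    and not_subset: "\<And>D. D \<in> \<D> \<Longrightarrow> \<not> S \<subseteq> D"
begin

lemma primary_Sha_generatorE:
  obtains x where "x \<in> carrier primary_Sha" "x \<noteq> \<one>\<^bsub>primary_Sha\<^esub>" "x [^]\<^bsub>primary_Sha\<^esub> p = \<one>\<^bsub>primary_Sha\<^esub>"
    "\<forall>y\<in>carrier primary_Sha. \<exists>j::nat. y = x [^]\<^bsub>primary_Sha\<^esub> j"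
proof -
  obtain c :: "'a \<Rightarrow> 'a \<Rightarrow> circle" and k where c: "crossed_hom (carrier G) c" "invariant_crossed_hom c"
    and torsion: "\<forall>g\<in>carrier G. \<forall>x\<in>carrier G. p \<cdot> c g x = 0" and k: "k \<in> stab \<one>" "c k \<one> \<noteq> 0"
    using exists_invariant_crossed_hom[OF conditions(3,1)] .
  note cocycle = cocycle_mod_const_if_crossed_hom[OF c(1)]
  have coboundary: "coboundary_mod_const (carrier G) (\<lambda>g x. p \<cdot> c g x)"
    by (rule coboundary_mod_const_if_const[where e = "\<lambda>_. 0"]) (use torsion in simp)
  have "coboundary_mod_const D c" if "D \<in> \<D>" for D
    by (rule coboundary_if_not_S_subset[OF conditions(1) c(1) invariant_crossed_homD(2)[OF c(2)]
          _ \<D>[OF that] not_subset[OF that]])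
      (use torsion in blast)
  moreover have "coboundary_mod_const (carrier G) (\<lambda>g x. (p ^ 1) \<cdot> c g x)" using coboundary by simp
  ultimately have "connecting c \<in> carrier primary_Sha" using connecting_in_primary_Sha_iff[OF cocycle] by blast
  moreover have "connecting c \<noteq> \<one>\<^bsub>primary_Sha\<^esub>"
    unfolding primary_Sha_one
    using connecting_eq_one_iff[OF cocycle] not_coboundary_if_nonzero_at_one[OF conditions(2) c(1) k] by simp
  moreover have "connecting c [^]\<^bsub>primary_Sha\<^esub> p = \<one>\<^bsub>primary_Sha\<^esub>"
    unfolding primary_Sha_pow primary_Sha_one using connecting_pow_eq_one_iff[OF cocycle] coboundary by simp
  moreover have "\<exists>j::nat. y = connecting c [^]\<^bsub>primary_Sha\<^esub> j" if "y \<in> carrier primary_Sha" for y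
    by (rule primary_Sha_generated[OF conditions(1) c(2,1) coboundary k that])
  ultimately show ?thesis using that[of "connecting c"] by blast
qed

theorem primary_Sha_iso: "primary_Sha \<cong> integer_mod_group p"
proof -
  interpret A: comm_group primary_Sha by (rule comm_group_primary_Sha)
  obtain x where x: "x \<in> carrier primary_Sha" "x \<noteq> \<one>\<^bsub>primary_Sha\<^esub>" "x [^]\<^bsub>primary_Sha\<^esub> p = \<one>\<^bsub>primary_Sha\<^esub>"
    and generates: "\<forall>y\<in>carrier primary_Sha. \<exists>j::nat. y = x [^]\<^bsub>primary_Sha\<^esub> j"
    by (rule primary_Sha_generatorE)
  show ?thesis by (rule A.cyclic_iso_integer_mod_group[OF prime_p x]) (use generates in blast)
qed

lemma primary_Sha_nontrivial: "carrier primary_Sha \<noteq> {\<one>\<^bsub>primary_Sha\<^esub>}"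
  by (rule primary_Sha_generatorE) blast

end

end

end

end

lemma S_iso_iff_card: "G\<lparr>carrier := S\<rparr> \<cong> integer_mod_group p \<times>\<times> integer_mod_group p \<longleftrightarrow> card S = p\<^sup>2"
proof
  assume "G\<lparr>carrier := S\<rparr> \<cong> integer_mod_group p \<times>\<times> integer_mod_group p"
  then have "card S = card (carrier (integer_mod_group p \<times>\<times> integer_mod_group p))"
    using iso_same_card by fastforce
  then show "card S = p\<^sup>2"
    using prime_gt_0_nat[OF prime_p] by (simp add: carrier_integer_mod_group power2_eq_square)
next
  assume card: "card S = p\<^sup>2"
  note one = G.one_closed
  obtain y where y: "y \<in> carrier G" "stab \<one> \<noteq> stab y" using exists_other_stab[OF card_S_neq_p[OF card]] by metis
  have "k = \<one>" if "k \<in> stab \<one> \<inter> stab y" for k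
    using that y G.prime_order_subgroup_eq_generate[OF subgroup_stab prime_card_stab[OF card]] one by blast
  then have "stab \<one> \<inter> stab y = {\<one>}" using one_in_stab one y(1) by blast
  moreover have "G\<lparr>carrier := stab x\<rparr> \<cong> integer_mod_group p" if "x \<in> carrier G" for x
    using G.prime_order_subgroup_iso[OF subgroup_stab[OF that] prime_card_stab[OF card that]]
      card_stab_eq_p[OF card that] by simp
  ultimately show "G\<lparr>carrier := S\<rparr> \<cong> integer_mod_group p \<times>\<times> integer_mod_group p"
    using S_iso_DirProd_if_disjoint[OF one y(1,2)] one y(1) by blast
qed

lemma not_S_subset_cyclic:
  assumes card: "card S = p\<^sup>2" and D: "D \<in> cyclic_subgroups G"
  shows "\<not> S \<subseteq> D"
proof
  assume "S \<subseteq> D"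
  then obtain g where "g \<in> carrier G" "S \<subseteq> generate G {g}" using D by (auto simp: cyclic_subgroups_def)
  then have "card S \<le> p"
    using G.card_le_exponent_if_subset_cyclic[OF finite_G _ _ prime_gt_0_nat[OF prime_p] S_nat_pow_p] by blast
  then show False using card prime_gt_1_nat[OF prime_p] by (simp add: power2_eq_square)
qed

end

lemma admissibleD:
  assumes "admissible G \<D>"
  shows "D \<in> \<D> \<Longrightarrow> subgroup D G" "g \<in> carrier G \<Longrightarrow> generate G {g} \<in> \<D>"
  using assms by (auto simp: admissible_def cyclic_subgroups_def)

lemma (in group) admissible_cyclic_subgroups:
  assumes "finite (carrier G)"
  shows "admissible G (cyclic_subgroups G)"
  unfolding admissible_def
proof (intro conjI ballI)
  have "cyclic_subgroups G = (\<lambda>g. generate G {g}) ` carrier G" by (auto simp: cyclic_subgroups_def)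
  then show "finite (cyclic_subgroups G)" using assms by simp
  show "subgroup D G" if "D \<in> cyclic_subgroups G" for D
    using that generate_is_subgroup by (auto simp: cyclic_subgroups_def)
  fix D g assume "D \<in> cyclic_subgroups G" and g: "g \<in> carrier G"
  then obtain x where x: "x \<in> carrier G" "D = generate G {x}" by (auto simp: cyclic_subgroups_def)
  have xg: "g \<otimes> x \<otimes> inv g \<in> carrier G" using g x by simp
  have "g <# D #> inv g = generate G {g \<otimes> x \<otimes> inv g}"
    unfolding conj_set_eq_image x(2) generate_pow_on_finite_carrier[OF assms x(1)]
      generate_pow_on_finite_carrier[OF assms xg]
    by (auto simp: image_iff conj_nat_pow[OF g x(1)]) (metis conj_nat_pow[OF g x(1)])
  then show "g <# D #> inv g \<in> cyclic_subgroups G" using xg by (auto simp: cyclic_subgroups_def)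
qed simp

section \<open>Transitive groups\<close>

context
  fixes n :: nat and G :: "(nat \<Rightarrow> nat) monoid" (structure)
  assumes transitive: "transitive_group n G"
begin

lemma transitive_group_eq: "G = (sym_group n)\<lparr>carrier := carrier G\<rparr>"
  using transitive by (simp add: transitive_group_def)

lemma group_transitive_group: "group G"
  using group.subgroup_imp_group[OF sym_group_is_group, of "carrier G" n] transitive
  by (metis transitive_group_def)

lemma transitive_group_mult: "x \<otimes> y = x \<circ> y"
  by (subst transitive_group_eq) (simp add: sym_group_mult)

lemma transitive_group_one: "\<one> = id"
  by (subst transitive_group_eq) (simp add: sym_group_one)

lemma transitive_group_permutes: "g \<in> carrier G \<Longrightarrow> g permutes {1..n}"
  using transitive subgroup.subset by (fastforce simp: transitive_group_def sym_group_carrier)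

lemma finite_transitive_group: "finite (carrier G)"
  by (rule finite_subset[OF _ finite_permutations[of "{1..n}"]]) (auto dest: transitive_group_permutes)

lemma transitive_groupE:
  assumes "i \<in> {1..n}" "j \<in> {1..n}"
  obtains g where "g \<in> carrier G" "g i = j"
  using transitive assms unfolding transitive_group_def by blast

lemma transitive_group_action: "group_action G {1..n} (\<lambda>g. restrict g {1..n})"
proof -
  have Bij: "restrict g {1..n} \<in> Bij {1..n}" if "g \<in> carrier G" for g
  proof -
    have "bij_betw (restrict g {1..n}) {1..n} {1..n} \<longleftrightarrow> bij_betw g {1..n} {1..n}" by (rule bij_betw_cong) simp
    then show ?thesis using permutes_imp_bij[OF transitive_group_permutes[OF that]] by (simp only: Bij_def) simp
  qed
  have "restrict (g \<circ> h) {1..n} = compose {1..n} (restrict g {1..n}) (restrict h {1..n})" if "h \<in> carrier G" for g h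
    using permutes_in_image[OF transitive_group_permutes[OF that]] by (auto simp: compose_def fun_eq_iff)
  then have "(\<lambda>g. restrict g {1..n}) \<in> hom G (BijGroup {1..n})"
    using Bij by (intro homI) (simp_all add: BijGroup_def transitive_group_mult del: One_nat_def)
  then show ?thesis
    using group_transitive_group group_BijGroup
    by (simp add: group_action_def group_hom_def group_hom_axioms_def del: One_nat_def)
qed

lemma corresponding_subgroup_orbit_stabilizer:
  assumes "corresponding_subgroup n G H"
  shows "subgroup H G" "order G = n * card H"
proof -
  interpret act: group_action G "{1..n}" "\<lambda>g. restrict g {1..n}" by (rule transitive_group_action)
  obtain i where i: "i \<in> {1..n}" and "H = stabilizer G (\<lambda>g. g) i"
    using assms by (auto simp: corresponding_subgroup_def)
  then have H: "H = stabilizer G (\<lambda>g. restrict g {1..n}) i" by (simp add: stabilizer_def)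
  have "orbit G (\<lambda>g. restrict g {1..n}) i = {1..n}"
  proof (intro equalityI subsetI)
    fix j assume "j \<in> {1..n}"
    then obtain g where "g \<in> carrier G" "g i = j" using transitive_groupE i by blast
    then show "j \<in> orbit G (\<lambda>g. restrict g {1..n}) i" using i by (auto simp: orbit_def)
  qed (use i permutes_in_image[OF transitive_group_permutes] in \<open>auto simp: orbit_def\<close>)
  then show "subgroup H G" "order G = n * card H"
    using act.stabilizer_subgroup[OF i] act.orbit_stabilizer_theorem[OF i] by (simp_all add: H)
qed

lemma corresponding_subgroup_core_free:
  assumes H: "corresponding_subgroup n G H" and g: "g \<in> carrier G"
    and core: "\<And>x. x \<in> carrier G \<Longrightarrow> x \<otimes> g \<otimes> inv x \<in> H"
  shows "g = \<one>"
proof -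
  interpret G: group G by (rule group_transitive_group)
  obtain i where i: "i \<in> {1..n}" and H: "H = {g \<in> carrier G. g i = i}"
    using H by (auto simp: corresponding_subgroup_def stabilizer_def)
  have "g j = j" for j
  proof (cases "j \<in> {1..n}")
    case True
    then obtain y where y: "y \<in> carrier G" "y i = j" using transitive_groupE[OF i] by blast
    have "(inv y) (g j) = i" using core[OF G.inv_closed[OF y(1)]] y by (simp add: H transitive_group_mult)
    then have "(y \<otimes> inv y) (g j) = j" using y(2) by (simp add: transitive_group_mult)
    then show ?thesis using y(1) by (simp add: transitive_group_one)
  next
    case False
    then show ?thesis using permutes_not_in[OF transitive_group_permutes[OF g]] by blast
  qed
  then show ?thesis by (simp add: transitive_group_one fun_eq_iff)
qed

end

lemma (in group) sylow_subgroup_coprime_index: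
  assumes p: "prime p" and fin: "finite (carrier G)" and S: "sylow_subgroup p G S"
  shows "coprime p (card (rcosets S))"
proof (rule prime_imp_coprime[OF p], rule notI)
  assume "p dvd card (rcosets S)"
  then have "p * card S dvd order G"
    using lagrange S by (metis dvd_refl mult_dvd_mono sylow_subgroup_def)
  then have "p ^ Suc (multiplicity p (order G)) dvd order G" using S by (simp add: sylow_subgroup_def)
  moreover have "order G \<noteq> 0" using fin by (simp add: order_def) blast
  ultimately show False
    using power_dvd_iff_le_multiplicity[of "order G" p] p by (metis Suc_n_not_le_n not_prime_unit)
qed

lemma (in normal_sylow) card_S_eq_prime_mult:
  assumes n: "order G = n * card H" "p dvd n" "\<not> p\<^sup>2 dvd n"
  shows "card S = p * card (S \<inter> H)"
proof -
  note SH = subgroup_S_Int[OF subgroup_H]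
  obtain a where a: "card S = p ^ a" using card_S_power by blast
  let ?h = "card (cosets_in G (S \<inter> H) H)" and ?c = "card (cosets_in G (S \<inter> H) S)"
  have h: "?h * card (S \<inter> H) = card H" and c: "?c * card (S \<inter> H) = card S"
    using G.card_cosets_in[OF SH] subgroup_H S.subgroup_axioms by simp_all
  have "card (rcosets S) * ?c * card (S \<inter> H) = n * ?h * card (S \<inter> H)"
    using G.lagrange[OF S.subgroup_axioms] c h n(1) by (simp add: mult.assoc)
  moreover have "0 < card (S \<inter> H)" using G.finite_subgroup_card_pos[OF SH] finite_S by simp
  ultimately have index: "card (rcosets S) * ?c = n * ?h" by (metis mult_cancel2 less_irrefl)
  obtain e where e: "?c = p ^ e" using divides_primepow_nat[OF prime_p] a c by (metis dvd_triv_left)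
  have coprime: "coprime ?h p" by (rule coprime_card_cosets_in_S_Int[OF subgroup_H])
  have "p dvd p ^ e"
    using index n(2) coprime_index e by (metis coprime_dvd_mult_right_iff dvd_mult2)
  then have "e \<noteq> 0" using prime_p by (metis not_prime_unit power_0)
  moreover have "\<not> p\<^sup>2 dvd p ^ e"
  proof
    assume "p\<^sup>2 dvd p ^ e"
    then have "p\<^sup>2 dvd n * ?h" using index e by (metis dvd_mult)
    moreover have "coprime (p\<^sup>2) ?h" using coprime by (simp add: coprime_commute)
    ultimately show False using n(3) by (simp add: coprime_dvd_mult_left_iff)
  qed
  then have "\<not> 2 \<le> e" using le_imp_power_dvd by blast
  ultimately have "e = 1" by linarith
  then show ?thesis using c e by simp
qed

lemma core_free_sylow_if_transitive:
  assumes p: "prime p" and tr: "transitive_group n G" and n: "p dvd n" "\<not> p\<^sup>2 dvd n"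
    and H: "corresponding_subgroup n G H" and sylow: "sylow_subgroup p G S" and S: "S \<lhd> G"
  shows "core_free_sylow G H S p"
proof -
  note G = group_transitive_group[OF tr] and finite = finite_transitive_group[OF tr]
  note subgroup_H = corresponding_subgroup_orbit_stabilizer(1)[OF tr H]
    and order = corresponding_subgroup_orbit_stabilizer(2)[OF tr H]
  interpret normal_sylow G H S p
    using sylow unfolding sylow_subgroup_def
    by (intro normal_sylow.intro coset_module.intro coset_module_axioms.intro normal_sylow_axioms.intro
        G subgroup_H S finite p group.sylow_subgroup_coprime_index[OF G p finite sylow]) blast
  show ?thesis
    by (intro core_free_sylow.intro core_free_sylow_axioms.intro normal_sylow_axioms card_S_eq_prime_mult[OF order n]
        corresponding_subgroup_core_free[OF tr H])
qed

lemma (in core_free_sylow) Sha2_omega_primary_part_nontrivial_iff: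
  "carrier (primary_part p (Sha2_omega G (J G H) (J_act G)))
      \<noteq> {\<one>\<^bsub>primary_part p (Sha2_omega G (J G H) (J_act G))\<^esub>}
    \<longleftrightarrow> card S = p\<^sup>2 \<and> commutator_subgroup G S (carrier G) = S
      \<and> normalizer G (S \<inter> H) = centralizer G (S \<inter> H)"
  (is "?nontrivial \<longleftrightarrow> ?conditions")
proof
  note \<D> = admissibleD[OF G.admissible_cyclic_subgroups[OF finite_G]]
  show ?conditions if ?nontrivial
    by (rule conditions_if_primary_Sha_nontrivial[OF \<D>(1) _ that]) (use \<D>(2) S_carrier in auto)
  show ?nontrivial if ?conditions
    by (rule primary_Sha_nontrivial[OF \<D>(1)]) (use that \<D>(2) S_carrier not_S_subset_cyclic in auto)
qed

theorem theorem6p17: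
  fixes p n :: nat
    and G :: "(nat \<Rightarrow> nat) monoid"
    and H S :: "(nat \<Rightarrow> nat) set"
  assumes "prime p"
    and "transitive_group n G"
    and "p dvd n" and "\<not> p\<^sup>2 dvd n"
    and "corresponding_subgroup n G H"
    and "sylow_subgroup p G S"
    and "S \<lhd> G"
  shows
    "((carrier (primary_part p (Sha2_omega G (J G H) (J_act G)))
          \<noteq> {\<one>\<^bsub>primary_part p (Sha2_omega G (J G H) (J_act G))\<^esub>}
        \<longleftrightarrow> G\<lparr>carrier := S\<rparr> \<cong> integer_mod_group p \<times>\<times> integer_mod_group p
            \<and> commutator_subgroup G S (carrier G) = S
            \<and> normalizer G (S \<inter> H) = centralizer G (S \<inter> H))
      \<and> (G\<lparr>carrier := S\<rparr> \<cong> integer_mod_group p \<times>\<times> integer_mod_group p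
            \<and> commutator_subgroup G S (carrier G) = S
            \<and> normalizer G (S \<inter> H) = centralizer G (S \<inter> H)
          \<longrightarrow> (\<forall>\<D>. admissible G \<D> \<longrightarrow>
                ((\<exists>D\<in>\<D>. S \<subseteq> D) \<longrightarrow>
                   carrier (primary_part p (Sha2 G \<D> (J G H) (J_act G)))
                     = {\<one>\<^bsub>primary_part p (Sha2 G \<D> (J G H) (J_act G))\<^esub>})
                \<and> ((\<nexists>D. D \<in> \<D> \<and> S \<subseteq> D) \<longrightarrow>
                   primary_part p (Sha2 G \<D> (J G H) (J_act G)) \<cong> integer_mod_group p))))
     \<and> (\<forall>\<D>. admissible G \<D> \<longrightarrow>
          prime_to_part p (Sha2 G \<D> (J G H) (J_act G))
            \<cong> Sha2 (G Mod S) (quotient_subgroups G S \<D>)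
                 (J G (H <#>\<^bsub>G\<^esub> S)) (quotient_act (J_act G)))"
proof -
  interpret core_free_sylow G H S p by (rule core_free_sylow_if_transitive[OF assms])
  show ?thesis
    unfolding S_iso_iff_card
  proof (intro conjI allI impI Sha2_omega_primary_part_nontrivial_iff)
    fix \<D> assume "admissible G \<D>"
    note \<D> = admissibleD[OF this]
    show "prime_to_part p (Sha2 G \<D> (J G H) (J_act G))
        \<cong> Sha2 (G Mod S) (quotient_subgroups G S \<D>) (J G (H <#>\<^bsub>G\<^esub> S)) (quotient_act (J_act G))"
      by (rule prime_to_part_Sha2[OF \<D>(1)])
    show "carrier (primary_part p (Sha2 G \<D> (J G H) (J_act G)))
        = {\<one>\<^bsub>primary_part p (Sha2 G \<D> (J G H) (J_act G))\<^esub>}" if "\<exists>D\<in>\<D>. S \<subseteq> D"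
      using that primary_Sha_trivial_if_S_subset[OF \<D>(1)] by blast
    show "primary_part p (Sha2 G \<D> (J G H) (J_act G)) \<cong> integer_mod_group p"
      if "card S = p\<^sup>2 \<and> commutator_subgroup G S (carrier G) = S
          \<and> normalizer G (S \<inter> H) = centralizer G (S \<inter> H)" and "\<nexists>D. D \<in> \<D> \<and> S \<subseteq> D"
      by (rule primary_Sha_iso[OF \<D>(1)]) (use that \<D>(2) S_carrier in auto)
  qed
qed

end
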